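(* Let $G$ be a finite group, $p$ an odd prime, $S$ a Sylow $p$-subgroup of $G$ and $\mathcal{F}:=\mathcal{F}_S(G)$. Assume that there is a subgroup $D$ of $S$ with $1<|D|<|S|$ such that every subgroup of $S$ of order $|D|$ is abelian and semi-invariant in $\mathcal{F}$. Then $\mathcal{F}$ is supersolvable.
   Context: For a finite group $G$ and $S\in\mathrm{Syl}_p(G)$, $\mathcal{F}_S(G)$ is the (saturated) fusion system on $S$ whose objects are the subgroups of $S$ and whose morphisms $P\to Q$ are the maps $x\mapsto x^g$ with $g\in G$, $P^g\le Q$. Semi-invariant: a subgroup $H\le S$ is semi-invariant in a fusion system $\mathcal{F}$ on $S$ if for every subgroup $K$ with $H\le K\le S$ and every $\alpha\in\mathrm{Aut}_{\mathcal{F}}(K)$ one has $H^{\alpha}=H$. Supersolvable: a saturated fusion system $\mathcal{F}$ on $S$ is supersolvable if there is a series of subgroups $1=S_0\le S_1\le\cdots\le S_n=S$ such that each $S_i$ ($0\le i\le n$) is strongly $\mathcal{F}$-closed and $S_{i+1}/S_i$ is cyclic for $0\le i\le n-1$. (A subgroup $T\le S$ is strongly $\mathcal{F}$-closed if for every $P\le T$ and every morphism $\phi\in\mathrm{Hom}_{\mathcal{F}}(P,S)$ one has $P^{\phi}\le T$.) *)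

theory Defs
  imports "HOL-Algebra.Sylow" "HOL-Algebra.Elementary_Groups"
begin

definition sylow_subgroup :: "nat \<Rightarrow> ('a, 'b) monoid_scheme \<Rightarrow> 'a set \<Rightarrow> bool"
  where "sylow_subgroup p G S \<longleftrightarrow> subgroup S G \<and> card S = p ^ multiplicity p (order G)"

text \<open>A fusion system on a group is represented by its morphism sets: \<open>F P Q\<close> is the set of
  morphisms from \<open>P\<close> to \<open>Q\<close>, each of them a map that is extensional on its domain \<open>P\<close>.
  The objects are the subgroups of the underlying group, which is passed separately as a record.\<close>

type_synonym 'a fusion = "'a set \<Rightarrow> 'a set \<Rightarrow> ('a \<Rightarrow> 'a) set"

definition fusion_of :: "('a, 'b) monoid_scheme \<Rightarrow> 'a set \<Rightarrow> 'a fusion"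
  where "fusion_of G S P Q =
    {\<phi>. subgroup P (G\<lparr>carrier := S\<rparr>) \<and> subgroup Q (G\<lparr>carrier := S\<rparr>) \<and>
        (\<exists>g\<in>carrier G. \<phi> = (\<lambda>x\<in>P. inv\<^bsub>G\<^esub> g \<otimes>\<^bsub>G\<^esub> x \<otimes>\<^bsub>G\<^esub> g) \<and> \<phi> ` P \<subseteq> Q)}"

definition fusion_aut :: "'a fusion \<Rightarrow> 'a set \<Rightarrow> ('a \<Rightarrow> 'a) set"
  where "fusion_aut F K =
    {\<alpha> \<in> F K K. \<exists>\<beta>\<in>F K K. compose K \<beta> \<alpha> = (\<lambda>x\<in>K. x) \<and> compose K \<alpha> \<beta> = (\<lambda>x\<in>K. x)}"

definition semi_invariant :: "('a, 'b) monoid_scheme \<Rightarrow> 'a fusion \<Rightarrow> 'a set \<Rightarrow> bool"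
  where "semi_invariant S F H \<longleftrightarrow> subgroup H S \<and>
    (\<forall>K. subgroup K S \<and> H \<subseteq> K \<longrightarrow> (\<forall>\<alpha>\<in>fusion_aut F K. \<alpha> ` H = H))"

definition strongly_closed :: "('a, 'b) monoid_scheme \<Rightarrow> 'a fusion \<Rightarrow> 'a set \<Rightarrow> bool"
  where "strongly_closed S F T \<longleftrightarrow> subgroup T S \<and>
    (\<forall>P. subgroup P S \<and> P \<subseteq> T \<longrightarrow> (\<forall>\<phi>\<in>F P (carrier S). \<phi> ` P \<subseteq> T))"

text \<open>Supersolvability is a notion for saturated fusion systems; saturation is the standing
  hypothesis on \<open>F\<close>, not part of the property. (Fusion systems \<open>fusion_of G S\<close> of finite groups,
  for \<open>S\<close> a Sylow subgroup, are saturated.) Normality of \<open>T i\<close> in \<open>T (Suc i)\<close> is stated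
  explicitly because \<open>Mod\<close> denotes the quotient group only in that case.\<close>

definition supersolvable_fusion :: "('a, 'b) monoid_scheme \<Rightarrow> 'a fusion \<Rightarrow> bool"
  where "supersolvable_fusion S F \<longleftrightarrow>
    (\<exists>n (T :: nat \<Rightarrow> 'a set).
       T 0 = {\<one>\<^bsub>S\<^esub>} \<and> T n = carrier S \<and>
       (\<forall>i\<le>n. strongly_closed S F (T i)) \<and>
       (\<forall>i<n. T i \<subseteq> T (Suc i) \<and> T i \<lhd> S\<lparr>carrier := T (Suc i)\<rparr> \<and>
              cyclic_group (S\<lparr>carrier := T (Suc i)\<rparr> Mod T i)))"

end

theory Submission
  imports Defs "HOL-Number_Theory.Number_Theory"
begin

text \<open>Write \<open>|D| = p\<^sup>d\<close>. Two facts are shown: \<open>N\<^sub>G(S)\<close> controls fusion in \<open>S\<close>, and \<open>S\<close> has a series of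
  \<open>N\<^sub>G(S)\<close>-invariant subgroups with factors of order \<open>p\<close>; the members of this series are then strongly
  closed.

  For control of fusion, Alperin's argument reduces to finding, for \<open>Q < S\<close> with \<open>C\<^sub>S(Q) \<le> Q\<close> and
  \<open>N\<^sub>S(Q)\<close> Sylow in \<open>N\<^sub>G(Q)\<close>, a nontrivial normal \<open>p\<close>-subgroup of \<open>Aut\<^sub>G(Q) = N\<^sub>G(Q)/C\<^sub>G(Q)\<close>. Since subgroups of
  order \<open>p\<^sup>d\<close> are abelian, \<open>|Q| \<ge> p\<^sup>d\<close>.

  If \<open>|Q| > p\<^sup>d\<close>, there is an invariant \<open>W < Q\<close> of order \<open>p\<^sup>d\<^sup>-\<^sup>1\<close>, and a \<open>p'\<close>-automorphism that is trivial on
  all \<open>V/W\<close> of order \<open>p\<close> is trivial on \<open>Q/W\<close> (as \<open>p\<close> is odd) and then on \<open>Q\<close>: otherwise a diagonal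
  subgroup of \<open>[Q, h] C\<^sub>Q(h)\<close> of order \<open>p\<^sup>d\<close> fails to be invariant. So \<open>Aut\<^sub>G(Q)\<close> is a \<open>p\<close>-group extended by an
  abelian group of exponent dividing \<open>p - 1\<close>; for \<open>Q = S\<close> this also gives the invariant series.

  If \<open>|Q| = p\<^sup>d\<close>, the elements of order \<open>p\<close> of \<open>S/Q\<close> are central there and act on \<open>Q\<close> as transvections. Two
  conjugates that do not annihilate each other would either generate a nonabelian \<open>p\<close>-group, against
  centrality, or an \<open>SL\<^sub>2(p)\<close>, whose \<open>-1\<close> contradicts semi-invariance as \<open>p\<close> is odd. Hence these
  transvections generate a normal \<open>p\<close>-subgroup.

  Computations take place in a type class of groups; Cayley's representation by bijections embeds
  both \<open>G\<close> and quotients of its subgroups into types of that class.\<close>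

section \<open>Groups as a type class\<close>

text \<open>A normal \<open>p\<close>-subgroup of Aut_G(Q) helps because it has the form CB/C with C
  = C_G(Q) and B <= N_S(Q), where B > Q. By a Frattini argument each u in N_G(Q) agrees on Q with
  some uc, c in C, that normalises B; so the conjugation extends to a larger subgroup and induction
  applies. If C_S(Q) is not contained in Q, then B = Q C_S(Q) does the same job, which is why the
  search may assume C_S(Q) <= Q. The split at |Q| = \<open>p^d\<close> is forced. An element of
  N_G(Q) normalises every subgroup of order \<open>p^d\<close> inside Q, which is informative only
  if Q is larger than that. If |Q| = \<open>p^d\<close>, the hypothesis concerns the other subgroups
  of that order only through elements that normalise some K <= S not contained in Q. Therefore the
  element -1 of SL_2(p) must first be corrected to one that normalises K = Q<x>; the contradiction
  then comes from the subgroup generated by C_Q(x) and a product xb with b in Q moved by x.\<close>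

class group_mult = monoid_mult + inverse +
  assumes left_inv [simp]: "inverse a * a = 1"
begin

lemma inv_mult_cancel [simp]: "inverse a * (a * b) = b"
  by (simp flip: mult_assoc)

lemma left_mult_cancel [simp]: "a * b = a * c \<longleftrightarrow> b = c"
  by (metis inv_mult_cancel)

lemma right_inv [simp]: "a * inverse a = 1"
proof -
  have "inverse a * (a * inverse a) = inverse a * 1" by simp
  then show ?thesis by (simp only: left_mult_cancel)
qed

lemma mult_inv_cancel [simp]: "a * (inverse a * b) = b"
  by (simp flip: mult_assoc)

lemma right_mult_cancel [simp]: "b * a = c * a \<longleftrightarrow> b = c"
  by (metis mult_assoc right_inv mult_1_right)

lemma inv_one [simp]: "inverse 1 = 1"
  using left_inv[of 1] by (simp del: left_inv)

lemma mult_eq_1_imp_inverse: "a * b = 1 \<Longrightarrow> inverse a = b"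
  by (metis inv_mult_cancel mult_1_right)

lemma inv_inv [simp]: "inverse (inverse a) = a"
  by (rule mult_eq_1_imp_inverse) simp

lemma inv_mult [simp]: "inverse (a * b) = inverse b * inverse a"
  by (rule mult_eq_1_imp_inverse) (simp add: mult_assoc)

end

section \<open>Conjugation, subgroups, normalisers and centralisers\<close>

lemma inv_power: "inverse (a ^ n) = inverse a ^ n" for a :: "'a::group_mult"
  by (induction n) (simp_all add: power_commutes)

text \<open>The right action x^g, the convention of \<open>fusion_of\<close>; products of
  conjugators therefore act from left to right.\<close>

definition cj :: "'a::group_mult \<Rightarrow> 'a \<Rightarrow> 'a" where
  "cj g x = inverse g * x * g"

lemma cj_mult: "cj g (x * y) = cj g x * cj g y"
  by (simp add: cj_def mult.assoc)

lemma cj_prod: "cj (g * h) x = cj h (cj g x)"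
  by (simp add: cj_def mult.assoc)

lemma cj_one [simp]: "cj 1 x = x" "cj g 1 = 1"
  by (simp_all add: cj_def)

lemma cj_inverse: "cj g (inverse x) = inverse (cj g x)"
  by (simp add: cj_def mult.assoc)

lemma cj_power: "cj g (x ^ n) = cj g x ^ n"
  by (induction n) (simp_all add: cj_mult)

lemma cj_inv_cj [simp]: "cj (inverse g) (cj g x) = x" "cj g (cj (inverse g) x) = x"
  by (simp_all add: cj_def mult.assoc)

lemma cj_eq_iff [simp]: "cj g x = cj g y \<longleftrightarrow> x = y"
  by (metis cj_inv_cj(1))

lemma cj_self [simp]: "cj x x = x"
  by (simp add: cj_def mult.assoc)

lemma cj_eq_self_iff: "cj g x = x \<longleftrightarrow> x * g = g * x"
  by (metis (no_types, lifting) cj_def inv_mult_cancel mult.assoc mult_inv_cancel)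

definition subgrp :: "'a::group_mult set \<Rightarrow> bool" where
  "subgrp H \<longleftrightarrow> 1 \<in> H \<and> (\<forall>x\<in>H. \<forall>y\<in>H. x * y \<in> H) \<and> (\<forall>x\<in>H. inverse x \<in> H)"

lemma subgrp_one: "subgrp H \<Longrightarrow> 1 \<in> H"
  and subgrp_mult: "subgrp H \<Longrightarrow> x \<in> H \<Longrightarrow> y \<in> H \<Longrightarrow> x * y \<in> H"
  and subgrp_inv: "subgrp H \<Longrightarrow> x \<in> H \<Longrightarrow> inverse x \<in> H"
  by (auto simp: subgrp_def)

lemma subgrp_power: "subgrp H \<Longrightarrow> x \<in> H \<Longrightarrow> x ^ n \<in> H"
  by (induction n) (auto simp: subgrp_one subgrp_mult)

lemma subgrp_cj: "subgrp H \<Longrightarrow> x \<in> H \<Longrightarrow> g \<in> H \<Longrightarrow> cj g x \<in> H"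
  by (simp add: cj_def subgrp_mult subgrp_inv)

lemma subgrp_Int: "subgrp H \<Longrightarrow> subgrp K \<Longrightarrow> subgrp (H \<inter> K)"
  by (auto simp: subgrp_def)

lemma subgrp_trivial: "subgrp {1}"
  by (simp add: subgrp_def)

lemma subgrp_mult_iff:
  assumes "subgrp H" "x \<in> H"
  shows "x * y \<in> H \<longleftrightarrow> y \<in> H" "y * x \<in> H \<longleftrightarrow> y \<in> H"
proof -
  show "x * y \<in> H \<longleftrightarrow> y \<in> H"
    using subgrp_mult[OF assms(1) subgrp_inv[OF assms], of "x * y"] subgrp_mult[OF assms, of y] by auto
  show "y * x \<in> H \<longleftrightarrow> y \<in> H"
    using subgrp_mult[OF assms(1) _ subgrp_inv[OF assms], of "y * x"] subgrp_mult[OF assms(1) _ assms(2), of y]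
    by (auto simp: mult.assoc)
qed

lemma subgrp_inv_iff: "subgrp H \<Longrightarrow> inverse x \<in> H \<longleftrightarrow> x \<in> H"
  by (metis inv_inv subgrp_inv)

text \<open>The equivalence makes this a subgroup for every set H, also an infinite one. No ambient
  group is fixed, so N_G(H) appears as an intersection with \<open>normaliser H\<close>.\<close>

definition normaliser :: "'a::group_mult set \<Rightarrow> 'a set" where
  "normaliser H = {g. \<forall>x. cj g x \<in> H \<longleftrightarrow> x \<in> H}"

definition centraliser :: "'a::group_mult set \<Rightarrow> 'a set" where
  "centraliser H = {g. \<forall>x\<in>H. cj g x = x}"

lemma normaliserI':
  "(\<And>x. x \<in> H \<Longrightarrow> cj g x \<in> H) \<Longrightarrow> (\<And>x. cj g x \<in> H \<Longrightarrow> x \<in> H) \<Longrightarrow> g \<in> normaliser H"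
  unfolding normaliser_def by blast

lemma normaliserD: "g \<in> normaliser H \<Longrightarrow> cj g x \<in> H \<longleftrightarrow> x \<in> H"
  by (simp add: normaliser_def)

lemma normaliser_cj: "g \<in> normaliser H \<Longrightarrow> x \<in> H \<Longrightarrow> cj g x \<in> H"
  by (simp add: normaliser_def)

lemma centraliserD: "g \<in> centraliser H \<Longrightarrow> x \<in> H \<Longrightarrow> cj g x = x"
  by (simp add: centraliser_def)

lemma subgrp_normaliser: "subgrp (normaliser H)"
proof -
  have "cj (inverse g) x \<in> H \<longleftrightarrow> x \<in> H" if "g \<in> normaliser H" for g x
    using normaliserD[OF that, of "cj (inverse g) x"] by simp
  then show ?thesis by (simp add: subgrp_def normaliser_def cj_prod)
qed

lemma subgrp_centraliser: "subgrp (centraliser H)"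
proof -
  have "cj (inverse g) x = x" if "g \<in> centraliser H" "x \<in> H" for g x
    using centraliserD[OF that] by (metis cj_inv_cj(1))
  then show ?thesis by (simp add: subgrp_def centraliser_def cj_prod)
qed

lemma subgrp_le_normaliser: "subgrp H \<Longrightarrow> H \<subseteq> normaliser H"
proof
  fix g assume H: "subgrp H" and g: "g \<in> H"
  have "x \<in> H" if "cj g x \<in> H" for x
    using subgrp_cj[OF H that subgrp_inv[OF H g]] by simp
  then show "g \<in> normaliser H"
    using subgrp_cj[OF H _ g] by (intro normaliserI')
qed

lemma normaliserI:
  assumes "finite H" "\<And>x. x \<in> H \<Longrightarrow> cj g x \<in> H"
  shows "g \<in> normaliser H"
proof -
  have "inj_on (cj g) H" by (simp add: inj_on_def)
  then have "cj g ` H = H"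
    using assms by (intro card_subset_eq) (auto simp: card_image)
  then have "x \<in> H" if "cj g x \<in> H" for x
    using that by (metis cj_eq_iff imageE)
  then show ?thesis using assms(2) by (intro normaliserI')
qed

lemma centraliser_le_normaliser: "centraliser H \<subseteq> normaliser H"
proof
  fix g assume g: "g \<in> centraliser H"
  show "g \<in> normaliser H"
  proof (rule normaliserI')
    show "cj g x \<in> H" if "x \<in> H" for x using centraliserD[OF g that] that by simp
    show "x \<in> H" if "cj g x \<in> H" for x using centraliserD[OF g that] that by simp
  qed
qed

lemma normaliser_Int: "g \<in> normaliser A \<Longrightarrow> g \<in> normaliser B \<Longrightarrow> g \<in> normaliser (A \<inter> B)"
  by (auto simp: normaliser_def)

lemma cj_cj: "cj g (cj h x) = cj (cj g h) (cj g x)"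
  by (simp add: cj_def mult.assoc)

lemma normaliser_centraliser: "normaliser H \<subseteq> normaliser (centraliser H)"
proof
  fix g assume g: "g \<in> normaliser H"
  have *: "cj g n \<in> centraliser H" if "g \<in> normaliser H" "n \<in> centraliser H" for g n
  proof -
    have "cj (cj g n) x = x" if x: "x \<in> H" for x
    proof -
      have "cj (inverse g) x \<in> H"
        using normaliser_cj[OF subgrp_inv[OF subgrp_normaliser \<open>g \<in> normaliser H\<close>] x] .
      then have "cj n (cj (inverse g) x) = cj (inverse g) x"
        using \<open>n \<in> _\<close> by (simp add: centraliserD)
      then show ?thesis
        by (metis cj_cj cj_inv_cj(2))
    qed
    then show ?thesis by (simp add: centraliser_def)
  qed
  have **: "n \<in> centraliser H" if "cj g n \<in> centraliser H" for n
    using *[OF subgrp_inv[OF subgrp_normaliser g] that] by simp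
  show "g \<in> normaliser (centraliser H)"
    by (rule normaliserI'[OF *[OF g] **])
qed

lemma normaliser_centraliser_Int:
  assumes "subgrp N" "N \<subseteq> normaliser H"
  shows "N \<subseteq> normaliser (centraliser H \<inter> N)"
  using assms subgrp_le_normaliser[OF assms(1)] normaliser_centraliser[of H]
    normaliser_Int[of _ "centraliser H" N] by blast

lemma subgrp_cj_image: "subgrp H \<Longrightarrow> subgrp (cj g ` H)"
  unfolding subgrp_def
proof (intro conjI ballI)
  assume H: "1 \<in> H \<and> (\<forall>x\<in>H. \<forall>y\<in>H. x * y \<in> H) \<and> (\<forall>x\<in>H. inverse x \<in> H)"
  show "1 \<in> cj g ` H" using H by (intro image_eqI[of _ _ 1]) auto
  fix x assume "x \<in> cj g ` H"
  then show "inverse x \<in> cj g ` H" using H by (auto simp flip: cj_inverse)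
  fix y assume "y \<in> cj g ` H"
  then show "x * y \<in> cj g ` H" using H \<open>x \<in> cj g ` H\<close> by (auto simp flip: cj_mult)
qed

lemma card_cj_image: "card (cj g ` H) = card H"
  by (simp add: card_image inj_on_def)

lemma mem_cj_image: "x \<in> cj g ` H \<longleftrightarrow> cj (inverse g) x \<in> H"
  by (metis cj_inv_cj imageE image_eqI)

lemma normaliser_cj_image: "h \<in> normaliser (cj g ` H) \<longleftrightarrow> cj (inverse g) h \<in> normaliser H"
proof -
  have "(\<forall>x. P (cj (inverse g) x)) \<longleftrightarrow> (\<forall>y. P y)" for P
    by (metis cj_inv_cj(1))
  then show ?thesis
    by (simp add: normaliser_def mem_cj_image cj_cj[of "inverse g"])
qed

section \<open>Products of subgroups\<close>

definition sprod :: "'a::group_mult set \<Rightarrow> 'a set \<Rightarrow> 'a set" where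
  "sprod A B = {a * b | a b. a \<in> A \<and> b \<in> B}"

lemma sprodI: "a \<in> A \<Longrightarrow> b \<in> B \<Longrightarrow> a * b \<in> sprod A B"
  by (auto simp: sprod_def)

lemma sprodE: "x \<in> sprod A B \<Longrightarrow> (\<And>a b. x = a * b \<Longrightarrow> a \<in> A \<Longrightarrow> b \<in> B \<Longrightarrow> thesis) \<Longrightarrow> thesis"
  by (auto simp: sprod_def)

lemma sprod_left: "subgrp B \<Longrightarrow> A \<subseteq> sprod A B"
  using sprodI[of _ A 1 B] by (auto simp: subgrp_one)

lemma sprod_right: "subgrp A \<Longrightarrow> B \<subseteq> sprod A B"
  using sprodI[of 1 A _ B] by (auto simp: subgrp_one)

lemma sprod_subset: "subgrp K \<Longrightarrow> A \<subseteq> K \<Longrightarrow> B \<subseteq> K \<Longrightarrow> sprod A B \<subseteq> K"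
  by (auto simp: sprod_def subset_iff intro!: subgrp_mult)

lemma finite_sprod: "finite A \<Longrightarrow> finite B \<Longrightarrow> finite (sprod A B)"
  unfolding sprod_def by (rule finite_image_set2) auto

lemma sprod_commute:
  assumes "subgrp A" "subgrp B" "B \<subseteq> normaliser A"
  shows "sprod A B = sprod B A"
proof (intro equalityI subsetI)
  fix x assume "x \<in> sprod A B"
  then obtain a b where x: "x = a * b" "a \<in> A" "b \<in> B" by (rule sprodE)
  have "x = b * cj b a" using x by (simp add: cj_def mult.assoc)
  then show "x \<in> sprod B A"
    using x assms by (auto intro!: sprodI normaliser_cj)
next
  fix x assume "x \<in> sprod B A"
  then obtain b a where x: "x = b * a" "a \<in> A" "b \<in> B" by (rule sprodE)
  have "x = cj (inverse b) a * b" using x by (simp add: cj_def mult.assoc)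
  moreover have "inverse b \<in> normaliser A"
    using x assms by (auto intro: subgrp_inv subgrp_normaliser)
  ultimately show "x \<in> sprod A B"
    using x by (auto intro!: sprodI normaliser_cj)
qed

lemma subgrp_sprod:
  assumes "subgrp A" "subgrp B" "B \<subseteq> normaliser A"
  shows "subgrp (sprod A B)"
  unfolding subgrp_def
proof (intro conjI ballI)
  show "1 \<in> sprod A B"
    using sprodI[of 1 A 1 B] assms by (simp add: subgrp_one)
  fix x assume "x \<in> sprod A B"
  then obtain a b where x: "x = a * b" "a \<in> A" "b \<in> B" by (rule sprodE)
  have "inverse x \<in> sprod B A"
    using x assms by (auto intro!: sprodI subgrp_inv)
  then show "inverse x \<in> sprod A B"
    using sprod_commute[OF assms] by simp
  fix y assume "y \<in> sprod A B"
  then obtain a' b' where y: "y = a' * b'" "a' \<in> A" "b' \<in> B" by (rule sprodE)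
  have ib: "inverse b \<in> normaliser A"
    using x assms by (auto intro: subgrp_inv subgrp_normaliser)
  have "x * y = (a * cj (inverse b) a') * (b * b')"
    using x y by (simp add: cj_def mult.assoc)
  then show "x * y \<in> sprod A B"
    using x y assms normaliser_cj[OF ib] by (auto intro!: sprodI subgrp_mult)
qed

lemma normaliser_sprod:
  assumes "g \<in> normaliser A" "g \<in> normaliser B"
  shows "g \<in> normaliser (sprod A B)"
proof -
  have *: "cj g x \<in> sprod A B" if g: "g \<in> normaliser A" "g \<in> normaliser B" and x: "x \<in> sprod A B" for g x
  proof -
    obtain a b where "x = a * b" "a \<in> A" "b \<in> B" using x by (rule sprodE)
    then show ?thesis
      using g by (auto simp: cj_mult intro: sprodI dest: normaliser_cj)
  qed
  have **: "x \<in> sprod A B" if "cj g x \<in> sprod A B" for x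
    using *[OF subgrp_inv[OF subgrp_normaliser assms(1)] subgrp_inv[OF subgrp_normaliser assms(2)] that]
    by simp
  show ?thesis
    by (rule normaliserI'[OF *[OF assms] **])
qed

section \<open>Counting: fibres, cosets, orders of products, orbits of
  \<open>p\<close>-groups\<close>

lemma card_fibres:
  assumes "finite K" "\<And>x. x \<in> K \<Longrightarrow> card {y \<in> K. f y = f x} = m"
  shows "card K = card (f ` K) * m"
proof -
  have "card K = (\<Sum>y\<in>f ` K. card {x \<in> K. f x = y})"
    using sum.image_gen[OF assms(1), of "\<lambda>_. 1::nat" f] by simp
  also have "\<dots> = (\<Sum>y\<in>f ` K. m)"
    by (rule sum.cong) (auto simp: assms(2))
  finally show ?thesis by simp
qed

definition lcosets :: "'a::group_mult set \<Rightarrow> 'a set \<Rightarrow> 'a set set" where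
  "lcosets K H = (\<lambda>x. (*) x ` H) ` K"

lemma lcoset_eq_iff:
  assumes "subgrp H"
  shows "(*) x ` H = (*) y ` H \<longleftrightarrow> inverse y * x \<in> H"
proof
  assume "(*) x ` H = (*) y ` H"
  then have "x * 1 \<in> (*) y ` H" using subgrp_one[OF assms] by blast
  then show "inverse y * x \<in> H" by auto
next
  assume *: "inverse y * x \<in> H"
  have 1: "(*) x ` H \<subseteq> (*) y ` H" if "inverse y * x \<in> H" for x y
  proof
    fix z assume "z \<in> (*) x ` H"
    then obtain h where "h \<in> H" "z = x * h" by auto
    then have "z = y * (inverse y * x * h)" "inverse y * x * h \<in> H"
      using that assms by (auto simp: mult.assoc) (metis mult.assoc subgrp_mult)
    then show "z \<in> (*) y ` H" by blast
  qed
  have "inverse x * y \<in> H" using subgrp_inv[OF assms *] by simp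
  then show "(*) x ` H = (*) y ` H" using 1 * by blast
qed

lemma card_lcosets:
  assumes "subgrp H" "subgrp K" "H \<subseteq> K" "finite K"
  shows "card K = card (lcosets K H) * card H"
  unfolding lcosets_def
proof (rule card_fibres)
  fix x assume "x \<in> K"
  have "{y \<in> K. (*) y ` H = (*) x ` H} = (*) x ` H"
    using assms \<open>x \<in> K\<close>
    by (auto simp: lcoset_eq_iff image_iff subgrp_mult subset_iff) (metis mult_inv_cancel)
  then show "card {y \<in> K. (*) y ` H = (*) x ` H} = card H"
    by (simp add: card_image inj_on_def)
qed (use assms in auto)

lemma card_subgrp_dvd:
  assumes "subgrp H" "subgrp K" "H \<subseteq> K" "finite K"
  shows "card H dvd card K"
  using card_lcosets[OF assms] by simp

lemma card_sprod:
  assumes "subgrp A" "subgrp B" "finite A" "finite B"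
  shows "card (sprod A B) * card (A \<inter> B) = card A * card B"
proof -
  have "card (A \<times> B) = card ((\<lambda>(a, b). a * b) ` (A \<times> B)) * card (A \<inter> B)"
  proof (rule card_fibres)
    fix x assume "x \<in> A \<times> B"
    then obtain a b where x: "x = (a, b)" "a \<in> A" "b \<in> B" by auto
    have "{y \<in> A \<times> B. (case y of (a, b) \<Rightarrow> a * b) = (case x of (a, b) \<Rightarrow> a * b)}
        = (\<lambda>d. (a * d, inverse d * b)) ` (A \<inter> B)" (is "?L = ?R")
    proof (intro equalityI subsetI)
      fix y assume "y \<in> ?L"
      then obtain a' b' where y: "y = (a', b')" "a' \<in> A" "b' \<in> B" "a' * b' = a * b"
        using x by auto
      define d where "d = inverse a * a'"
      have b: "inverse d * b = b'"
        unfolding d_def inv_mult inv_inv mult.assoc by (simp flip: y(4))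
      have "d * b' = b" using b by (metis mult_inv_cancel)
      then have "d * b' * inverse b' = b * inverse b'" by simp
      then have dB: "d = b * inverse b'" by (simp add: mult.assoc)
      have "d \<in> A" using x y assms by (simp add: d_def subgrp_mult subgrp_inv)
      moreover have "d \<in> B" unfolding dB using x y assms by (simp add: subgrp_mult subgrp_inv)
      ultimately have "d \<in> A \<inter> B" by simp
      then show "y \<in> ?R" using y b by (auto simp: d_def image_iff intro!: bexI[of _ d])
    next
      fix y assume "y \<in> ?R"
      then show "y \<in> ?L" using x assms by (auto simp: subgrp_mult subgrp_inv mult.assoc)
    qed
    then show "card {y \<in> A \<times> B. (case y of (a, b) \<Rightarrow> a * b) = (case x of (a, b) \<Rightarrow> a * b)} = card (A \<inter> B)"
      by (simp add: card_image inj_on_def)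
  qed (use assms in auto)
  moreover have "(\<lambda>(a, b). a * b) ` (A \<times> B) = sprod A B"
    by (auto simp: sprod_def)
  ultimately show ?thesis by (simp add: card_cartesian_product)
qed

lemma prime_power_card:
  assumes "subgrp H" "H \<subseteq> K" "subgrp K" "card K = p ^ k" "prime (p::nat)"
  obtains j where "card H = p ^ j" "j \<le> k"
proof -
  have "finite K" using assms by (metis card.infinite not_prime_0 power_not_zero)
  then have "card H dvd p ^ k" using card_subgrp_dvd assms by metis
  then show thesis using that assms(5) by (metis divides_primepow_nat)
qed

text \<open>The moved points split into orbits whose lengths are powers of \<open>p\<close> other
  than 1. The induction strips one orbit at a time from a stable set without fixed points.\<close>

lemma fixed_points_cong:
  fixes act :: "'a::group_mult \<Rightarrow> 'b \<Rightarrow> 'b"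
  assumes U: "subgrp U" "card U = p ^ k" and p: "prime (p::nat)" and "finite E"
    and cl: "\<And>u e. u \<in> U \<Longrightarrow> e \<in> E \<Longrightarrow> act u e \<in> E"
    and one: "\<And>e. e \<in> E \<Longrightarrow> act 1 e = e"
    and mult: "\<And>u v e. u \<in> U \<Longrightarrow> v \<in> U \<Longrightarrow> e \<in> E \<Longrightarrow> act (u * v) e = act u (act v e)"
  shows "p dvd card {e \<in> E. \<exists>u\<in>U. act u e \<noteq> e}"
proof -
  have finU: "finite U" using U p by (metis card.infinite not_prime_0 power_not_zero)
  have undo: "act (inverse u) (act u e) = e" if "u \<in> U" "e \<in> E" for u e
    using mult[of "inverse u" u e] one that U by (simp add: subgrp_inv)
  have main: "p dvd card A" if "A \<subseteq> E" "\<And>u e. u \<in> U \<Longrightarrow> e \<in> A \<Longrightarrow> act u e \<in> A"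
      "\<And>e. e \<in> A \<Longrightarrow> \<exists>u\<in>U. act u e \<noteq> e" for A
    using that
  proof (induction "card A" arbitrary: A rule: less_induct)
    case less
    have finA: "finite A" using less.prems \<open>finite E\<close> finite_subset by blast
    show ?case
    proof (cases "A = {}")
      case False
      then obtain e where e: "e \<in> A" by auto
      define Orb where "Orb = (\<lambda>u. act u e) ` U"
      define St where "St = {u \<in> U. act u e = e}"
      have OA: "Orb \<subseteq> A" using less.prems(2)[OF _ e] by (auto simp: Orb_def)
      have AE: "a \<in> E" if "a \<in> A" for a using less.prems(1) that by blast
      have "act 1 e \<in> Orb" unfolding Orb_def using subgrp_one[OF U(1)] by blast
      then have eO: "e \<in> Orb" using one[OF AE[OF e]] by simp
      \<comment> \<open>Orbit-stabiliser: the fibre of u under u |-> \<open>act u e\<close> is the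
        left coset of \<open>St\<close> through u.\<close>
      have "card U = card Orb * card St"
        unfolding Orb_def
      proof (rule card_fibres)
        fix u assume u: "u \<in> U"
        have "act v e = act u e \<longleftrightarrow> act (inverse u * v) e = e" if "v \<in> U" for v
        proof -
          have "act (inverse u * v) e = act (inverse u) (act v e)"
            using mult[OF subgrp_inv[OF U(1) u] that AE[OF e]] .
          moreover have "act u (act (inverse u) (act v e)) = act v e"
            using undo[OF subgrp_inv[OF U(1) u] cl[OF that AE[OF e]]] by simp
          ultimately show ?thesis
            using undo[OF u AE[OF e]] by metis
        qed
        then have "{v \<in> U. act v e = act u e} = (*) u ` St"
          using u subgrp_mult[OF U(1) subgrp_inv[OF U(1) u]] subgrp_mult[OF U(1) u]
          by (auto simp: St_def image_iff) (metis mult_inv_cancel)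
        then show "card {v \<in> U. act v e = act u e} = card St"
          by (simp add: card_image inj_on_def)
      qed (fact finU)
      then have "card Orb dvd p ^ k" using U by (metis dvd_triv_left)
      then obtain j where j: "card Orb = p ^ j" using p by (metis divides_primepow_nat)
      obtain u where u: "u \<in> U" "act u e \<noteq> e" using less.prems e by blast
      have "j \<noteq> 0"
      proof
        assume "j = 0"
        then have "card Orb = 1" using j by simp
        then obtain z where "Orb = {z}" by (rule card_1_singletonE)
        moreover have "act u e \<in> Orb" using u by (simp add: Orb_def)
        ultimately show False using eO u by auto
      qed
      then have pO: "p dvd card Orb" using j by (simp add: dvd_power)
      have inv: "act u x \<in> A - Orb" if "u \<in> U" "x \<in> A - Orb" for u x
      proof -
        have "x \<in> Orb" if "act u x \<in> Orb"
        proof -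
          obtain v where v: "v \<in> U" "act u x = act v e" using \<open>act u x \<in> Orb\<close> by (auto simp: Orb_def)
          have "x = act (inverse u) (act v e)"
            using undo[OF \<open>u \<in> U\<close> AE[of x]] v \<open>x \<in> A - Orb\<close> by auto
          also have "\<dots> = act (inverse u * v) e"
            using mult[OF subgrp_inv[OF U(1) \<open>u \<in> U\<close>] v(1) AE[OF e]] by simp
          finally show ?thesis using U v \<open>u \<in> U\<close> by (auto simp: Orb_def subgrp_inv subgrp_mult)
        qed
        then show ?thesis using that less.prems(2)[of u x] by blast
      qed
      have lt: "card (A - Orb) < card A"
        using finA e eO OA by (intro psubset_card_mono) auto
      have "p dvd card (A - Orb)"
        by (rule less.hyps[OF lt]) (use less.prems inv in auto)
      moreover have "card A = card (A - Orb) + card Orb"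
        using OA finA by (simp add: card_Diff_subset finite_subset card_mono)
      ultimately show ?thesis using pO by simp
    qed simp
  qed
  have inv: "act u e \<in> {e \<in> E. \<exists>u\<in>U. act u e \<noteq> e}" if u: "u \<in> U" and e: "e \<in> {e \<in> E. \<exists>u\<in>U. act u e \<noteq> e}" for u e
  proof -
    obtain v where v: "v \<in> U" "act v e \<noteq> e" using e by auto
    have "\<not> (\<forall>w\<in>U. act w (act u e) = act u e)"
    proof
      assume *: "\<forall>w\<in>U. act w (act u e) = act u e"
      then have "act (inverse u) (act u e) = act u e" using u U by (auto simp: subgrp_inv)
      then have ue: "act u e = e" using undo u e by auto
      then show False using * v by auto
    qed
    then show ?thesis using cl u e by auto
  qed
  show ?thesis
    by (rule main[OF _ inv]) auto
qed

section \<open>Conjugacy of Sylow subgroups and chains in p-groups\<close>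

text \<open>U acts by left multiplication on the cosets of B in L. Their number is prime to
  \<open>p\<close>, so some coset xB is fixed, and then U^x <= B.\<close>

lemma sylow_conjugate:
  assumes L: "subgrp L" "finite L" and B: "subgrp B" "B \<subseteq> L" and U: "subgrp U" "U \<subseteq> L" "card U = p ^ k"
    and p: "prime (p::nat)" and ind: "\<not> p dvd card L div card B"
  obtains l where "l \<in> L" "\<And>u. u \<in> U \<Longrightarrow> cj l u \<in> B"
proof -
  define E where "E = lcosets L B"
  have cE: "card E = card L div card B"
  proof -
    have "card B > 0" using B L by (metis card_gt_0_iff empty_iff finite_subset subgrp_one)
    then show ?thesis using card_lcosets[OF B(1) L(1) B(2) L(2)] by (simp add: E_def)
  qed
  have finE: "finite E" using L by (simp add: E_def lcosets_def)
  have "p dvd card {e \<in> E. \<exists>u\<in>U. (*) u ` e \<noteq> e}"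
  proof (rule fixed_points_cong[where act = "\<lambda>u. image ((*) u)" and U = U and E = E and k = k])
    show "subgrp U" "card U = p ^ k" "prime p" "finite E" by (fact U p finE)+
    show "image ((*) 1) e = e" for e :: "'a set" by simp
    show "image ((*) (u * v)) e = image ((*) u) (image ((*) v) e)" for u v and e :: "'a set"
      by (simp add: image_image mult.assoc)
    fix u e assume "u \<in> U" "e \<in> E"
    then obtain x where "x \<in> L" "e = (*) x ` B" by (auto simp: E_def lcosets_def)
    moreover from this have "(*) u ` e = (*) (u * x) ` B"
      by (simp add: image_image mult.assoc)
    moreover have "u \<in> L" using U \<open>u \<in> U\<close> by blast
    ultimately have "(*) u ` e = (*) (u * x) ` B" "u * x \<in> L"
      using subgrp_mult[OF L(1)] by auto
    then show "(*) u ` e \<in> E" by (auto simp: E_def lcosets_def)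
  qed
  then have "{e \<in> E. \<exists>u\<in>U. (*) u ` e \<noteq> e} \<noteq> E" (is "?F \<noteq> E") using ind cE by metis
  moreover have "?F \<subseteq> E" by blast
  ultimately obtain e where "e \<in> E" "e \<notin> ?F" by blast
  then have e: "e \<in> E" "\<And>u. u \<in> U \<Longrightarrow> (*) u ` e = e" by blast+
  then obtain x where x: "x \<in> L" "e = (*) x ` B" by (auto simp: E_def lcosets_def)
  have "cj x u \<in> B" if "u \<in> U" for u
  proof -
    have "(*) (u * x) ` B = (*) x ` B" using e(2)[OF that] x by (auto simp: image_image mult.assoc)
    then have "inverse x * (u * x) \<in> B" by (simp only: lcoset_eq_iff[OF B(1)])
    then show ?thesis by (simp add: cj_def mult.assoc)
  qed
  then show thesis using that x by blast
qed

text \<open>Turns a subgroup of the type class into a record group, so that the existence of Sylow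
  subgroups and the equation x^|H| = 1 carry over.\<close>

definition grp :: "'a::group_mult set \<Rightarrow> 'a monoid" where
  "grp H = \<lparr>carrier = H, monoid.mult = (*), one = 1\<rparr>"

lemma grp_simps [simp]: "carrier (grp H) = H" "x \<otimes>\<^bsub>grp H\<^esub> y = x * y" "\<one>\<^bsub>grp H\<^esub> = 1"
  by (simp_all add: grp_def)

lemma group_grp: "subgrp H \<Longrightarrow> group (grp H)"
  by (rule groupI) (auto simp: subgrp_mult subgrp_one mult.assoc intro: subgrp_inv left_inv)

lemma grp_pow [simp]: "x [^]\<^bsub>grp H\<^esub> (n::nat) = x ^ n"
  by (induction n) (simp_all add: nat_pow_def power_commutes)

lemma grp_inv: "subgrp H \<Longrightarrow> x \<in> H \<Longrightarrow> inv\<^bsub>grp H\<^esub> x = inverse x"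
  by (rule group.inv_equality) (simp_all add: group_grp subgrp_inv)

lemma subgroup_grp_iff: "subgrp H \<Longrightarrow> subgroup K (grp H) \<longleftrightarrow> subgrp K \<and> K \<subseteq> H"
  by (auto simp: subgroup_def subgrp_def grp_inv subset_iff)

lemma power_card: "subgrp H \<Longrightarrow> finite H \<Longrightarrow> x \<in> H \<Longrightarrow> x ^ card H = 1"
  using group.pow_order_eq_1[OF group_grp, of H x] by (simp add: order_def)

lemma sylow_exists:
  assumes "prime p" "subgrp X" "finite X"
  obtains R where "subgrp R" "R \<subseteq> X" "card R = p ^ multiplicity p (card X)"
proof -
  obtain m where "card X = p ^ multiplicity p (card X) * m"
    using multiplicity_dvd[of p "card X"] by (elim dvdE)
  then have "\<exists>R. subgroup R (grp X) \<and> card R = p ^ multiplicity p (card X)"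
    using assms by (intro sylow_thm[of _ _ _ m]) (auto simp: group_grp order_def)
  then show thesis using that subgroup_grp_iff[OF assms(2)] by blast
qed

lemma card_subgrp_pos: "subgrp H \<Longrightarrow> finite H \<Longrightarrow> card H > 0"
  using subgrp_one by (auto simp: card_gt_0_iff)

lemma normaliser_trivial: "normaliser {1} = UNIV"
proof -
  have "cj g x = 1 \<longleftrightarrow> x = 1" for g x :: 'a
    using cj_eq_iff[of g x 1] by simp
  then show ?thesis by (auto simp: normaliser_def)
qed

section \<open>\<open>p\<close>-groups: fixed points, growing normalisers, chains\<close>

lemma finite_p_group: "card U = p ^ k \<Longrightarrow> prime (p::nat) \<Longrightarrow> finite U"
  by (metis card.infinite not_prime_0 power_not_zero)

text \<open>The number of fixed points is divisible by \<open>p\<close>, so \<open>e0\<close> cannot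
  be the only one.\<close>

lemma another_fixed_point:
  fixes act :: "'a::group_mult \<Rightarrow> 'b \<Rightarrow> 'b"
  assumes "subgrp U" "card U = p ^ k" "prime (p::nat)" "finite E"
    and "\<And>u e. u \<in> U \<Longrightarrow> e \<in> E \<Longrightarrow> act u e \<in> E"
    and "\<And>e. e \<in> E \<Longrightarrow> act 1 e = e"
    and "\<And>u v e. u \<in> U \<Longrightarrow> v \<in> U \<Longrightarrow> e \<in> E \<Longrightarrow> act (u * v) e = act u (act v e)"
    and "p dvd card E" "e0 \<in> E" "\<And>u. u \<in> U \<Longrightarrow> act u e0 = e0"
  obtains e where "e \<in> E" "e \<noteq> e0" "\<And>u. u \<in> U \<Longrightarrow> act u e = e"
proof -
  let ?M = "{e \<in> E. \<exists>u\<in>U. act u e \<noteq> e}"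
  have "p dvd card ?M" by (rule fixed_points_cong) (fact assms)+
  moreover have "card (E - ?M) = card E - card ?M"
    by (rule card_Diff_subset) (auto simp: assms)
  ultimately have d: "p dvd card (E - ?M)" using assms(8) by (simp add: dvd_diff_nat)
  have "E - ?M \<noteq> {e0}"
  proof
    assume "E - ?M = {e0}"
    then have "p dvd 1" using d by simp
    then show False using assms(3) by simp
  qed
  moreover have "e0 \<in> E - ?M" using assms(9,10) by auto
  ultimately obtain e where "e \<in> E - ?M" "e \<noteq> e0" by blast
  then show thesis using that by blast
qed

text \<open>The sequence x, x^p, x^(p^2), ... starts outside M and ends inside; the term before a
  step into M serves. It replaces an element outside M by one of order \<open>p\<close> modulo
  M.\<close>

lemma p_power_root:
  assumes "x \<notin> M" "x ^ (p ^ k) \<in> M"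
  obtains j where "x ^ (p ^ j) \<notin> M" "(x ^ (p ^ j)) ^ p \<in> (M :: 'a::group_mult set)"
proof -
  have "\<exists>j. x ^ (p ^ j) \<notin> M \<and> (x ^ (p ^ j)) ^ p \<in> M"
    using assms(2)
  proof (induction k)
    case 0
    then show ?case using assms(1) by simp
  next
    case (Suc k)
    then show ?case
      by (cases "x ^ (p ^ k) \<in> M") (auto simp: power_mult mult.commute[of p] intro!: exI[of _ k])
  qed
  then show thesis using that by blast
qed

lemma p_group_power: "subgrp S \<Longrightarrow> card S = p ^ k \<Longrightarrow> prime (p::nat) \<Longrightarrow> x \<in> S \<Longrightarrow> x ^ (p ^ k) = 1"
  using power_card finite_p_group by metis

lemma p_group_index:
  assumes "subgrp U" "subgrp S" "U \<subset> S" "card S = p ^ n" "prime (p::nat)"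
  shows "p dvd card (lcosets S U)"
proof -
  have fin: "finite S" by (rule finite_p_group) (fact assms)+
  have e: "card S = card (lcosets S U) * card U"
    using assms fin by (intro card_lcosets) auto
  then have "card (lcosets S U) dvd p ^ n" using assms(4) by (metis dvd_triv_left)
  then obtain j where j: "card (lcosets S U) = p ^ j" using assms(5) by (metis divides_primepow_nat)
  have "card U < card S" using assms(3) fin by (simp add: psubset_card_mono)
  then have "j \<noteq> 0" using e j by (intro notI) simp
  then show ?thesis using j by (simp add: dvd_power)
qed

text \<open>U acts on the cosets of U in S, whose number \<open>p\<close> divides, and fixes the
  coset U. A second fixed coset xU means that x normalises U, and a suitable power of x has order
  \<open>p\<close> modulo U.\<close>

lemma p_group_normaliser_grows:
  assumes U: "subgrp U" and S: "subgrp S" "U \<subset> S" "card S = p ^ n" and p: "prime (p::nat)"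
  obtains x where "x \<in> S" "x \<notin> U" "x \<in> normaliser U" "x ^ p \<in> U"
proof -
  have fin: "finite S" using S(3) p by (rule finite_p_group)
  have US: "U \<subseteq> S" using S by auto
  obtain k where k: "card U = p ^ k" using prime_power_card[OF U US S(1,3) p] by metis
  define E where "E = lcosets S U"
  have UE: "U \<in> E"
    unfolding E_def lcosets_def by (rule image_eqI[of _ _ 1]) (simp_all add: subgrp_one S)
  obtain e where e: "e \<in> E" "e \<noteq> U" "\<And>u. u \<in> U \<Longrightarrow> image ((*) u) e = e"
  proof (rule another_fixed_point[where act = "\<lambda>u. image ((*) u)" and U = U and E = E and k = k and ?e0.0 = U and p = p])
    show "finite E" using fin by (simp add: E_def lcosets_def)
    show "p dvd card E" unfolding E_def by (rule p_group_index) (fact U S p)+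
    show "image ((*) 1) e = e" for e :: "'a set" by simp
    show "image ((*) (u * v)) e = image ((*) u) (image ((*) v) e)" for u v and e :: "'a set"
      by (simp add: image_image mult.assoc)
    show "image ((*) u) U = U" if "u \<in> U" for u
      using lcoset_eq_iff[OF U, of u 1] that by simp
    fix u e assume u: "u \<in> U" and "e \<in> E"
    then obtain x where x: "x \<in> S" "e = (*) x ` U" by (auto simp: E_def lcosets_def)
    then have "(*) u ` e = (*) (u * x) ` U" by (simp add: image_image mult.assoc)
    moreover have "u * x \<in> S" using u US x subgrp_mult[OF S(1)] by blast
    ultimately show "(*) u ` e \<in> E" by (auto simp: E_def lcosets_def)
  qed (use U k p UE in blast)+
  obtain x where x: "x \<in> S" "e = (*) x ` U" using e(1) by (auto simp: E_def lcosets_def)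
  have xU: "x \<notin> U"
  proof
    assume "x \<in> U"
    then show False using lcoset_eq_iff[OF U, of x 1] e(2) x by simp
  qed
  have "cj x u \<in> U" if "u \<in> U" for u
  proof -
    have "(*) (u * x) ` U = (*) x ` U" using e(3)[OF that] x by (simp add: image_image mult.assoc)
    then have "inverse x * (u * x) \<in> U" by (simp only: lcoset_eq_iff[OF U])
    then show ?thesis by (simp add: cj_def mult.assoc)
  qed
  then have xN: "x \<in> normaliser U"
    using fin US finite_subset by (intro normaliserI) auto
  have "x ^ (p ^ n) \<in> U"
    using p_group_power[OF S(1,3) p x(1)] U by (simp add: subgrp_one)
  then obtain j where j: "x ^ (p ^ j) \<notin> U" "(x ^ (p ^ j)) ^ p \<in> U"
    using p_power_root[OF xU] by blast
  show thesis
    using that[OF _ j(1) _ j(2)] x(1) S(1) subgrp_power[OF subgrp_normaliser xN] by (simp add: subgrp_power)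
qed

text \<open>The subgroup U<x>, when x normalises U and some positive power of x lies in U; natural
  exponents then suffice. In a finite group \<open>adj {1} x\<close> is the cyclic group
  <x>.\<close>

definition adj :: "'a::group_mult set \<Rightarrow> 'a \<Rightarrow> 'a set" where
  "adj U x = {u * x ^ i | u i. u \<in> U}"

lemma adjI: "u \<in> U \<Longrightarrow> u * x ^ i \<in> adj U x"
  by (auto simp: adj_def)

lemma adjE: "y \<in> adj U x \<Longrightarrow> (\<And>u i. y = u * x ^ i \<Longrightarrow> u \<in> U \<Longrightarrow> thesis) \<Longrightarrow> thesis"
  by (auto simp: adj_def)

lemma adj_mem: "subgrp U \<Longrightarrow> x \<in> adj U x"
  using adjI[of 1 U x 1] by (simp add: subgrp_one)

lemma adj_sub: "U \<subseteq> adj U x"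
  using adjI[of _ U x 0] by auto

lemma adj_subset: "subgrp V \<Longrightarrow> U \<subseteq> V \<Longrightarrow> x \<in> V \<Longrightarrow> adj U x \<subseteq> V"
  by (auto simp: adj_def subset_iff intro!: subgrp_mult subgrp_power)

lemma cj_neg: "cj (inverse g) x * g = g * x"
  by (simp add: cj_def mult.assoc)

lemma subgrp_adj:
  assumes U: "subgrp U" and x: "x \<in> normaliser U" "x ^ k \<in> U" "k > 0"
  shows "subgrp (adj U x)"
  unfolding subgrp_def
proof (intro conjI ballI)
  have xi: "inverse (x ^ i) \<in> normaliser U" for i
    using x(1) by (intro subgrp_inv subgrp_power subgrp_normaliser)
  have sw: "x ^ i * v \<in> adj U x" if "v \<in> U" for i v
  proof -
    have "x ^ i * v = cj (inverse (x ^ i)) v * x ^ i" by (simp add: cj_neg)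
    then show ?thesis using normaliser_cj[OF xi that] by (simp add: adjI)
  qed
  show "1 \<in> adj U x" using adj_sub U subgrp_one by blast
  fix y assume "y \<in> adj U x"
  then obtain u i where y: "y = u * x ^ i" "u \<in> U" by (rule adjE)
  have "inverse (x ^ i) = x ^ ((k - 1) * i) * inverse (x ^ (k * i))"
  proof -
    have "x ^ (k * i) = x ^ i * x ^ ((k - 1) * i)"
      using x(3) by (simp flip: power_add) (simp add: algebra_simps)
    then show ?thesis by simp
  qed
  then have "inverse y = x ^ ((k - 1) * i) * (inverse (x ^ (k * i)) * inverse u)"
    by (simp add: y mult.assoc)
  moreover have "x ^ (k * i) \<in> U" using x(2) U by (simp add: power_mult subgrp_power)
  ultimately show "inverse y \<in> adj U x"
    using y U by (auto intro!: sw subgrp_mult subgrp_inv)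
  fix z assume "z \<in> adj U x"
  then obtain v j where z: "z = v * x ^ j" "v \<in> U" by (rule adjE)
  have "y * z = (u * cj (inverse (x ^ i)) v) * x ^ (i + j)"
    by (simp add: y z cj_def mult.assoc power_add)
  then show "y * z \<in> adj U x"
    using y z U normaliser_cj[OF xi z(2)] by (auto intro!: adjI subgrp_mult)
qed

lemma card_adj:
  assumes U: "subgrp U" "finite U" and x: "x ^ k \<in> U" "k > 0" "\<And>i. 0 < i \<Longrightarrow> i < k \<Longrightarrow> x ^ i \<notin> U"
  shows "card (adj U x) = k * card U"
proof -
  have "bij_betw (\<lambda>(u, i). u * x ^ i) (U \<times> {..<k}) (adj U x)"
    unfolding bij_betw_def
  proof
    have le: "i \<le> j" if "u \<in> U" "v \<in> U" "i < k" "j < k" "u * x ^ i = v * x ^ j" for u v i j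
    proof (rule ccontr)
      assume "\<not> i \<le> j"
      then have "x ^ i = x ^ (i - j) * x ^ j" by (simp flip: power_add)
      then have "u * x ^ (i - j) * x ^ j = v * x ^ j" using that(5) by (simp add: mult.assoc)
      then have "x ^ (i - j) = inverse u * v" by (metis inv_mult_cancel right_mult_cancel)
      then have "x ^ (i - j) \<in> U" using that U by (simp add: subgrp_mult subgrp_inv)
      then show False using x(3)[of "i - j"] that \<open>\<not> i \<le> j\<close> by simp
    qed
    show "inj_on (\<lambda>(u, i). u * x ^ i) (U \<times> {..<k})"
    proof (rule inj_onI, clarsimp)
      fix u i v j assume a: "u \<in> U" "v \<in> U" "i < k" "j < k" "u * x ^ i = v * x ^ j"
      have "i = j" using le[OF a] le[OF a(2,1,4,3)] a(5) by simp
      then show "u = v \<and> i = j" using a(5) by simp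
    qed
    show "(\<lambda>(u, i). u * x ^ i) ` (U \<times> {..<k}) = adj U x"
    proof (intro equalityI subsetI)
      fix y assume "y \<in> adj U x"
      then obtain u i where y: "y = u * x ^ i" "u \<in> U" by (rule adjE)
      have "x ^ i = (x ^ k) ^ (i div k) * x ^ (i mod k)"
        by (simp flip: power_mult power_add)
      then have "y = (u * (x ^ k) ^ (i div k)) * x ^ (i mod k)" by (simp add: y mult.assoc)
      moreover have "u * (x ^ k) ^ (i div k) \<in> U" using y U x by (simp add: subgrp_mult subgrp_power)
      ultimately show "y \<in> (\<lambda>(u, i). u * x ^ i) ` (U \<times> {..<k})"
        using x(2) by (intro image_eqI[of _ _ "(u * (x ^ k) ^ (i div k), i mod k)"]) auto
    qed (auto simp: adj_def)
  qed
  then have "card (U \<times> {..<k}) = card (adj U x)" by (rule bij_betw_same_card)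
  then show ?thesis by (simp add: card_cartesian_product mult.commute)
qed

lemma power_mem_coprime:
  assumes U: "subgrp U" and "x ^ m \<in> U" "x ^ n \<in> U" "coprime m n"
  shows "x \<in> U"
proof (cases "m = 0")
  case True
  then show ?thesis using assms by simp
next
  case False
  then obtain a b where ab: "m * a = n * b + gcd m n" using bezout_nat by blast
  have "x ^ (m * a) \<in> U" "x ^ (n * b) \<in> U" using assms by (simp_all add: power_mult subgrp_power)
  moreover have "x ^ (m * a) = x ^ (n * b) * x" using ab assms(4) by (simp add: power_commutes)
  ultimately show ?thesis using subgrp_mult_iff(1)[OF U] by metis
qed

lemma card_adj_prime:
  assumes U: "subgrp U" "finite U" and p: "prime (p::nat)" and x: "x ^ p \<in> U" "x \<notin> U"
  shows "card (adj U x) = p * card U"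
proof (rule card_adj)
  fix i assume "0 < i" "i < p"
  then have "coprime i p" using p by (metis coprime_commute nat_dvd_not_less prime_imp_coprime)
  then show "x ^ i \<notin> U" using power_mem_coprime[OF U(1) _ x(1)] x(2) by blast
qed (use assms in \<open>auto simp: prime_gt_0_nat\<close>)

text \<open>If k is the least positive exponent with x^k in W, then |W<x>| = k |W| divides
  \<open>p\<close> |W|; so k divides \<open>p\<close>, and k is not 1.\<close>

lemma index_prime:
  assumes W: "subgrp W" "W \<subseteq> V" and V: "subgrp V" "finite V" "V \<subseteq> normaliser W"
    and c: "card V = p * card W" and p: "prime (p::nat)" and x: "x \<in> V" "x \<notin> W"
  shows "x ^ p \<in> W" "adj W x = V"
proof -
  have finW: "finite W" using W V finite_subset by blast
  have "x ^ card V \<in> W" using power_card[OF V(1,2) x(1)] W by (simp add: subgrp_one)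
  moreover have "card V > 0" using V x by (auto simp: card_gt_0_iff)
  ultimately have ex: "\<exists>k. 0 < k \<and> x ^ k \<in> W" by blast
  define k where "k = (LEAST k. 0 < k \<and> x ^ k \<in> W)"
  have k: "0 < k" "x ^ k \<in> W" using LeastI_ex[OF ex] by (auto simp: k_def)
  have kmin: "x ^ i \<notin> W" if "0 < i" "i < k" for i
    using that not_less_Least[of i "\<lambda>k. 0 < k \<and> x ^ k \<in> W"] by (auto simp: k_def)
  have xN: "x \<in> normaliser W" using V x by blast
  have sub: "subgrp (adj W x)" using subgrp_adj[OF W(1) xN k(2,1)] .
  have sV: "adj W x \<subseteq> V" using adj_subset[OF V(1) W(2) x(1)] .
  have card: "card (adj W x) = k * card W" using card_adj[OF W(1) finW k(2,1) kmin] by blast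
  have "card (adj W x) dvd card V" using card_subgrp_dvd[OF sub V(1) sV V(2)] .
  moreover have "card W > 0" using card_subgrp_pos[OF W(1) finW] .
  ultimately have "k dvd p" using card c by simp
  moreover have "k \<noteq> 1" using k x by auto
  ultimately have "k = p" using p by (metis prime_nat_iff)
  then show "x ^ p \<in> W" using k by simp
  show "adj W x = V" using card \<open>k = p\<close> c sV V(2) by (intro card_subset_eq) auto
qed

text \<open>The normaliser of U contains an x outside U with |U<x>| = \<open>p\<close> |U| =
  |S|.\<close>

lemma index_prime_normal:
  assumes U: "subgrp U" "U \<subseteq> S" and S: "subgrp S" "card S = p ^ n" and p: "prime (p::nat)"
    and c: "card S = p * card U"
  shows "S \<subseteq> normaliser U"
proof -
  have fin: "finite S" using S(2) p by (rule finite_p_group)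
  have "U \<noteq> S"
  proof
    assume "U = S"
    then have "card S = p * card S" using c by simp
    moreover have "card S > 0" using S p by (simp add: prime_gt_0_nat)
    ultimately show False using prime_gt_1_nat[OF p] by simp
  qed
  then obtain x where x: "x \<in> S" "x \<notin> U" "x \<in> normaliser U" "x ^ p \<in> U"
    using p_group_normaliser_grows[OF U(1) S(1) _ S(2) p] U by blast
  have "card (adj U x) = card S"
    using card_adj_prime[OF U(1) _ p x(4,2)] U fin c by (simp add: finite_subset)
  then have "adj U x = S"
    using fin adj_subset[OF S(1) U(2) x(1)] by (intro card_subset_eq) auto
  moreover have "adj U x \<subseteq> normaliser U"
    by (intro adj_subset subgrp_normaliser subgrp_le_normaliser U x)
  ultimately show ?thesis by simp
qed

lemma intermediate_subgrp:
  assumes U: "subgrp U" "U \<subseteq> S" and S: "subgrp S" "card S = p ^ n" and p: "prime (p::nat)"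
    and c: "card U = p ^ i" "i \<le> j" "j \<le> n"
  obtains V where "subgrp V" "U \<subseteq> V" "V \<subseteq> S" "card V = p ^ j"
proof -
  have fin: "finite S" using S(2) p by (rule finite_p_group)
  have "\<exists>V. subgrp V \<and> U \<subseteq> V \<and> V \<subseteq> S \<and> card V = p ^ j"
    using c(2,3)
  proof (induction j rule: dec_induct)
    case base
    then show ?case using U c by blast
  next
    case (step j)
    then obtain V where V: "subgrp V" "U \<subseteq> V" "V \<subseteq> S" "card V = p ^ j" by auto
    have "V \<noteq> S"
    proof
      assume "V = S"
      then have "p ^ n = p ^ j" using V(4) S(2) by simp
      then have "n = j" using prime_gt_1_nat[OF p] power_inject_exp by blast
      then show False using step.prems by simp
    qed
    then obtain x where x: "x \<in> S" "x \<notin> V" "x \<in> normaliser V" "x ^ p \<in> V"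
      using p_group_normaliser_grows[OF V(1) S(1) _ S(2) p] V(3) by blast
    have "subgrp (adj V x)" using subgrp_adj[OF V(1) x(3,4)] p by (simp add: prime_gt_0_nat)
    moreover have "card (adj V x) = p ^ Suc j"
      using card_adj_prime[OF V(1) _ p x(4,2)] V fin by (simp add: finite_subset)
    moreover have "U \<subseteq> adj V x" using V(2) adj_sub by blast
    moreover have "adj V x \<subseteq> S" using adj_subset[OF S(1) V(3) x(1)] .
    ultimately show ?case by blast
  qed
  then show thesis using that by blast
qed

text \<open>The commutator [x, s], arranged so that x^s = x [x, s].\<close>

definition cm :: "'a::group_mult \<Rightarrow> 'a \<Rightarrow> 'a" where
  "cm x s = inverse x * cj s x"

lemma cj_cm: "cj s x = x * cm x s"
  by (simp add: cm_def)

lemma cm_mult: "cm (x * y) s = cj y (cm x s) * cm y s"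
  by (simp add: cm_def cj_def mult.assoc)

lemma cm_inverse: "cm (inverse x) s = inverse (cj (inverse x) (cm x s))"
  by (simp add: cm_def cj_def mult.assoc)

text \<open>The preimage of the fixed points of s on \<open>normaliser W\<close> modulo W;
  restricting to the normaliser makes it closed under products.\<close>

definition fixmod :: "'a::group_mult set \<Rightarrow> 'a \<Rightarrow> 'a set" where
  "fixmod W s = {x \<in> normaliser W. cm x s \<in> W}"

lemma subgrp_fixmod:
  assumes W: "subgrp W"
  shows "subgrp (fixmod W s)"
  unfolding subgrp_def
proof (intro conjI ballI)
  show "1 \<in> fixmod W s"
    using W by (simp add: fixmod_def cm_def subgrp_one subgrp_normaliser)
  fix x assume x: "x \<in> fixmod W s"
  then have xN: "x \<in> normaliser W" "inverse x \<in> normaliser W"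
    by (simp_all add: fixmod_def subgrp_inv subgrp_normaliser)
  then show "inverse x \<in> fixmod W s"
    using x W by (simp add: fixmod_def cm_inverse subgrp_inv normaliser_cj)
  fix y assume y: "y \<in> fixmod W s"
  then show "x * y \<in> fixmod W s"
    using x W xN by (simp add: fixmod_def cm_mult subgrp_mult subgrp_normaliser normaliser_cj)
qed

lemma fixmod_sub:
  assumes "subgrp W" "s \<in> normaliser W"
  shows "W \<subseteq> fixmod W s"
  using assms subgrp_le_normaliser[OF assms(1)]
  by (auto simp: fixmod_def cm_def subgrp_mult subgrp_inv normaliser_cj)

text \<open>S acts by conjugation on the cosets of M in R and fixes M itself, hence also another
  coset xM. A power of x has order \<open>p\<close> modulo M and is still fixed, since
  \<open>fixmod M s\<close> is a subgroup.\<close>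

lemma p_group_central_step:
  assumes M: "subgrp M" and R: "subgrp R" "M \<subset> R" "card R = p ^ r" "R \<subseteq> normaliser M"
    and S: "subgrp S" "card S = p ^ k" "S \<subseteq> normaliser M" "S \<subseteq> normaliser R" and p: "prime (p::nat)"
  obtains x where "x \<in> R" "x \<notin> M" "x ^ p \<in> M" "\<And>s. s \<in> S \<Longrightarrow> cm x s \<in> M"
proof -
  have fin: "finite R" using R(3) p by (rule finite_p_group)
  define E where "E = lcosets R M"
  \<comment> \<open>The inverse turns conjugation, a right action, into a left action.\<close>
  define act where "act s = image (cj (inverse s))" for s :: 'a
  have actx: "act s ((*) x ` M) = (*) (cj (inverse s) x) ` M" if "s \<in> S" for s x
  proof -
    have "cj (inverse s) ` M = M"
    proof -
      have "inverse s \<in> normaliser M" "s \<in> normaliser M"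
        using S that by (auto intro: subgrp_inv subgrp_normaliser)
      then show ?thesis
        using normaliser_cj[of "inverse s" M] normaliser_cj[of s M]
        by (auto simp: mem_cj_image)
    qed
    then have "(*) (cj (inverse s) x) ` (cj (inverse s) ` M) = (*) (cj (inverse s) x) ` M" by simp
    then show ?thesis by (simp add: act_def image_image cj_mult)
  qed
  have ME: "M \<in> E"
    unfolding E_def lcosets_def by (rule image_eqI[of _ _ 1]) (simp_all add: subgrp_one R)
  obtain e where e: "e \<in> E" "e \<noteq> M" "\<And>s. s \<in> S \<Longrightarrow> act s e = e"
  proof (rule another_fixed_point[where act = act and U = S and E = E and k = k and ?e0.0 = M and p = p])
    show "finite E" using fin by (simp add: E_def lcosets_def)
    show "p dvd card E" unfolding E_def by (rule p_group_index) (fact M R p)+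
    show "act 1 e = e" for e by (auto simp: act_def)
    show "act (u * v) e = act u (act v e)" for u v e
      by (simp add: act_def image_image flip: cj_prod)
    show "act s M = M" if "s \<in> S" for s
      using actx[OF that, of 1] by simp
    fix s e assume s: "s \<in> S" and "e \<in> E"
    then obtain x where x: "x \<in> R" "e = (*) x ` M" by (auto simp: E_def lcosets_def)
    moreover have "inverse s \<in> normaliser R"
      using S s by (auto intro: subgrp_inv subgrp_normaliser)
    ultimately have "act s e = (*) (cj (inverse s) x) ` M" "cj (inverse s) x \<in> R"
      using actx[OF s, of x] normaliser_cj by auto
    then show "act s e \<in> E" unfolding E_def lcosets_def by blast
  qed (use S p ME in blast)+
  obtain x where x: "x \<in> R" "e = (*) x ` M" using e(1) by (auto simp: E_def lcosets_def)
  have xM: "x \<notin> M"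
  proof
    assume "x \<in> M"
    then show False using lcoset_eq_iff[OF M, of x 1] e(2) x by simp
  qed
  have cm: "cm x s \<in> M" if "s \<in> S" for s
  proof -
    have "inverse s \<in> S" using that S by (simp add: subgrp_inv)
    from actx[OF this, of x] e(3)[OF this] x(2)
    have "(*) (cj s x) ` M = (*) x ` M" by simp
    then show ?thesis unfolding lcoset_eq_iff[OF M] by (simp add: cm_def)
  qed
  have "x ^ (p ^ r) \<in> M"
    using p_group_power[OF R(1,3) p x(1)] M by (simp add: subgrp_one)
  then obtain j where j: "x ^ (p ^ j) \<notin> M" "(x ^ (p ^ j)) ^ p \<in> M"
    using p_power_root[OF xM] by blast
  show thesis
  proof (rule that[OF _ j])
    show "x ^ p ^ j \<in> R" using x R by (simp add: subgrp_power)
    fix s assume s: "s \<in> S"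
    have "x \<in> fixmod M s" using cm[OF s] x R by (auto simp: fixmod_def)
    then have "x ^ p ^ j \<in> fixmod M s" by (intro subgrp_power subgrp_fixmod M)
    then show "cm (x ^ p ^ j) s \<in> M" by (simp add: fixmod_def)
  qed
qed

lemma adj_normal:
  assumes M: "subgrp M" and x: "x \<in> normaliser M" "x ^ p \<in> M" "p > 0" and s: "s \<in> normaliser M" "cm x s \<in> M"
    and fin: "finite (adj M x)"
  shows "s \<in> normaliser (adj M x)"
proof (rule normaliserI[OF fin])
  fix y assume "y \<in> adj M x"
  then obtain u i where y: "y = u * x ^ i" "u \<in> M" by (rule adjE)
  have A: "subgrp (adj M x)" using subgrp_adj[OF M x] .
  have "cj s y = cj s u * (x * cm x s) ^ i" by (simp add: y cj_mult cj_power flip: cj_cm)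
  moreover have "cj s u \<in> adj M x" "x \<in> adj M x" "cm x s \<in> adj M x"
    using adj_sub[of M x] adj_mem[OF M, of x] normaliser_cj[OF s(1) y(2)] s by auto
  ultimately show "cj s y \<in> adj M x" using A by (simp add: subgrp_mult subgrp_power)
qed

text \<open>V/W has order \<open>p\<close>, so it is generated by any nontrivial coset that S fixes,
  and the whole section is fixed.\<close>

lemma central_index_prime:
  assumes W: "subgrp W" "W \<subseteq> V" and V: "subgrp V" "card V = p ^ r" and c: "card V = p * card W"
    and S: "subgrp S" "card S = p ^ k" "S \<subseteq> normaliser W" "S \<subseteq> normaliser V" and p: "prime (p::nat)"
    and x: "x \<in> V" and s: "s \<in> S"
  shows "cm x s \<in> W"
proof -
  have fin: "finite V" using V(2) p by (rule finite_p_group)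
  have VN: "V \<subseteq> normaliser W" by (rule index_prime_normal[OF W V p c])
  have "W \<noteq> V"
  proof
    assume "W = V"
    then have "card V = p * card V" using c by simp
    then show False using card_subgrp_pos[OF V(1) fin] prime_gt_1_nat[OF p] by simp
  qed
  then obtain y where y: "y \<in> V" "y \<notin> W" "y ^ p \<in> W" "\<And>s. s \<in> S \<Longrightarrow> cm y s \<in> W"
    using p_group_central_step[OF W(1) V(1) _ V(2) VN S p] W by blast
  have "V = adj W y" using index_prime(2)[OF W V(1) fin VN c p y(1,2)] by simp
  also have "\<dots> \<subseteq> fixmod W s"
    using S s y VN by (intro adj_subset subgrp_fixmod fixmod_sub W) (auto simp: fixmod_def)
  finally show ?thesis using x by (auto simp: fixmod_def)
qed

text \<open>Among the proper S-invariant subgroups of R take one of largest order. The central step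
  enlarges it by a factor \<open>p\<close>, and by maximality the result is R.\<close>

lemma maximal_normal_subgrp:
  assumes R: "subgrp R" "R \<noteq> {1}" "card R = p ^ r"
    and S: "subgrp S" "card S = p ^ k" "S \<subseteq> normaliser R" "R \<subseteq> S" and p: "prime (p::nat)"
  obtains U where "subgrp U" "U \<subseteq> R" "card R = p * card U" "S \<subseteq> normaliser U"
proof -
  have fin: "finite R" using R(3) p by (rule finite_p_group)
  define \<U> where "\<U> = {U. subgrp U \<and> U \<subset> R \<and> S \<subseteq> normaliser U}"
  have "\<U> \<subseteq> Pow R" by (auto simp: \<U>_def)
  then have fU: "finite \<U>" using fin finite_subset by blast
  have "{1} \<in> \<U>"
    using R subgrp_one[OF R(1)] by (auto simp: \<U>_def subgrp_trivial normaliser_trivial)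
  then have ne: "\<U> \<noteq> {}" by blast
  define m where "m = Max (card ` \<U>)"
  have "m \<in> card ` \<U>" unfolding m_def using fU ne by (intro Max_in) auto
  then obtain U where U: "U \<in> \<U>" "card U = m" by blast
  have mx: "card V \<le> card U" if "V \<in> \<U>" for V
    using that fU by (simp add: U m_def)
  have U': "subgrp U" "U \<subset> R" "S \<subseteq> normaliser U" using U by (auto simp: \<U>_def)
  obtain x where x: "x \<in> R" "x \<notin> U" "x ^ p \<in> U" "\<And>s. s \<in> S \<Longrightarrow> cm x s \<in> U"
    using p_group_central_step[OF U'(1) R(1) U'(2) R(3) _ S(1,2) U'(3) S(3) p] U'(3) S(4) by blast
  have xN: "x \<in> normaliser U" using x(1) U'(3) S(4) by blast
  have p0: "p > 0" using p by (simp add: prime_gt_0_nat)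
  have sub: "subgrp (adj U x)" using subgrp_adj[OF U'(1) xN x(3) p0] .
  have le: "adj U x \<subseteq> R" using U' x by (intro adj_subset R) auto
  have finU: "finite U" using U'(2) fin finite_subset by blast
  have card: "card (adj U x) = p * card U" by (rule card_adj_prime[OF U'(1) finU p x(3,2)])
  have "card U > 0" using card_subgrp_pos[OF U'(1) finU] .
  then have "card (adj U x) > card U" using card prime_gt_1_nat[OF p] by simp
  then have "adj U x \<notin> \<U>" using mx by (metis not_le)
  moreover have "S \<subseteq> normaliser (adj U x)"
    using adj_normal[OF U'(1) xN x(3) p0] U'(3) x(4) finite_subset[OF le fin] by blast
  ultimately have "adj U x = R" using sub le by (auto simp: \<U>_def)
  then show thesis using that[of U] U' card by auto
qed

section \<open>Quotients and coprime action\<close>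

typedef 'a bijection = "{f :: 'a \<Rightarrow> 'a. bij f}"
  by (rule exI[of _ id]) simp

setup_lifting type_definition_bijection

instantiation bijection :: (type) group_mult
begin

lift_definition one_bijection :: "'a bijection" is id
  by simp

lift_definition times_bijection :: "'a bijection \<Rightarrow> 'a bijection \<Rightarrow> 'a bijection" is comp
  by (simp add: bij_comp)

lift_definition inverse_bijection :: "'a bijection \<Rightarrow> 'a bijection" is "inv_into UNIV"
  by (simp add: bij_imp_bij_inv)

definition divide_bijection :: "'a bijection \<Rightarrow> 'a bijection \<Rightarrow> 'a bijection" where
  "divide_bijection f g = f * inverse g"

instance
  by standard (transfer; simp add: o_assoc bij_is_inj)+

end

text \<open>The regular representation of N(W)/W on its cosets, extended by the identity so that it
  becomes a bijection of the whole type of sets.\<close>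

definition coset_shift :: "'a::group_mult set \<Rightarrow> 'a \<Rightarrow> 'a set \<Rightarrow> 'a set" where
  "coset_shift W g Y = (if Y \<in> lcosets (normaliser W) W then (*) g ` Y else Y)"

text \<open>The quotient map from \<open>normaliser W\<close> with kernel W. Outside the normaliser
  \<open>coset_shift\<close> may fail to be a bijection, hence the membership conditions in the
  rules about \<open>quo\<close>.\<close>

definition quo :: "'a::group_mult set \<Rightarrow> 'a \<Rightarrow> 'a set bijection" where
  "quo W g = Abs_bijection (coset_shift W g)"

lemma coset_shift_mem:
  assumes "g \<in> normaliser W" "Y \<in> lcosets (normaliser W) W"
  shows "(*) g ` Y \<in> lcosets (normaliser W) W"
proof -
  obtain x where x: "x \<in> normaliser W" "Y = (*) x ` W" using assms(2) by (auto simp: lcosets_def)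
  then have "(*) g ` Y = (*) (g * x) ` W" by (simp add: image_image mult.assoc)
  moreover have "g * x \<in> normaliser W" using subgrp_mult[OF subgrp_normaliser assms(1) x(1)] .
  ultimately show ?thesis by (auto simp: lcosets_def)
qed

lemma coset_shift_mult:
  "g \<in> normaliser W \<Longrightarrow> h \<in> normaliser W \<Longrightarrow> coset_shift W (g * h) = coset_shift W g \<circ> coset_shift W h"
  by (auto simp: coset_shift_def fun_eq_iff coset_shift_mem image_image mult.assoc)

lemma coset_shift_one: "coset_shift W 1 = id"
  by (auto simp: coset_shift_def fun_eq_iff)

lemma bij_coset_shift:
  assumes "g \<in> normaliser W"
  shows "bij (coset_shift W g)"
proof -
  have "inverse g \<in> normaliser W" using assms by (rule subgrp_inv[OF subgrp_normaliser])
  then show ?thesis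
    using coset_shift_mult[of g W "inverse g"] coset_shift_mult[of "inverse g" W g] assms
    by (intro o_bij[of "coset_shift W (inverse g)"]) (simp_all add: coset_shift_one)
qed

lemma quo_mult:
  assumes "g \<in> normaliser W" "h \<in> normaliser W"
  shows "quo W (g * h) = quo W g * quo W h"
  using assms subgrp_mult[OF subgrp_normaliser assms]
  by (simp add: quo_def coset_shift_mult times_bijection.abs_eq eq_onp_def bij_coset_shift)

lemma quo_eq_1_iff:
  assumes W: "subgrp W" and g: "g \<in> normaliser W"
  shows "quo W g = 1 \<longleftrightarrow> g \<in> W"
proof -
  have "quo W g = 1 \<longleftrightarrow> coset_shift W g = id"
    using bij_coset_shift[OF g] by (simp add: quo_def one_bijection_def Abs_bijection_inject)
  also have "\<dots> \<longleftrightarrow> (\<forall>x\<in>normaliser W. (*) (g * x) ` W = (*) x ` W)"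
  proof
    assume id: "coset_shift W g = id"
    show "\<forall>x\<in>normaliser W. (*) (g * x) ` W = (*) x ` W"
    proof
      fix x assume "x \<in> normaliser W"
      then have "(*) x ` W \<in> lcosets (normaliser W) W" by (simp add: lcosets_def)
      then have "(*) g ` ((*) x ` W) = (*) x ` W"
        using fun_cong[OF id, of "(*) x ` W"] by (simp add: coset_shift_def)
      then show "(*) (g * x) ` W = (*) x ` W" by (simp add: image_image mult.assoc)
    qed
  qed (auto simp: coset_shift_def fun_eq_iff lcosets_def image_image mult.assoc)
  also have "\<dots> \<longleftrightarrow> (\<forall>x\<in>normaliser W. cj x g \<in> W)"
    by (simp only: lcoset_eq_iff[OF W] cj_def mult.assoc)
  also have "\<dots> \<longleftrightarrow> g \<in> W"
    using subgrp_one[OF subgrp_normaliser, of W] by (auto simp: normaliserD)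
  finally show ?thesis .
qed

lemma quo_one [simp]: "quo W 1 = 1"
  by (simp add: quo_def coset_shift_one one_bijection_def)

lemma quo_inverse: "g \<in> normaliser W \<Longrightarrow> quo W (inverse g) = inverse (quo W g)"
  using quo_mult[of g W "inverse g"] subgrp_inv[OF subgrp_normaliser, of g W]
  by (intro mult_eq_1_imp_inverse[symmetric]) simp

lemma quo_power: "g \<in> normaliser W \<Longrightarrow> quo W (g ^ n) = quo W g ^ n"
  by (induction n) (simp_all add: quo_mult subgrp_power subgrp_normaliser)

lemma quo_cj: "g \<in> normaliser W \<Longrightarrow> x \<in> normaliser W \<Longrightarrow> quo W (cj g x) = cj (quo W g) (quo W x)"
  by (simp add: cj_def quo_mult quo_inverse subgrp_mult subgrp_inv subgrp_normaliser)

lemma quo_cm: "g \<in> normaliser W \<Longrightarrow> x \<in> normaliser W \<Longrightarrow> quo W (cm x g) = cm (quo W x) (quo W g)"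
  by (simp add: cm_def quo_mult quo_inverse quo_cj subgrp_cj subgrp_inv subgrp_normaliser)

lemma cm_eq_1_iff: "cm x g = 1 \<longleftrightarrow> cj g x = x"
  by (metis cj_cm left_mult_cancel mult_1_right)

text \<open>On an abelian group x |-> [x, g] is an endomorphism with kernel C_A(g); the order
  formula is |A| = |[A, g]| |C_A(g)|.\<close>

lemma cm_abelian:
  assumes A: "subgrp A" "finite A" and ab: "\<And>x y. x \<in> A \<Longrightarrow> y \<in> A \<Longrightarrow> x * y = y * x"
    and g: "g \<in> normaliser A"
  shows cm_abelian_mult: "x \<in> A \<Longrightarrow> y \<in> A \<Longrightarrow> cm (x * y) g = cm x g * cm y g"
    and cm_abelian_inverse: "x \<in> A \<Longrightarrow> cm (inverse x) g = inverse (cm x g)"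
    and cm_abelian_closed: "x \<in> A \<Longrightarrow> cm x g \<in> A"
    and subgrp_cm_image: "subgrp ((\<lambda>x. cm x g) ` A)"
    and card_cm_image: "card A = card ((\<lambda>x. cm x g) ` A) * card {x \<in> A. cj g x = x}"
proof -
  have cA: "cm x g \<in> A" if "x \<in> A" for x
    using that A(1) normaliser_cj[OF g] by (simp add: cm_def subgrp_mult subgrp_inv)
  have fixA: "cj y x = x" if "x \<in> A" "y \<in> A" for x y using ab[OF that] by (simp add: cj_eq_self_iff)
  have hom: "cm (x * y) g = cm x g * cm y g" if "x \<in> A" "y \<in> A" for x y
    using fixA[OF cA that(2)] that by (simp add: cm_mult)
  have inv: "cm (inverse x) g = inverse (cm x g)" if "x \<in> A" for x
    using fixA[OF cA subgrp_inv[OF A(1)]] that by (simp add: cm_inverse)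
  show "x \<in> A \<Longrightarrow> y \<in> A \<Longrightarrow> cm (x * y) g = cm x g * cm y g" by (rule hom)
  show "x \<in> A \<Longrightarrow> cm (inverse x) g = inverse (cm x g)" by (rule inv)
  show "x \<in> A \<Longrightarrow> cm x g \<in> A" by (rule cA)
  show "subgrp ((\<lambda>x. cm x g) ` A)"
    unfolding subgrp_def
  proof (intro conjI ballI)
    show "1 \<in> (\<lambda>x. cm x g) ` A"
      using subgrp_one[OF A(1)] by (intro image_eqI[of _ _ 1]) (auto simp: cm_def)
    fix x assume "x \<in> (\<lambda>x. cm x g) ` A"
    then obtain a where a: "x = cm a g" "a \<in> A" by blast
    show "inverse x \<in> (\<lambda>x. cm x g) ` A"
      using inv[OF a(2)] a subgrp_inv[OF A(1)] by (intro image_eqI[of _ _ "inverse a"]) auto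
    fix y assume "y \<in> (\<lambda>x. cm x g) ` A"
    then obtain b where b: "y = cm b g" "b \<in> A" by blast
    show "x * y \<in> (\<lambda>x. cm x g) ` A"
      using hom[OF a(2) b(2)] a b subgrp_mult[OF A(1)] by (intro image_eqI[of _ _ "a * b"]) auto
  qed
  let ?F = "{x \<in> A. cj g x = x}"
  show "card A = card ((\<lambda>x. cm x g) ` A) * card ?F"
  proof (rule card_fibres[OF A(2)])
    fix x assume x: "x \<in> A"
    have eq: "cm y g = cm x g \<longleftrightarrow> inverse x * y \<in> ?F" if y: "y \<in> A" for y
    proof -
      have xy: "inverse x * y \<in> A" using x y A(1) by (simp add: subgrp_mult subgrp_inv)
      have "cm (inverse x * y) g = inverse (cm x g) * cm y g"
        using hom[OF subgrp_inv[OF A(1) x] y] inv[OF x] by simp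
      then have "cm (inverse x * y) g = 1 \<longleftrightarrow> cm y g = cm x g"
        by (metis left_inv left_mult_cancel)
      then show ?thesis using xy by (simp add: cm_eq_1_iff)
    qed
    have "{y \<in> A. cm y g = cm x g} = (*) x ` ?F"
    proof (intro equalityI subsetI)
      fix y assume "y \<in> {y \<in> A. cm y g = cm x g}"
      then have "inverse x * y \<in> ?F" using eq by blast
      then show "y \<in> (*) x ` ?F" by (intro image_eqI[of _ _ "inverse x * y"]) auto
    next
      fix y assume "y \<in> (*) x ` ?F"
      then obtain z where z: "y = x * z" "z \<in> ?F" by blast
      then have "y \<in> A" using subgrp_mult[OF A(1) x] by blast
      then show "y \<in> {y \<in> A. cm y g = cm x g}" using eq[of y] z by simp
    qed
    then show "card {y \<in> A. cm y g = cm x g} = card ?F"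
      by (simp add: card_image inj_on_def)
  qed
qed

lemma quo_eq_iff:
  assumes W: "subgrp W" and "g \<in> normaliser W" "h \<in> normaliser W"
  shows "quo W g = quo W h \<longleftrightarrow> inverse g * h \<in> W"
proof -
  have "inverse g * h \<in> W \<longleftrightarrow> quo W (inverse g * h) = 1"
    using assms by (simp add: quo_eq_1_iff subgrp_mult subgrp_inv subgrp_normaliser)
  also have "\<dots> \<longleftrightarrow> inverse (quo W g) * quo W h = 1"
    using assms by (simp add: quo_mult quo_inverse subgrp_inv subgrp_normaliser)
  also have "\<dots> \<longleftrightarrow> quo W g = quo W h"
    by (metis inv_inv mult_eq_1_imp_inverse left_inv)
  finally show ?thesis by simp
qed

lemma subgrp_quo_image:
  assumes "subgrp H" "H \<subseteq> normaliser W"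
  shows "subgrp (quo W ` H)"
  unfolding subgrp_def
proof (intro conjI ballI)
  show "1 \<in> quo W ` H" using subgrp_one[OF assms(1)] by (intro image_eqI[of _ _ 1]) auto
  fix x assume "x \<in> quo W ` H"
  then obtain a where a: "x = quo W a" "a \<in> H" by auto
  then show "inverse x \<in> quo W ` H"
    using assms quo_inverse[of a W] subgrp_inv[of H a] by (metis image_eqI subsetD)
  fix y assume "y \<in> quo W ` H"
  then obtain b where b: "y = quo W b" "b \<in> H" by auto
  then show "x * y \<in> quo W ` H"
    using a assms quo_mult[of a W b] subgrp_mult[of H a b] by (metis image_eqI subsetD)
qed

lemma card_quo_image:
  assumes "subgrp H" "H \<subseteq> normaliser W" "subgrp W" "W \<subseteq> H" "finite H"
  shows "card H = card (quo W ` H) * card W"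
proof (rule card_fibres)
  fix x assume x: "x \<in> H"
  have "quo W y = quo W x \<longleftrightarrow> inverse x * y \<in> W" if "y \<in> H" for y
    using quo_eq_iff[OF assms(3), of x y] x that assms(2) by (metis subsetD)
  then have "{y \<in> H. quo W y = quo W x} = (*) x ` W"
    using assms(4) subgrp_mult[OF assms(1) x]
    by (auto simp: image_iff subset_iff) (metis mult_inv_cancel)
  then show "card {y \<in> H. quo W y = quo W x} = card W"
    by (simp add: card_image inj_on_def)
qed (fact assms)

section \<open>Generated subgroups and automorphisms of order prime to \<open>p\<close>\<close>

definition gen :: "'a::group_mult set \<Rightarrow> 'a set" where
  "gen A = \<Inter> {K. subgrp K \<and> A \<subseteq> K}"

lemma subgrp_gen: "subgrp (gen A)"
  by (auto simp: gen_def subgrp_def)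

lemma gen_sub: "A \<subseteq> gen A"
  by (auto simp: gen_def)

lemma gen_least: "subgrp K \<Longrightarrow> A \<subseteq> K \<Longrightarrow> gen A \<subseteq> K"
  by (auto simp: gen_def)

text \<open>h^i sends x to x c^i; for i = m this gives c^m = 1, while the order of c is a power of
  \<open>p\<close>.\<close>

lemma coprime_action_trivial:
  assumes h: "h ^ m = 1" "coprime m (p::nat)" and c: "cj h x = x * c" "cj h c = c" "c ^ (p ^ k) = 1"
  shows "c = (1 :: 'a::group_mult)"
proof -
  have "cj (h ^ i) x = x * c ^ i" for i
  proof (induction i)
    case (Suc i)
    have "cj (h ^ Suc i) x = cj h (cj (h ^ i) x)" by (simp add: power_commutes flip: cj_prod)
    then show ?case using Suc c by (simp add: cj_mult cj_power mult.assoc)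
  qed simp
  from this[of m] have "c ^ m = 1"
    using h(1) by (metis cj_one(1) left_mult_cancel mult_1_right)
  then show ?thesis
    using power_mem_coprime[of "{1}" c m "p ^ k"] c h by (simp add: subgrp_trivial)
qed

lemma commuting_power_mult:
  assumes "x * y = y * (x :: 'a::monoid_mult)"
  shows "(x * y) ^ n = x ^ n * y ^ n"
proof (induction n)
  case (Suc n)
  have "(x * y) ^ Suc n = x * (y * x ^ n) * y ^ n" by (simp add: Suc mult.assoc)
  also have "y * x ^ n = x ^ n * y" using power_commuting_commutes[OF assms, of n] by simp
  finally show ?case by (simp add: mult.assoc)
qed simp

text \<open>Here z is the commutator [b, a], and the sum over {..<n} is n(n-1)/2, the number of
  times some b has to pass some a.\<close>

lemma class2_power:
  fixes a b z :: "'a::monoid_mult"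
  assumes ba: "b * a = a * b * z" and za: "z * a = a * z" and zb: "z * b = b * z"
  shows "(a * b) ^ n = a ^ n * b ^ n * z ^ (\<Sum>{..<n})" "b ^ n * a = a * b ^ n * z ^ n"
proof -
  have zna: "z ^ k * a = a * z ^ k" and znb: "z ^ k * b = b * z ^ k" for k
    using power_commuting_commutes[OF za, of k] power_commuting_commutes[OF zb, of k] by auto
  have bna: "b ^ k * a = a * b ^ k * z ^ k" for k
  proof (induction k)
    case (Suc k)
    have "b ^ Suc k * a = b ^ k * (b * a)" by (simp add: power_Suc2 mult.assoc del: power_Suc)
    also have "\<dots> = (b ^ k * a) * b * z" by (simp add: ba mult.assoc)
    also have "\<dots> = a * b ^ k * (z ^ k * b) * z" by (simp add: Suc mult.assoc)
    also have "\<dots> = a * (b ^ k * b) * (z ^ k * z)" by (simp add: znb mult.assoc)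
    finally show ?case by (simp add: power_Suc2 del: power_Suc)
  qed simp
  then show "b ^ n * a = a * b ^ n * z ^ n" .
  show "(a * b) ^ n = a ^ n * b ^ n * z ^ (\<Sum>{..<n})"
  proof (induction n)
    case (Suc n)
    let ?t = "\<Sum>{..<n}"
    have "(a * b) ^ Suc n = (a ^ n * b ^ n * z ^ ?t) * (a * b)"
      using Suc by (simp add: power_Suc2 del: power_Suc)
    also have "\<dots> = a ^ n * b ^ n * (z ^ ?t * a) * b" by (simp add: mult.assoc)
    also have "\<dots> = a ^ n * (b ^ n * a) * (z ^ ?t * b)" by (simp add: zna mult.assoc)
    also have "\<dots> = a ^ n * (a * b ^ n * z ^ n) * (b * z ^ ?t)" by (simp only: bna znb)
    also have "\<dots> = (a ^ n * a) * (b ^ n * b) * (z ^ n * z ^ ?t)"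
    proof -
      have "z ^ n * (b * z ^ ?t) = b * (z ^ n * z ^ ?t)" by (simp only: znb flip: mult.assoc)
      then show ?thesis by (simp only: mult.assoc)
    qed
    also have "\<dots> = a ^ Suc n * b ^ Suc n * z ^ (n + ?t)"
      by (simp only: power_Suc2 power_add)
    also have "n + ?t = \<Sum>{..<Suc n}" by simp
    finally show ?case .
  qed simp
qed

text \<open>Oddness of \<open>p\<close> enters here: the exponent of z in the \<open>p\<close>-th
  power formula is divisible by \<open>p\<close>.\<close>

lemma dvd_sum_lessThan_odd:
  assumes "odd (p::nat)"
  shows "p dvd \<Sum>{..<p}"
proof -
  have s: "2 * \<Sum>{..<n} = n * (n - 1)" for n :: nat
  proof (induction n)
    case (Suc n)
    then show ?case by (cases n) (auto simp: algebra_simps)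
  qed simp
  have "p dvd 2 * \<Sum>{..<p}" unfolding s by simp
  moreover have "coprime p 2" using assms by simp
  ultimately show ?thesis using coprime_dvd_mult_right_iff by blast
qed

text \<open>Induction on the order of x. By induction h fixes x^p, so y = x^h has y^p = x^p. This
  power commutes with x, so z = [y, x^-1] has z^p = 1, and the power formula gives (x^-1 y)^p = 1.
  Hence [x, h] = x^-1 y is fixed by h, and coprimeness makes it trivial.\<close>

lemma class2_coprime_action:
  assumes p: "prime (p::nat)" "odd p" and h: "h ^ m = 1" "coprime m p"
    and H: "subgrp H" "card H = p ^ n" "h \<in> normaliser H"
    and cl: "\<And>x y z. x \<in> H \<Longrightarrow> y \<in> H \<Longrightarrow> z \<in> H \<Longrightarrow> cm x y * z = z * cm x y"
    and om: "\<And>x. x \<in> H \<Longrightarrow> x ^ p = 1 \<Longrightarrow> cj h x = x"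
    and x: "x \<in> H"
  shows "cj h x = x"
proof -
  have "cj h x = x" if "x ^ (p ^ k) = 1" "x \<in> H" for x k
    using that
  proof (induction k arbitrary: x)
    case 0
    then show ?case by simp
  next
    case (Suc k)
    define y where "y = cj h x"
    have y: "y \<in> H" using Suc H(3) by (simp add: y_def normaliser_cj)
    have "cj h (x ^ p) = x ^ p"
      using Suc by (intro Suc.IH) (simp_all add: subgrp_power H power_mult)
    then have yp: "y ^ p = x ^ p" by (simp add: y_def cj_power)
    define a z where "a = inverse x" and "z = cm y a"
    have a: "a \<in> H" using Suc H by (simp add: a_def subgrp_inv)
    have ba: "y * a = a * y * z" by (simp add: z_def cm_def cj_def mult.assoc)
    have za: "z * a = a * z" "z * y = y * z" using cl y a by (simp_all add: z_def)
    have "y ^ p * a = a * y ^ p * z ^ p" by (rule class2_power(2)[OF ba za])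
    moreover have "y ^ p * a = a * y ^ p"
      unfolding yp a_def by (rule power_commuting_commutes) simp
    ultimately have zp: "z ^ p = 1" by (metis left_mult_cancel mult_1_right)
    obtain t where t: "\<Sum>{..<p} = p * t" using dvd_sum_lessThan_odd[OF p(2)] by (elim dvdE)
    have "(a * y) ^ p = a ^ p * y ^ p * z ^ (\<Sum>{..<p})" by (rule class2_power(1)[OF ba za])
    also have "\<dots> = 1" using zp by (simp add: t power_mult yp a_def flip: inv_power)
    finally have c: "(a * y) ^ p = 1" .
    have "a * y \<in> H" using a y H by (simp add: subgrp_mult)
    then have "cj h (a * y) = a * y" using om c by blast
    moreover have "cj h x = x * (a * y)" by (simp add: a_def y_def)
    moreover have "(a * y) ^ (p ^ 1) = 1" using c by simp
    ultimately have "a * y = 1" using coprime_action_trivial[OF h] by blast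
    then show ?case using \<open>cj h x = x * (a * y)\<close> by simp
  qed
  moreover have "x ^ (p ^ n) = 1" by (rule p_group_power) (fact H p x)+
  ultimately show ?thesis using x by blast
qed

text \<open>Passing to the subgroup generated by the commutators with \<open>h\<close> forces nilpotency class at
  most two, where the \<open>p\<close>-th power map is multiplicative up to \<open>p\<close>-th powers of commutators.\<close>

lemma coprime_action_on_omega:
  assumes p: "prime (p::nat)" "odd p" and h: "h ^ m = 1" "coprime m p"
    and Q: "subgrp Q" "card Q = p ^ n" "h \<in> normaliser Q"
    and om: "\<And>x. x \<in> Q \<Longrightarrow> x ^ p = 1 \<Longrightarrow> cj h x = x"
    and x: "x \<in> Q"
  shows "cj h x = x"
proof -
  have finQ: "finite Q" using Q(2) p(1) by (rule finite_p_group)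
  have "\<forall>x\<in>H. cj h x = x" if "subgrp H" "H \<subseteq> Q" "h \<in> normaliser H" for H
    using that
  proof (induction "card H" arbitrary: H rule: less_induct)
    case less
    note H = less.prems
    have finH: "finite H" using H finQ finite_subset by blast
    obtain r where r: "card H = p ^ r" using prime_power_card[OF H(1,2) Q(1,2) p(1)] by metis
    define D where "D = gen ((\<lambda>x. cm x h) ` H)"
    have DH: "D \<subseteq> H"
      unfolding D_def using H by (intro gen_least) (auto simp: cm_def subgrp_mult subgrp_inv normaliser_cj)
    have D: "subgrp D" by (simp add: D_def subgrp_gen)
    have cmD: "cm x h \<in> D" if "x \<in> H" for x
      using gen_sub[of "(\<lambda>x. cm x h) ` H"] that by (auto simp: D_def)
    have IH: "cj h x = x" if "subgrp M" "M \<subset> H" "h \<in> normaliser M" "x \<in> M" for M x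
      using less.hyps[of M] that H(2) psubset_card_mono[OF finH that(2)] by blast
    show ?case
    proof (cases "D = H")
      \<comment> \<open>If D = [H, h] is proper, then by induction h fixes every [x, h], and
        coprimeness makes these commutators trivial.\<close>
      case False
      have "D \<subseteq> {x. cj h x \<in> D}"
        unfolding D_def
      proof (rule gen_least)
        show "subgrp {x. cj h x \<in> gen ((\<lambda>x. cm x h) ` H)}"
          using subgrp_gen[of "(\<lambda>x. cm x h) ` H"] by (simp add: subgrp_def cj_mult cj_inverse)
        show "(\<lambda>x. cm x h) ` H \<subseteq> {x. cj h x \<in> gen ((\<lambda>x. cm x h) ` H)}"
        proof clarsimp
          fix x assume "x \<in> H"
          have "cj h (cm x h) = cm (cj h x) h" by (simp add: cm_def cj_mult cj_inverse)
          then show "cj h (cm x h) \<in> gen ((\<lambda>x. cm x h) ` H)"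
            using cmD[of "cj h x"] normaliser_cj[OF H(3) \<open>x \<in> H\<close>] by (simp add: D_def)
        qed
      qed
      then have hD: "h \<in> normaliser D"
        using finite_subset[OF DH finH] by (intro normaliserI) auto
      show ?thesis
      proof
        fix x assume x: "x \<in> H"
        have c: "cm x h \<in> D" "cm x h \<in> Q" using cmD x DH H by blast+
        have "cj h (cm x h) = cm x h" using IH[OF D _ hD c(1)] DH False by blast
        moreover have "cm x h ^ (p ^ n) = 1" by (rule p_group_power) (fact Q p c)+
        ultimately have "cm x h = 1" using coprime_action_trivial[OF h cj_cm] by blast
        then show "cj h x = x" by (simp add: cm_eq_1_iff)
      qed
    next
      case True
      \<comment> \<open>Since h centralises the proper subgroup M, the elements x and x^h act on M
        in the same way; so [H, h], which is H here, centralises M.\<close>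
      have cent: "y * x = x * y" if M: "subgrp M" "M \<subset> H" "h \<in> normaliser M" "H \<subseteq> normaliser M"
        and "y \<in> M" "x \<in> H" for M x y
      proof -
        have "D \<subseteq> centraliser M"
          unfolding D_def
        proof (intro gen_least subgrp_centraliser, clarsimp)
          fix x assume x: "x \<in> H"
          have "cj (cm x h) y = y" if y: "y \<in> M" for y
          proof -
            define y' where "y' = cj (inverse x) y"
            have "inverse x \<in> normaliser M" using x H M by (auto intro: subgrp_inv)
            then have y': "y' \<in> M" using y by (simp add: y'_def normaliser_cj)
            have "cj (cm x h) y = cj (cj h x) y'" by (simp add: cm_def cj_prod y'_def)
            also have "\<dots> = cj (cj h x) (cj h y')" using IH[OF M(1-3) y'] by simp
            also have "\<dots> = cj h (cj x y')" by (rule cj_cj[symmetric])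
            also have "\<dots> = y" using IH[OF M(1-3) y] by (simp add: y'_def)
            finally show ?thesis .
          qed
          then show "cm x h \<in> centraliser M" by (simp add: centraliser_def)
        qed
        then have "x \<in> centraliser M" using True that by blast
        then show ?thesis using \<open>y \<in> M\<close> by (simp add: centraliser_def cj_eq_self_iff)
      qed
      define Z where "Z = H \<inter> centraliser H"
      have Z: "subgrp Z" "Z \<subseteq> H" using subgrp_Int[OF H(1) subgrp_centraliser] by (auto simp: Z_def)
      have HZ: "H \<subseteq> normaliser Z"
        unfolding Z_def using subgrp_le_normaliser[OF H(1)] normaliser_centraliser[of H]
        by (auto intro: normaliser_Int)
      have hZ: "h \<in> normaliser Z"
        unfolding Z_def using H(3) normaliser_centraliser[of H] by (auto intro: normaliser_Int)
      have Zc: "z * x = x * z" if "z \<in> Z" "x \<in> H" for z x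
      proof -
        have "cj z x = x" using that by (auto simp: Z_def centraliser_def)
        then show ?thesis by (simp add: cj_eq_self_iff)
      qed
      have class2: "cm x y \<in> Z" if "x \<in> H" "y \<in> H" for x y
      proof (cases "Z = H")
        case True
        then show ?thesis using that H by (simp add: cm_def subgrp_mult subgrp_inv subgrp_cj)
      next
        case False
        then have ZH: "Z \<subset> H" using Z by blast
        obtain x0 where x0: "x0 \<in> H" "x0 \<notin> Z" "\<And>s. s \<in> H \<Longrightarrow> cm x0 s \<in> Z"
          using p_group_central_step[OF Z(1) H(1) ZH r HZ H(1) r HZ subgrp_le_normaliser[OF H(1)] p(1)]
          by metis
        \<comment> \<open>M/Z is the centre of H/Z. Were M proper, \<open>cent\<close> would put it
          into the centre Z of H, against the choice of \<open>x0\<close>.\<close>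
        define M where "M = {x \<in> H. \<forall>s\<in>H. x \<in> fixmod Z s}"
        have M: "subgrp M" "M \<subseteq> H"
          using subgrp_fixmod[OF Z(1)] H(1) by (auto simp: M_def subgrp_def)
        have ZM: "Z \<subseteq> M"
          using fixmod_sub[OF Z(1)] HZ Z(2) by (auto simp: M_def)
        have HM: "H \<subseteq> normaliser M"
        proof
          fix g assume g: "g \<in> H"
          show "g \<in> normaliser M"
          proof (rule normaliserI)
            show "finite M" using M finH finite_subset by blast
            fix x assume x: "x \<in> M"
            then have "cm x g \<in> M" using g ZM by (auto simp: M_def fixmod_def)
            then show "cj g x \<in> M" using x M by (simp add: cj_cm subgrp_mult)
          qed
        qed
        have hM: "h \<in> normaliser M"
        proof (rule normaliserI)
          show "finite M" using M finH finite_subset by blast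
          fix x assume x: "x \<in> M"
          have hx: "cj h x \<in> H" using x M(2) normaliser_cj[OF H(3)] by blast
          have "cm (cj h x) s \<in> Z" if "s \<in> H" for s
          proof -
            have "cj (inverse h) s \<in> H"
              using normaliser_cj[OF subgrp_inv[OF subgrp_normaliser H(3)] that] .
            then have "cm x (cj (inverse h) s) \<in> Z" using x by (simp add: M_def fixmod_def)
            then have "cj h (cm x (cj (inverse h) s)) \<in> Z" by (rule normaliser_cj[OF hZ])
            then show ?thesis by (simp add: cm_def cj_mult cj_inverse cj_cj[of h "cj (inverse h) s"])
          qed
          then show "cj h x \<in> M" using hx HZ by (auto simp: M_def fixmod_def)
        qed
        have "M = H"
        proof (rule ccontr)
          assume "M \<noteq> H"
          then have MH: "M \<subset> H" using M by blast
          have "x0 \<in> M" using x0 HZ by (auto simp: M_def fixmod_def)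
          then have "x0 * y = y * x0" if "y \<in> H" for y using cent[OF M(1) MH hM HM _ that] by blast
          then have "x0 \<in> centraliser H" by (simp add: centraliser_def cj_eq_self_iff)
          then show False using x0 by (simp add: Z_def)
        qed
        then show ?thesis using that by (auto simp: M_def fixmod_def)
      qed
      show ?thesis
      proof
        fix x assume "x \<in> H"
        show "cj h x = x"
        proof (rule class2_coprime_action[OF p h H(1) r H(3) _ _ \<open>x \<in> H\<close>])
          show "cm a b * c = c * cm a b" if "a \<in> H" "b \<in> H" "c \<in> H" for a b c
            using Zc[OF class2[OF that(1,2)] that(3)] .
        qed (use om H in blast)
      qed
    qed
  qed
  then show ?thesis using Q x by blast
qed

section \<open>Groups all of whose subgroups of a given order are invariant\<close>

text \<open>All elements of X of order prime to \<open>p\<close> lie in C, so X/C is a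
  \<open>p\<close>-group and X = CR for a Sylow \<open>p\<close>-subgroup R of X. Since T has index
  prime to \<open>p\<close> in N, some element of N conjugates R into T, and it normalises
  C.\<close>

lemma p_prime_elements_central:
  assumes N: "subgrp N" "finite N" and T: "subgrp T" "T \<subseteq> N" and p: "prime (p::nat)"
    and ind: "\<not> p dvd card N div card T" and X: "subgrp X" "X \<subseteq> N"
    and C: "subgrp C" "C \<subseteq> X" "N \<subseteq> normaliser C"
    and el: "\<And>h m. h \<in> X \<Longrightarrow> h ^ m = 1 \<Longrightarrow> coprime m p \<Longrightarrow> h \<in> C"
  obtains n where "n \<in> N" "\<And>g. g \<in> X \<Longrightarrow> cj n g \<in> sprod C T"
proof -
  have finX: "finite X" using X N finite_subset by blast
  obtain R where R: "subgrp R" "R \<subseteq> X" "card R = p ^ multiplicity p (card X)"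
    using sylow_exists[OF p X(1) finX] by blast
  have RN: "R \<subseteq> normaliser C" using R X C by blast
  have CR: "subgrp (sprod C R)" "sprod C R \<subseteq> X" "C \<subseteq> sprod C R" "R \<subseteq> sprod C R"
    using subgrp_sprod[OF C(1) R(1) RN] sprod_subset[OF X(1) C(2) R(2)] sprod_left[OF R(1)] sprod_right[OF C(1)]
    by auto
  have finCR: "finite (sprod C R)" using CR(2) finX finite_subset by blast
  \<comment> \<open>Checked prime by prime: a Sylow q-subgroup of X lies in C if q differs from
    \<open>p\<close>, and has the order of R if q = \<open>p\<close>.\<close>
  have "card X dvd card (sprod C R)"
  proof (rule multiplicity_le_imp_dvd)
    show "card X \<noteq> 0" using card_subgrp_pos[OF X(1) finX] by simp
    fix q :: nat assume q: "prime q"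
    obtain Y where Y: "subgrp Y" "Y \<subseteq> X" "card Y = q ^ multiplicity q (card X)"
      using sylow_exists[OF q X(1) finX] by blast
    have "card Y dvd card (sprod C R)"
    proof (cases "q = p")
      case True
      then have "card Y = card R" using Y R by simp
      then show ?thesis using card_subgrp_dvd[OF R(1) CR(1,4) finCR] by simp
    next
      case False
      have "Y \<subseteq> C"
      proof
        fix y assume y: "y \<in> Y"
        have "y ^ card Y = 1" using power_card[OF Y(1) _ y] finite_subset[OF Y(2) finX] by blast
        moreover have "coprime (card Y) p" using False p q Y(3) by (simp add: primes_coprime)
        ultimately show "y \<in> C" using el y Y(2) by blast
      qed
      then show ?thesis using card_subgrp_dvd[OF Y(1) CR(1) _ finCR] CR(3) by blast
    qed
    then show "multiplicity q (card X) \<le> multiplicity q (card (sprod C R))"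
      using card_subgrp_pos[OF CR(1) finCR] q Y(3) by (intro multiplicity_geI) auto
  qed
  then have "card X \<le> card (sprod C R)"
    using card_subgrp_pos[OF CR(1) finCR] dvd_imp_le by blast
  then have XCR: "sprod C R = X" using CR(2) finX by (meson card_seteq)
  obtain n where n: "n \<in> N" "\<And>r. r \<in> R \<Longrightarrow> cj n r \<in> T"
    using sylow_conjugate[OF N T R(1) _ R(3) p ind] R(2) X(2) by blast
  have "cj n g \<in> sprod C T" if g: "g \<in> X" for g
  proof -
    obtain c r where cr: "g = c * r" "c \<in> C" "r \<in> R" using g XCR sprodE[of g C R] by metis
    moreover have "cj n c \<in> C" using cr n C by (auto intro: normaliser_cj)
    ultimately show ?thesis using n by (auto simp: cj_mult intro: sprodI)
  qed
  then show thesis using that n(1) by blast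
qed

text \<open>Averaging over the powers of h: the images of x are x c_i with c_i = [x, h^i] in the
  abelian group W. As m is invertible modulo |W|, the product of the c_i for i < m can be raised to
  the inverse of m, which gives the mean of these images; h fixes it.\<close>

lemma coprime_fixed_point_in_coset:
  assumes W: "subgrp W" "card W = p ^ k" "h \<in> normaliser W" and p: "prime (p::nat)"
    and ab: "\<And>x y. x \<in> W \<Longrightarrow> y \<in> W \<Longrightarrow> x * y = y * x"
    and h: "h ^ m = 1" "coprime m p" and x: "cm x h \<in> W"
  obtains w where "w \<in> W" "cj h (x * w) = x * w"
proof -
  define c where "c i = cm x (h ^ i)" for i
  have c0: "c 0 = 1" "c m = 1" by (simp_all add: c_def cm_def h)
  have step: "cj h (c i) = inverse (c 1) * c (Suc i)" for i
    by (simp add: c_def cm_def cj_mult cj_inverse cj_prod mult.assoc power_commutes[symmetric])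
  have cW: "c i \<in> W" for i
  proof (induction i)
    case 0
    then show ?case using W by (simp add: c0 subgrp_one)
  next
    case (Suc i)
    have "c (Suc i) = c 1 * cj h (c i)" by (simp add: step)
    then show ?case using Suc x W by (simp add: c_def subgrp_mult normaliser_cj)
  qed
  \<comment> \<open>The product of the \<open>c j\<close> with j < i.\<close>
  define P where "P i = rec_nat 1 (\<lambda>i a. a * c i) i" for i
  have P: "P 0 = 1" "P (Suc i) = P i * c i" for i by (simp_all add: P_def)
  have PW: "P i \<in> W" for i
    by (induction i) (use W cW in \<open>auto simp: P subgrp_one subgrp_mult\<close>)
  have iW: "inverse (c 1) ^ i \<in> W" for i using W cW by (simp add: subgrp_power subgrp_inv)
  have hP: "cj h (P i) = inverse (c 1) ^ i * P (Suc i)" for i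
  proof (induction i)
    case (Suc i)
    have "cj h (P (Suc i)) = inverse (c 1) ^ i * (P (Suc i) * inverse (c 1)) * c (Suc i)"
      by (simp only: P(2)[of i] cj_mult Suc step) (simp add: mult.assoc P)
    also have "P (Suc i) * inverse (c 1) = inverse (c 1) * P (Suc i)"
      using ab[OF PW[of "Suc i"] iW[of 1]] by simp
    finally show ?case by (simp add: P(2)[of "Suc i"] mult.assoc power_Suc2 del: power_Suc)
  qed (simp add: P c0)
  have "P (Suc m) = P m" by (simp add: P c0)
  then have hPm: "cj h (P m) = inverse (c 1) ^ m * P m" using hP[of m] by simp
  have "coprime m (p ^ k)" using h(2) by simp
  moreover have "c 1 ^ (p ^ k) = 1" by (rule p_group_power) (fact W p cW)+
  ultimately have "\<exists>a. inverse (c 1) ^ (m * a) = inverse (c 1)"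
  proof (cases "m = 0")
    case True
    then have "p ^ k = 1" using \<open>coprime m (p ^ k)\<close> by auto
    then have "c 1 = 1" using \<open>c 1 ^ (p ^ k) = 1\<close> by (simp only: power_one_right)
    then show ?thesis by simp
  next
    case False
    then obtain a b where ab: "m * a = p ^ k * b + gcd m (p ^ k)" using bezout_nat by blast
    then have "m * a = p ^ k * b + 1" using \<open>coprime m (p ^ k)\<close> by simp
    moreover have "inverse (c 1) ^ (p ^ k) = 1" using \<open>c 1 ^ (p ^ k) = 1\<close> by (simp flip: inv_power)
    ultimately have "inverse (c 1) ^ (m * a) = inverse (c 1)"
      by (simp only: power_add power_mult) simp
    then show ?thesis by blast
  qed
  then obtain a where a: "inverse (c 1) ^ (m * a) = inverse (c 1)" by blast
  have "cj h (P m ^ a) = (inverse (c 1) ^ m) ^ a * P m ^ a"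
    unfolding cj_power hPm by (rule commuting_power_mult) (use ab iW PW in blast)
  also have "(inverse (c 1) ^ m) ^ a = inverse (c 1)" using a by (simp add: power_mult)
  finally have "cj h (x * P m ^ a) = x * (c 1 * (inverse (c 1) * P m ^ a))"
    by (simp add: cj_mult cj_cm[of h x] c_def mult.assoc)
  then have "cj h (x * P m ^ a) = x * P m ^ a" by simp
  then show thesis using that[of "P m ^ a"] PW W by (simp add: subgrp_power)
qed

text \<open>For W <= V, the elements that stabilise the pair by acting trivially on the section
  V/W.\<close>

definition stabmod :: "'a::group_mult set \<Rightarrow> 'a set \<Rightarrow> 'a set" where
  "stabmod V W = {g \<in> normaliser W. \<forall>x\<in>V. cm x g \<in> W}"

lemma cm_prod: "cm x (g * h) = cm x h * cj h (cm x g)"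
  by (simp add: cm_def cj_prod cj_mult cj_inverse mult.assoc)

lemma cm_inv: "cm x (inverse g) = inverse (cj (inverse g) (cm x g))"
  by (simp add: cm_def cj_mult cj_inverse)

lemma subgrp_stabmod: "subgrp W \<Longrightarrow> subgrp (stabmod V W)"
  unfolding subgrp_def[of "stabmod V W"]
proof (intro conjI ballI)
  assume W: "subgrp W"
  note n = subgrp_normaliser[of W]
  show "1 \<in> stabmod V W" using W n by (simp add: stabmod_def cm_def subgrp_one)
  fix g assume g: "g \<in> stabmod V W"
  then have "inverse g \<in> normaliser W" using subgrp_inv[OF n] by (simp add: stabmod_def)
  then show "inverse g \<in> stabmod V W"
    using g W by (simp add: stabmod_def cm_inv subgrp_inv normaliser_cj)
  fix h assume h: "h \<in> stabmod V W"
  then show "g * h \<in> stabmod V W"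
    using g W subgrp_mult[OF n] by (simp add: stabmod_def cm_prod subgrp_mult normaliser_cj)
qed

lemma stabmodD: "g \<in> stabmod V W \<Longrightarrow> x \<in> V \<Longrightarrow> cm x g \<in> W"
  by (simp add: stabmod_def)

lemma centraliser_stabmod: "subgrp W \<Longrightarrow> W \<subseteq> V \<Longrightarrow> centraliser V \<subseteq> stabmod V W"
  using centraliser_le_normaliser[of W]
  by (auto simp: stabmod_def centraliser_def cm_def subgrp_one)

text \<open>V/W is cyclic, generated by the coset of \<open>x0\<close>, so the exponent with which u
  acts on this coset is valid on all of V/W.\<close>

lemma power_action_on_prime_index:
  assumes W: "subgrp W" "V = adj W x0" "V \<subseteq> normaliser W" and x0: "x0 \<in> V"
    and u: "u \<in> normaliser W" "u \<in> normaliser V"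
  obtains i where "\<And>x. x \<in> V \<Longrightarrow> quo W (cj u x) = quo W x ^ i"
proof -
  have gen: "\<exists>k. quo W x = quo W x0 ^ k" if "x \<in> V" for x
  proof -
    obtain w k where "x = w * x0 ^ k" "w \<in> W" using \<open>x \<in> V\<close> W(2) adjE by metis
    moreover have "w \<in> normaliser W" "x0 \<in> normaliser W"
      using subgrp_le_normaliser[OF W(1)] \<open>w \<in> W\<close> x0 W(3) by auto
    ultimately have "quo W x = quo W x0 ^ k"
      using W(1) by (simp add: quo_mult quo_power subgrp_power subgrp_normaliser quo_eq_1_iff[THEN iffD2])
    then show ?thesis ..
  qed
  obtain i where i: "quo W (cj u x0) = quo W x0 ^ i" using gen normaliser_cj[OF u(2) x0] by blast
  have "quo W (cj u x) = quo W x ^ i" if x: "x \<in> V" for x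
  proof -
    obtain k where k: "quo W x = quo W x0 ^ k" using gen x by blast
    have "quo W (cj u x) = cj (quo W u) (quo W x0) ^ k"
      using x u W(3) k by (simp add: quo_cj subset_iff cj_power)
    also have "cj (quo W u) (quo W x0) = quo W x0 ^ i"
      using i x0 u W(3) by (simp add: quo_cj subset_iff)
    finally show ?thesis by (simp add: k mult.commute flip: power_mult)
  qed
  then show thesis using that by blast
qed

lemma cm_mem_iff_quo:
  assumes "subgrp W" "x \<in> normaliser W" "g \<in> normaliser W"
  shows "cm x g \<in> W \<longleftrightarrow> quo W (cj g x) = quo W x"
  using quo_eq_iff[OF assms(1,2) subgrp_cj[OF subgrp_normaliser assms(2,3)]] by (auto simp: cm_def)

text \<open>u and v act on V/W as power maps, and power maps commute.\<close>

lemma commutator_trivial_on_prime_index: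
  assumes W: "subgrp W" "V = adj W x0" "V \<subseteq> normaliser W" and x0: "x0 \<in> V"
    and u: "u \<in> normaliser W" "u \<in> normaliser V" and v: "v \<in> normaliser W" "v \<in> normaliser V"
    and x: "x \<in> V"
  shows "cm x (cm u v) \<in> W"
proof -
  obtain i where i: "\<And>x. x \<in> V \<Longrightarrow> quo W (cj u x) = quo W x ^ i"
    using power_action_on_prime_index[OF W x0 u] by blast
  obtain j where j: "\<And>x. x \<in> V \<Longrightarrow> quo W (cj v x) = quo W x ^ j"
    using power_action_on_prime_index[OF W x0 v] by blast
  \<comment> \<open>Chosen such that x = (y^v)^u; then [u, v] sends x to (y^u)^v.\<close>
  define y where "y = cj (inverse u * inverse v) x"
  have "inverse u * inverse v \<in> normaliser V"
    using u v by (intro subgrp_mult subgrp_inv subgrp_normaliser)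
  then have y: "y \<in> V" using x by (simp add: y_def normaliser_cj)
  have "cj u (cj v y) = x" by (simp add: y_def cj_prod)
  then have "quo W x = quo W y ^ (j * i)"
    using i[OF normaliser_cj[OF v(2) y]] j[OF y] by (simp add: power_mult)
  moreover have "cj (cm u v) x = cj v (cj u y)"
    by (simp add: y_def cm_def cj_prod cj_def mult.assoc)
  then have "quo W (cj (cm u v) x) = quo W y ^ (i * j)"
    using j[OF normaliser_cj[OF u(2) y]] i[OF y] by (simp add: power_mult)
  moreover have "cm u v \<in> normaliser W"
    unfolding cm_def using u v by (intro subgrp_mult subgrp_inv subgrp_cj subgrp_normaliser)
  ultimately show ?thesis
    using x W(3) by (subst cm_mem_iff_quo[OF W(1)]) (auto simp: mult.commute)
qed

text \<open>If u acts on V/W with exponent i, then u^(p-1) acts with exponent i^(p-1), which is 1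
  modulo \<open>p\<close> by Fermat.\<close>

lemma power_trivial_on_prime_index:
  assumes W: "subgrp W" "V = adj W x0" "V \<subseteq> normaliser W" and x0: "x0 \<in> V" "x0 \<notin> W"
    and u: "u \<in> normaliser W" "u \<in> normaliser V" and p: "prime (p::nat)"
    and xp: "\<And>x. x \<in> V \<Longrightarrow> x ^ p \<in> W" and x: "x \<in> V"
  shows "cm x (u ^ (p - 1)) \<in> W"
proof -
  obtain i where i: "\<And>x. x \<in> V \<Longrightarrow> quo W (cj u x) = quo W x ^ i"
    using power_action_on_prime_index[OF W x0(1) u] by blast
  have uV: "cj (u ^ k) x \<in> V" if "x \<in> V" for k x
    using that u by (intro normaliser_cj subgrp_power subgrp_normaliser)
  have ik: "quo W (cj (u ^ k) x) = quo W x ^ (i ^ k)" if x: "x \<in> V" for k x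
  proof (induction k)
    case (Suc k)
    have "cj (u ^ Suc k) x = cj u (cj (u ^ k) x)" by (simp add: power_commutes flip: cj_prod)
    then show ?case using i[OF uV[OF x]] Suc by (simp add: mult.commute flip: power_mult)
  qed simp
  have qp: "quo W x ^ p = 1" if "x \<in> V" for x
    using xp[OF that] that W(3) quo_eq_1_iff[OF W(1), of "x ^ p"]
    by (auto simp: quo_power subgrp_power[OF subgrp_normaliser] subset_iff)
  \<comment> \<open>Otherwise u would send \<open>x0\<close> into W, although u normalises W and
    \<open>x0\<close> lies outside.\<close>
  have "\<not> p dvd i"
  proof
    assume "p dvd i"
    then have "quo W (cj u x0) = 1" using i[OF x0(1)] qp[OF x0(1)] by (auto simp: power_mult)
    then have "cj u x0 \<in> W"
      using quo_eq_1_iff[OF W(1)] normaliser_cj[OF u(2) x0(1)] W(3) by blast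
    then show False using x0 normaliserD[OF u(1)] by simp
  qed
  then have "[i ^ (p - 1) = 1] (mod p)" using p by (intro fermat_theorem) auto
  moreover have "i ^ (p - 1) \<ge> 1" using \<open>\<not> p dvd i\<close> by (cases "i = 0") auto
  ultimately obtain t where "i ^ (p - 1) = 1 + p * t"
    by (metis cong_to_1_nat dvd_def le_add_diff_inverse)
  then have "quo W (cj (u ^ (p - 1)) x) = quo W x"
    using ik[OF x, of "p - 1"] qp[OF x] by (simp add: power_mult)
  then show ?thesis
    using x W(3) u by (subst cm_mem_iff_quo[OF W(1)]) (auto intro: subgrp_power subgrp_normaliser)
qed

text \<open>The situation |Q| > \<open>p^d\<close> with N = N_G(Q). It is used for the domains in
  Alperin's argument, and with Q = S for the invariant series.\<close>

locale invariant_subgroups =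
  fixes Q N :: "'a::group_mult set" and p n d :: nat
  assumes p: "prime p" "odd p" and Q: "subgrp Q" "card Q = p ^ n" and d: "0 < d" "d < n"
    and N: "subgrp N" "finite N" "Q \<subseteq> N" "N \<subseteq> normaliser Q"
    and inv: "\<And>H. subgrp H \<Longrightarrow> H \<subseteq> Q \<Longrightarrow> card H = p ^ d \<Longrightarrow> N \<subseteq> normaliser H"
    and ab: "\<And>H x y. subgrp H \<Longrightarrow> H \<subseteq> Q \<Longrightarrow> card H = p ^ d \<Longrightarrow> x \<in> H \<Longrightarrow> y \<in> H \<Longrightarrow> x * y = y * x"
begin

lemma finQ: "finite Q"
  using Q(2) p(1) by (rule finite_p_group)

lemma p0: "p > 0" "p > 1"
  by (rule prime_gt_0_nat prime_gt_1_nat, rule p)+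

lemma powers_subgrp:
  assumes "x \<in> Q"
  shows "subgrp (adj {1} x)"
  using p_group_power[OF Q p(1) assms] p0 by (intro subgrp_adj[of _ _ "p ^ n"]) (auto simp: subgrp_trivial normaliser_trivial)

text \<open>Take K <= Q of order \<open>p^(d+1)\<close>. If K has two subgroups of order
  \<open>p^d\<close>, their intersection is invariant and has the right order. Otherwise K is
  cyclic, and so is its subgroup H of order \<open>p^d\<close>, whose subgroup of index
  \<open>p\<close> is characteristic.\<close>

lemma invariant_of_corank_one:
  obtains W where "subgrp W" "W \<subseteq> Q" "card W = p ^ (d - 1)" "N \<subseteq> normaliser W"
proof -
  obtain K where K: "subgrp K" "K \<subseteq> Q" "card K = p ^ Suc d"
    using intermediate_subgrp[of "{1}" Q p n 0 "Suc d"] subgrp_trivial subgrp_one[OF Q(1)] Q p d by auto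
  have finK: "finite K" using K finQ finite_subset by blast
  obtain H where H: "subgrp H" "H \<subseteq> K" "card H = p ^ d"
    using intermediate_subgrp[OF subgrp_trivial _ K(1,3) p(1), of 0 d] subgrp_one[OF K(1)] by auto
  have HQ: "H \<subseteq> Q" using H K by blast
  show thesis
  proof (cases "\<exists>H'. subgrp H' \<and> H' \<subseteq> K \<and> card H' = p ^ d \<and> H' \<noteq> H")
    case True
    then obtain H' where H': "subgrp H'" "H' \<subseteq> K" "card H' = p ^ d" "H' \<noteq> H" by blast
    have H'Q: "H' \<subseteq> Q" using H' K by blast
    let ?W = "H \<inter> H'"
    have W: "subgrp ?W" using H H' by (simp add: subgrp_Int)
    have sub: "subgrp (sprod H H')"
      using inv[OF H(1) HQ H(3)] N(3) H'Q by (intro subgrp_sprod H H') blast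
    have subK: "sprod H H' \<subseteq> K" using H H' K by (intro sprod_subset) auto
    obtain j where j: "card (sprod H H') = p ^ j" "j \<le> Suc d"
      using prime_power_card[OF sub subK K(1,3) p(1)] by blast
    obtain i where i: "card ?W = p ^ i"
      using prime_power_card[OF W _ H(1,3) p(1)] by blast
    have "\<not> H' \<subseteq> H"
      using card_subset_eq[of H H'] H H' finite_subset[OF H(2) finK] by auto
    then have "H \<subset> sprod H H'"
      using sprod_left[OF H'(1), of H] sprod_right[OF H(1), of H'] by blast
    then have "card H < card (sprod H H')"
      using finite_subset[OF subK finK] by (simp add: psubset_card_mono)
    then have "d < j" using j H(3) p0 by (simp add: power_strict_increasing_iff)
    then have "j = Suc d" using j by simp
    have "p ^ j * p ^ i = p ^ d * p ^ d"
      using card_sprod[OF H(1) H'(1)] finite_subset[OF H(2) finK] finite_subset[OF H'(2) finK] i j H(3) H'(3) by simp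
    then have "j + i = d + d" using p0 by (simp flip: power_add)
    then have "i = d - 1" using \<open>j = Suc d\<close> by simp
    then have "card ?W = p ^ (d - 1)" using i by simp
    moreover have "N \<subseteq> normaliser ?W"
      using inv[OF H(1) HQ H(3)] inv[OF H'(1) H'Q H'(3)] normaliser_Int by blast
    ultimately show thesis using that[OF W] HQ by blast
  next
    \<comment> \<open>H is now the only subgroup of order \<open>p^d\<close> in K, so it contains
      every proper subgroup of K, and any x outside H generates K.\<close>
    case False
    have "H \<noteq> K" using H(3) K(3) p0 by auto
    then obtain x where x: "x \<in> K" "x \<notin> H" using H by blast
    have Kx: "adj {1} x = K"
    proof (rule ccontr)
      assume ne: "adj {1} x \<noteq> K"
      have sx: "subgrp (adj {1} x)" using powers_subgrp x K by blast
      have le: "adj {1} x \<subseteq> K" using K x by (intro adj_subset) (auto simp: subgrp_one)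
      obtain j where j: "card (adj {1} x) = p ^ j" "j \<le> Suc d"
        using prime_power_card[OF sx le K(1,3) p(1)] by blast
      have "j \<noteq> Suc d" using ne card_subset_eq[OF finK le] j K(3) by auto
      then obtain V where V: "subgrp V" "adj {1} x \<subseteq> V" "V \<subseteq> K" "card V = p ^ d"
        using intermediate_subgrp[OF sx le K(1,3) p(1) j(1), of d] j(2) by auto
      then have "V = H" using False by blast
      then show False using V(2) x(2) adj_mem[OF subgrp_trivial, of x] by blast
    qed
    have KN: "K \<subseteq> normaliser H" using inv[OF H(1) HQ H(3)] N(3) K(2) by blast
    have xp: "x ^ p \<in> H"
      using index_prime(1)[OF H(1,2) K(1) finK KN _ p(1) x] H K by simp
    have Hx: "\<exists>i. y = (x ^ p) ^ i" if "y \<in> H" for y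
    proof -
      have "y \<in> adj {1} x" using that H(2) Kx by blast
      then obtain i where i: "y = x ^ i" by (auto simp: adj_def)
      have "p dvd i"
      proof (rule ccontr)
        assume "\<not> p dvd i"
        then have "coprime i p" using p(1) prime_imp_coprime coprime_commute by metis
        then show False using power_mem_coprime[OF H(1) _ xp] that i x(2) by blast
      qed
      then obtain t where "i = p * t" by (elim dvdE)
      then have "y = (x ^ p) ^ t" using i by (simp add: power_mult)
      then show ?thesis ..
    qed
    define y where "y = x ^ p"
    have yQ: "y \<in> Q" using xp HQ by (auto simp: y_def)
    \<comment> \<open>H = <y> is cyclic and W = <y^p> has index \<open>p\<close> in it.\<close>
    define W where "W = adj {1} (y ^ p)"
    have W: "subgrp W" unfolding W_def using yQ Q by (intro powers_subgrp) (simp add: subgrp_power)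
    have WH: "W \<subseteq> H" unfolding W_def using H xp by (intro adj_subset) (auto simp: y_def subgrp_one subgrp_power)
    have Wi: "\<exists>i. w = (y ^ p) ^ i" if "w \<in> W" for w using that by (auto simp: W_def adj_def)
    have finW: "finite W" by (rule finite_subset[OF WH finite_subset[OF H(2) finK]])
    have yW: "y \<notin> W"
    proof
      assume "y \<in> W"
      then obtain i where i: "y = (y ^ p) ^ i" using Wi by blast
      have "y = 1"
      proof (cases "i = 0")
        case False
        \<comment> \<open>From y = y^(p i) follows y^(p i - 1) = 1 with an exponent prime to
          \<open>p\<close>, so y = 1, which would make H trivial.\<close>
        then obtain k where k: "p * i = Suc k" using p0 by (metis Suc_pred nat_0_less_mult_iff neq0_conv)
        then have "y * 1 = y * y ^ k" using i by (simp flip: power_mult)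
        then have "y ^ k = 1" by (metis left_mult_cancel)
        moreover have "coprime k (p ^ n)"
        proof -
          have "coprime k p"
          proof (rule coprimeI)
            fix c assume "c dvd k" "c dvd p"
            then have "c dvd p * i" "c dvd k" by auto
            then have "c dvd Suc k - k" using k by (metis dvd_diff_nat)
            then show "is_unit c" by simp
          qed
          then show ?thesis by simp
        qed
        moreover have "y ^ (p ^ n) = 1" using p_group_power[OF Q p(1) yQ] .
        ultimately show ?thesis using power_mem_coprime[OF subgrp_trivial, of y k "p ^ n"] by simp
      qed (use i in simp)
      then have "H \<subseteq> {1}" using Hx by (auto simp: y_def)
      then have "card H \<le> 1" using card_mono[of "{1}" H] by simp
      then show False using H(3) p0 d by (metis leD one_less_power)
    qed
    have "adj W y = H"
    proof (intro equalityI)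
      show "adj W y \<subseteq> H" using H(1) WH xp by (intro adj_subset) (auto simp: y_def)
      show "H \<subseteq> adj W y"
      proof
        fix z assume "z \<in> H"
        then obtain i where "z = y ^ i" using Hx by (auto simp: y_def)
        then show "z \<in> adj W y" using adjI[OF subgrp_one[OF W], of y i] by simp
      qed
    qed
    moreover have "y ^ p \<in> W" unfolding W_def by (rule adj_mem[OF subgrp_trivial])
    ultimately have "p ^ d = p * card W" using card_adj_prime[OF W finW p(1) _ yW] H(3) by simp
    moreover have "p ^ d = p * p ^ (d - 1)" using d by (simp flip: power_Suc)
    ultimately have "card W = p ^ (d - 1)" using p0 by simp
    moreover have "N \<subseteq> normaliser W"
    proof
      fix g assume g: "g \<in> N"
      have "cj g y \<in> H" using inv[OF H(1) HQ H(3)] g xp by (auto simp: y_def intro: normaliser_cj)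
      then obtain j where j: "cj g y = y ^ j" using Hx by (auto simp: y_def)
      have "cj g (y ^ p) = (y ^ p) ^ j" by (simp add: cj_power j flip: power_mult) (simp add: mult.commute)
      moreover have "y ^ p \<in> W" unfolding W_def by (rule adj_mem[OF subgrp_trivial])
      ultimately have "cj g w \<in> W" if "w \<in> W" for w
        using Wi[OF that] W by (auto simp: cj_power[of g "y ^ p"] subgrp_power)
      then show "g \<in> normaliser W" using finW by (intro normaliserI)
    qed
    ultimately show thesis using that[OF W] WH HQ by blast
  qed
qed

text \<open>If \<open>R = [W, h]\<close> is nontrivial, it is complemented in \<open>Q\<close> by \<open>C = C\<^sub>Q(h)\<close>. For \<open>U\<close> normal of index \<open>p\<close>
  in \<open>R\<close>, \<open>C\<^sub>1\<close> of index \<open>p\<close> in \<open>C\<^sub>2 \<le> C\<close>, \<open>r \<in> R - U\<close> and \<open>c \<in> C\<^sub>2 - C\<^sub>1\<close>, the subgroup \<open>U C\<^sub>1 \<langle>r c\<rangle>\<close>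
  meets \<open>R\<close> in \<open>U\<close>, so its \<open>h\<close>-invariance gives \<open>[R, h] \<le> U\<close>.\<close>

lemma coprime_centralises:
  assumes W: "subgrp W" "W \<subseteq> Q" "card W = p ^ (d - 1)" "N \<subseteq> normaliser W"
    and h: "h \<in> N" "h ^ m = 1" "coprime m p"
    and triv: "\<And>V x. subgrp V \<Longrightarrow> W \<subseteq> V \<Longrightarrow> V \<subseteq> Q \<Longrightarrow> card V = p ^ d \<Longrightarrow> x \<in> V \<Longrightarrow> cm x h \<in> W"
  shows "h \<in> centraliser Q"
proof -
  have QN: "Q \<subseteq> normaliser W" using N W by blast
  have hW: "h \<in> normaliser W" using h(1) W(4) by blast
  have hQ: "h \<in> normaliser Q" using h(1) N(4) by blast
  have finW: "finite W" using W(2) finQ finite_subset by blast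
  have pd: "p ^ d = p * p ^ (d - 1)" using d by (simp flip: power_Suc)
  have cmW: "cm x h \<in> W" if x: "x \<in> Q" for x
  proof -
    have qQ: "subgrp (quo W ` Q)" using subgrp_quo_image[OF Q(1) QN] .
    have "card (quo W ` Q) dvd p ^ n"
      using card_quo_image[OF Q(1) QN W(1,2) finQ] Q(2) by (metis dvd_triv_left)
    then obtain r where r: "card (quo W ` Q) = p ^ r" using p(1) by (metis divides_primepow_nat)
    have "quo W (h ^ m) = 1" by (simp add: h)
    then have "quo W h ^ m = 1" using quo_power[OF hW] by simp
    moreover have "quo W h \<in> normaliser (quo W ` Q)"
    proof (rule normaliserI)
      fix X assume "X \<in> quo W ` Q"
      then obtain y where y: "X = quo W y" "y \<in> Q" by auto
      then have "cj (quo W h) X = quo W (cj h y)" using quo_cj[OF hW] QN by auto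
      then show "cj (quo W h) X \<in> quo W ` Q" using normaliser_cj[OF hQ y(2)] by simp
    qed (simp add: finQ)
    moreover have "cj (quo W h) X = X" if X: "X \<in> quo W ` Q" "X ^ p = 1" for X
    proof -
      obtain y where y: "X = quo W y" "y \<in> Q" using X by auto
      have yN: "y \<in> normaliser W" using y QN by blast
      have "quo W (y ^ p) = 1" using X y quo_power[OF yN] by simp
      then have yp: "y ^ p \<in> W"
        using quo_eq_1_iff[OF W(1)] subgrp_power[OF subgrp_normaliser yN] by blast
      have "cm y h \<in> W"
      proof (cases "y \<in> W")
        case True
        then show ?thesis using W(1) hW by (simp add: cm_def subgrp_mult subgrp_inv normaliser_cj)
      next
        case False
        show ?thesis
        proof (rule triv)
          show "subgrp (adj W y)" using subgrp_adj[OF W(1) yN yp p0(1)] .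
          show "card (adj W y) = p ^ d" using card_adj_prime[OF W(1) finW p(1) yp False] W(3) pd by simp
        qed (use adj_sub adj_mem[OF W(1)] adj_subset[OF Q(1) W(2) y(2)] in auto)
      qed
      then show ?thesis using cm_mem_iff_quo[OF W(1) yN hW] quo_cj[OF hW yN] y by simp
    qed
    ultimately have "cj (quo W h) (quo W x) = quo W x"
      using coprime_action_on_omega[OF p _ h(3) qQ r] x by blast
    then show ?thesis using cm_mem_iff_quo[OF W(1) _ hW, of x] quo_cj[OF hW, of x] x QN by auto
  qed
  obtain V where V: "subgrp V" "W \<subseteq> V" "V \<subseteq> Q" "card V = p ^ d"
    using intermediate_subgrp[OF W(1,2) Q p(1) W(3), of d] d by auto
  have Wab: "x * y = y * x" if "x \<in> W" "y \<in> W" for x y using ab[OF V(1,3,4)] V(2) that by blast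
  have Wcj: "cj y x = x" if "x \<in> W" "y \<in> W" for x y using Wab[OF that] by (simp add: cj_eq_self_iff)
  have order: "x ^ (p ^ n) = 1" if "x \<in> Q" for x using p_group_power[OF Q p(1) that] .
  have cop1: "c = 1" if "cj h x = x * c" "cj h c = c" "c \<in> Q" for x c
    using coprime_action_trivial[OF h(2,3) that(1,2) order[OF that(3)]] .
  define R where "R = (\<lambda>w. cm w h) ` W"
  define C where "C = Q \<inter> {x. cj h x = x}"
  have hom: "cm (x * y) h = cm x h * cm y h" if "x \<in> W" "y \<in> W" for x y
    by (rule cm_abelian_mult[OF W(1) finW Wab hW that])
  have homi: "cm (inverse x) h = inverse (cm x h)" if "x \<in> W" for x
    by (rule cm_abelian_inverse[OF W(1) finW Wab hW that])
  have RW: "R \<subseteq> W" using cmW W by (auto simp: R_def)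
  have R: "subgrp R" unfolding R_def by (rule subgrp_cm_image[OF W(1) finW Wab hW])
  have C: "subgrp C" "C \<subseteq> Q"
    using Q(1) by (auto simp: C_def subgrp_def cj_mult cj_inverse)
  \<comment> \<open>A commutator [w, h] fixed by h is trivial by coprimeness.\<close>
  have RC: "r = 1" if rR: "r \<in> R" and rC: "r \<in> C" for r
  proof -
    obtain w where w: "r = cm w h" "w \<in> W" using rR by (auto simp: R_def)
    have "cj h r = r" "r \<in> Q" using rC by (auto simp: C_def)
    then show ?thesis using cop1[of w r] cj_cm[of h w] w(1) by simp
  qed
  have RQ: "R \<subseteq> Q" using RW W by blast
  have R1: "R = {1}"
  proof (rule ccontr)
    assume Rne: "R \<noteq> {1}"
    have WC: "subgrp (W \<inter> C)" using W C by (simp add: subgrp_Int)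
    have "{x \<in> W. cj h x = x} = W \<inter> C" using W(2) by (auto simp: C_def)
    then have "card W = card R * card (W \<inter> C)"
      using card_cm_image[OF W(1) finW Wab hW] by (simp add: R_def)
    \<comment> \<open>Every coset xW contains a fixed point of h, by averaging in the abelian group
      W.\<close>
    moreover have CW: "sprod C W = Q"
    proof (rule antisym)
      show "sprod C W \<subseteq> Q" using C W by (intro sprod_subset Q)
      show "Q \<subseteq> sprod C W"
      proof
        fix x assume x: "x \<in> Q"
        obtain w where w: "w \<in> W" "cj h (x * w) = x * w"
          using coprime_fixed_point_in_coset[OF W(1,3) hW p(1) Wab h(2,3) cmW[OF x]] by blast
        have "x * w \<in> C" using w x W(2) by (auto simp: C_def intro: subgrp_mult Q)
        then have "(x * w) * inverse w \<in> sprod C W" using w W by (intro sprodI subgrp_inv)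
        then show "x \<in> sprod C W" by (simp add: mult.assoc)
      qed
    qed
    moreover have "card (sprod C W) * card (C \<inter> W) = card C * card W"
      using C W finW finite_subset[OF C(2) finQ] by (intro card_sprod)
    moreover have "card (W \<inter> C) > 0"
      using card_subgrp_pos[OF WC] finW by simp
    ultimately have cQ: "card Q = card C * card R" by (simp add: Int_commute)
    \<comment> \<open>C commutes with h and normalises W, so it normalises [W, h]; W is abelian and
      centralises [W, h].\<close>
    have QR: "Q \<subseteq> normaliser R"
    proof -
      have finR: "finite R" using RW finW finite_subset by blast
      have "C \<subseteq> normaliser R"
      proof
        fix c assume c: "c \<in> C"
        have ch: "cj c h = h" using c by (simp add: C_def cj_eq_self_iff)
        show "c \<in> normaliser R"
        proof (rule normaliserI[OF finR])
          fix r assume "r \<in> R"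
          then obtain w where w: "r = cm w h" "w \<in> W" by (auto simp: R_def)
          have "cj c (cm w h) = cm (cj c w) (cj c h)"
            by (simp add: cm_def cj_mult cj_inverse cj_cj[of c h])
          moreover have "cj c w \<in> W" using c w C QN by (auto intro: normaliser_cj)
          ultimately show "cj c r \<in> R" using w ch by (simp add: R_def)
        qed
      qed
      moreover have "W \<subseteq> normaliser R"
      proof
        fix w assume "w \<in> W"
        then show "w \<in> normaliser R" using Wcj RW by (intro normaliserI[OF finR]) auto
      qed
      ultimately have "sprod C W \<subseteq> normaliser R" by (intro sprod_subset subgrp_normaliser)
      then show ?thesis using CW by simp
    qed
    obtain e where e: "card R = p ^ e" "e \<le> d - 1"
      using prime_power_card[OF R RW W(1,3) p(1)] by blast
    obtain U where U: "subgrp U" "U \<subseteq> R" "card R = p * card U" "Q \<subseteq> normaliser U"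
      using maximal_normal_subgrp[OF R Rne e(1) Q QR RQ p(1)] by blast
    obtain u where u: "card U = p ^ u" using prime_power_card[OF U(1,2) R e(1) p(1)] by blast
    have "p ^ e = p ^ Suc u" using U(3) e(1) u by simp
    then have eu: "e = Suc u" using p0(2) power_inject_exp by blast
    have cC: "card C = p ^ (n - e)"
    proof -
      have "p ^ n = card C * p ^ e" using cQ Q(2) e(1) by simp
      moreover have "p ^ n = p ^ (n - e) * p ^ e" using e(2) d by (simp flip: power_add)
      ultimately show ?thesis using p0 by simp
    qed
    have finC: "finite C" using C finQ finite_subset by blast
    \<comment> \<open>With |C2| = \<open>p^(d-u)\<close> the final subgroup has order
      \<open>p^u * p^(d-u-1) * p = p^d\<close>. Such a C2 fits into C because |C| =
      \<open>p^(n-e)\<close> with e = u + 1, and d < n.\<close>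
    have du: "d - u \<le> n - e" using eu e(2) d by linarith
    obtain C2 where C2: "subgrp C2" "C2 \<subseteq> C" "card C2 = p ^ (d - u)"
      by (rule intermediate_subgrp[OF subgrp_trivial _ C(1) cC p(1), of 0 "d - u"])
        (use subgrp_one[OF C(1)] du that in auto)
    obtain C1 where C1: "subgrp C1" "C1 \<subseteq> C2" "card C1 = p ^ (d - u - 1)"
      by (rule intermediate_subgrp[OF subgrp_trivial _ C2(1) C2(3) p(1), of 0 "d - u - 1"])
        (use subgrp_one[OF C2(1)] that in auto)
    have "d - u = Suc (d - u - 1)" using eu e(2) d by linarith
    then have c21: "card C2 = p * card C1" unfolding C1(3) C2(3) by (metis power_Suc)
    have fins: "finite C2" "finite C1" "finite R" "finite U"
      using finC C2 C1 finite_subset RW finW U by metis+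
    have "C1 \<noteq> C2" using c21 card_subgrp_pos[OF C2(1) fins(1)] p0 by auto
    then obtain c where c: "c \<in> C2" "c \<notin> C1" using C1 by blast
    have C21: "C2 \<subseteq> normaliser C1" by (rule index_prime_normal[OF C1(1,2) C2(1,3) p(1) c21])
    have cp: "c ^ p \<in> C1" by (rule index_prime(1)[OF C1(1,2) C2(1) fins(1) C21 c21 p(1) c])
    have "U \<noteq> R" using U(3) card_subgrp_pos[OF R fins(3)] p0 by auto
    then obtain r where r: "r \<in> R" "r \<notin> U" using U by blast
    have RU: "R \<subseteq> normaliser U" using RQ U by blast
    have rp: "r ^ p \<in> U" "adj U r = R"
      using index_prime[OF U(1,2) R fins(3) RU U(3) p(1) r] by auto
    have cmU: "cm x s \<in> U" if "x \<in> R" "s \<in> Q" for x s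
      using central_index_prime[OF U(1,2) R e(1) U(3) Q U(4) QR p(1) that] .
    define B where "B = sprod U C1"
    have C1Q: "C1 \<subseteq> Q" using C1 C2 C by blast
    have C1U: "C1 \<subseteq> normaliser U" using C1Q U by blast
    have B: "subgrp B" "U \<subseteq> B" "C1 \<subseteq> B" "B \<subseteq> Q" "finite B"
      using subgrp_sprod[OF U(1) C1(1) C1U] sprod_left[OF C1(1), of U] sprod_right[OF U(1), of C1]
        sprod_subset[OF Q(1) _ C1Q, of U] U(2) RQ finite_sprod fins by (auto simp: B_def)
    have cB: "card B = p ^ (d - 1)"
    proof -
      have "U \<inter> C1 = {1}" using RC U C1 C2 subgrp_one[OF U(1)] subgrp_one[OF C1(1)] by blast
      then have "card B = p ^ u * p ^ (d - u - 1)"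
        using card_sprod[OF U(1) C1(1) fins(4,2)] u C1(3) by (simp add: B_def)
      also have "\<dots> = p ^ (u + (d - u - 1))" by (simp only: power_add)
      also have "u + (d - u - 1) = d - 1" using eu e(2) d by linarith
      finally show ?thesis .
    qed
    have rQ: "r \<in> Q" "c \<in> Q" using r RQ c C2 C by auto
    have rB: "r \<in> normaliser B"
    proof (rule normaliserI[OF B(5)])
      fix b assume "b \<in> B"
      then obtain v c1 where b: "b = v * c1" "v \<in> U" "c1 \<in> C1" unfolding B_def by (rule sprodE)
      have "cj r v \<in> B" using b r RU B normaliser_cj by blast
      moreover have "cm r c1 \<in> B" using cmU[OF r(1)] b C1Q B by blast
      moreover have "cj r c1 = c1 * inverse (cm r c1)"
        by (simp add: cm_def cj_def mult.assoc)
      ultimately show "cj r b \<in> B"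
        unfolding b cj_mult using B b by (metis subgrp_inv subgrp_mult subsetD)
    qed
    have cBn: "c \<in> normaliser B"
      unfolding B_def using rQ U c C21 by (intro normaliser_sprod) auto
    define y where "y = r * c"
    have yB: "y \<in> normaliser B" unfolding y_def using rB cBn by (intro subgrp_mult subgrp_normaliser)
    \<comment> \<open>[r, c] lies in U, so r and c commute modulo B, and r^p and c^p lie in
      B.\<close>
    have yp: "y ^ p \<in> B"
    proof -
      have "cm r c \<in> B" using cmU[OF r(1) rQ(2)] B by blast
      then have "cj (quo B c) (quo B r) = quo B r"
        using cm_mem_iff_quo[OF B(1) rB cBn] quo_cj[OF cBn rB] by simp
      then have "(quo B r * quo B c) ^ p = quo B r ^ p * quo B c ^ p"
        unfolding cj_eq_self_iff by (rule commuting_power_mult)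
      then have "quo B (y ^ p) = quo B r ^ p * quo B c ^ p"
        unfolding quo_power[OF yB] by (simp add: y_def quo_mult[OF rB cBn])
      also have "\<dots> = quo B (r ^ p) * quo B (c ^ p)" by (simp add: quo_power rB cBn)
      also have "quo B (r ^ p) = 1"
        using rp B rB by (subst quo_eq_1_iff) (auto intro: subgrp_power subgrp_normaliser)
      also have "quo B (c ^ p) = 1"
        using cp B cBn by (subst quo_eq_1_iff) (auto intro: subgrp_power subgrp_normaliser)
      finally show ?thesis
        using quo_eq_1_iff[OF B(1) subgrp_power[OF subgrp_normaliser yB]] by simp
    qed
    \<comment> \<open>R and C meet trivially, so the factorisation rc is unique.\<close>
    have dec: "c \<in> C1" if "r * c = r1 * c1" "r1 \<in> R" "c1 \<in> C1" for r1 c1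
    proof -
      have "inverse r1 * r = c1 * inverse c"
        using that(1) by (metis inv_mult_cancel mult.assoc mult_1_right right_inv)
      moreover have "inverse r1 * r \<in> R" using R r that by (simp add: subgrp_mult subgrp_inv)
      moreover have "c1 * inverse c \<in> C"
        using that C1 C2 c by (intro subgrp_mult subgrp_inv C) auto
      ultimately have "c1 * inverse c = 1" using RC by metis
      then have "c1 = c" by (metis inv_inv mult_eq_1_imp_inverse inv_mult)
      then show ?thesis using that by simp
    qed
    have yB': "y \<notin> B"
    proof
      assume "y \<in> B"
      then obtain v c1 where "y = v * c1" "v \<in> U" "c1 \<in> C1" unfolding B_def by (rule sprodE)
      then show False using dec[of v c1] U(2) c by (auto simp: y_def)
    qed
    define H where "H = adj B y"
    have H: "subgrp H" unfolding H_def using subgrp_adj[OF B(1) yB yp p0(1)] .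
    have HQ: "H \<subseteq> Q" unfolding H_def y_def using B rQ by (intro adj_subset Q) (auto intro: subgrp_mult Q)
    have cH: "card H = p ^ d" using card_adj_prime[OF B(1,5) p(1) yp yB'] cB pd by (simp add: H_def)
    have finH: "finite H" using HQ finQ finite_subset by blast
    have hH: "h \<in> normaliser H" using inv[OF H HQ cH] h(1) by blast
    have BH: "B \<subseteq> H" "y \<in> H" unfolding H_def using adj_sub adj_mem[OF B(1)] by auto
    \<comment> \<open>An x in both H and R but outside U would give R = U<x> <= H. Then R C1 has
      order \<open>p^d\<close> and equals H, but rc is not in R C1.\<close>
    have HR: "x \<in> U" if x: "x \<in> H" "x \<in> R" for x
    proof (rule ccontr)
      assume "x \<notin> U"
      then have "adj U x = R" using index_prime(2)[OF U(1,2) R fins(3) RU U(3) p(1) x(2)] by simp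
      then have "R \<subseteq> H" using adj_subset[OF H _ x(1), of U] B BH by blast
      then have le: "sprod R C1 \<subseteq> H" using B BH by (intro sprod_subset H) auto
      have "R \<inter> C1 = {1}" using RC C1 C2 subgrp_one[OF R] subgrp_one[OF C1(1)] by blast
      then have "card (sprod R C1) = p ^ e * p ^ (d - u - 1)"
        using card_sprod[OF R C1(1) fins(3,2)] e(1) C1(3) by simp
      also have "\<dots> = p ^ (e + (d - u - 1))" by (simp only: power_add)
      also have "e + (d - u - 1) = d" using eu e(2) d by linarith
      finally have "sprod R C1 = H" using card_subset_eq[OF finH le] cH by simp
      then have "r * c \<in> sprod R C1" using BH(2) by (simp add: y_def)
      then show False using dec c sprodE by metis
    qed
    have hR: "h \<in> normaliser R"
    proof (rule normaliserI[OF fins(3)])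
      fix r assume "r \<in> R"
      then obtain w where w: "r = cm w h" "w \<in> W" by (auto simp: R_def)
      have "cj h (cm w h) = cm (cj h w) h" by (simp add: cm_def cj_mult cj_inverse)
      then show "cj h r \<in> R" using w normaliser_cj[OF hW w(2)] by (simp add: R_def)
    qed
    \<comment> \<open>As h fixes c, the quotient (rc)^h (rc)^-1 is r^h r^-1, which lies in H and in
      R.\<close>
    have rU: "cm r h \<in> U" if r: "r \<in> R" "r * c \<in> H" for r
    proof -
      have "cj h (r * c) \<in> H" using r hH by (simp add: normaliser_cj)
      moreover have "cj h c = c" using c C2 by (auto simp: C_def)
      ultimately have "(cj h r * c) * inverse (r * c) \<in> H"
        using subgrp_mult[OF H _ subgrp_inv[OF H r(2)], of "cj h r * c"] by (simp add: cj_mult)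
      then have "cj h r * inverse r \<in> H" by (simp add: mult.assoc)
      moreover have "cj h r * inverse r \<in> R" using r R normaliser_cj[OF hR] by (simp add: subgrp_mult subgrp_inv)
      ultimately have "cj h r * inverse r \<in> U" by (rule HR)
      then have "cj r (cj h r * inverse r) \<in> U" using r RU normaliser_cj by blast
      then show ?thesis by (simp add: cm_def cj_def mult.assoc)
    qed
    have "cm x h \<in> U" if x: "x \<in> R" for x
    proof -
      have "cm r h \<in> U" using rU[OF r(1)] BH by (simp add: y_def)
      moreover have "cm v h \<in> U" if "v \<in> U" for v
      proof -
        have "cj h v \<in> H \<inter> R" using that hH hR B BH U(2) normaliser_cj by blast
        then have "cj h v \<in> U" using HR by blast
        then show ?thesis using that U by (simp add: cm_def subgrp_mult subgrp_inv)
      qed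
      moreover have "h \<in> normaliser U"
      proof (rule normaliserI[OF fins(4)])
        fix v assume "v \<in> U"
        then have "cj h v \<in> H \<inter> R" using hH hR B BH U(2) normaliser_cj by blast
        then show "cj h v \<in> U" using HR by blast
      qed
      ultimately have "R \<subseteq> fixmod U h"
        unfolding rp(2)[symmetric] using r RU subgrp_le_normaliser[OF U(1)]
        by (intro adj_subset subgrp_fixmod U) (auto simp: fixmod_def)
      then show ?thesis using x by (auto simp: fixmod_def)
    qed
    then have "(\<lambda>x. cm x h) ` R \<subseteq> U" by blast
    \<comment> \<open>Injectivity of x |-> [x, h] on R reflects that R and C meet trivially; yet R
      is mapped into the smaller U.\<close>
    moreover have "inj_on (\<lambda>x. cm x h) R"
    proof (rule inj_onI)
      fix x y assume xy: "x \<in> R" "y \<in> R" "cm x h = cm y h"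
      have "cm (inverse x * y) h = inverse (cm x h) * cm y h"
        using hom[OF subgrp_inv[OF W(1)], of x y] homi[of x] xy RW by auto
      then have "cm (inverse x * y) h = 1" using xy by simp
      moreover have "inverse x * y \<in> R" using xy R by (simp add: subgrp_mult subgrp_inv)
      ultimately have "inverse x * y = 1" using RC RQ by (auto simp: C_def cm_eq_1_iff)
      then show "x = y" by (metis inv_inv mult_eq_1_imp_inverse)
    qed
    ultimately have "card R \<le> card U" using fins by (metis card_image card_mono)
    then show False using U(3) card_subgrp_pos[OF U(1) fins(4)] p0 by simp
  qed
  have fixW: "cj h w = w" if "w \<in> W" for w
  proof -
    have "cm w h \<in> R" using that by (simp add: R_def)
    then show ?thesis using R1 by (simp add: cm_eq_1_iff)
  qed
  have "cj h x = x" if x: "x \<in> Q" for x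
  proof -
    have "cm x h \<in> Q" using cmW[OF x] W(2) by blast
    then have "cm x h = 1" using cop1[OF cj_cm fixW[OF cmW[OF x]]] by blast
    then show ?thesis by (simp add: cm_eq_1_iff)
  qed
  then show ?thesis by (simp add: centraliser_def)
qed

text \<open>Let X act trivially on all sections V/W with |V| = \<open>p^d\<close>. Automorphisms of
  a group of order \<open>p\<close> commute and have order dividing p - 1, so X contains the
  commutators and the (p-1)-th powers of N. Elements of X of order prime to \<open>p\<close>
  centralise Q, so X is conjugate in N into a subgroup of C_N(Q) T.\<close>

lemma commutators_and_powers:
  assumes T: "subgrp T" "T \<subseteq> N" and ind: "\<not> p dvd card N div card T"
    and u: "u \<in> N" and v: "v \<in> N"
  shows "cm u v \<in> sprod (centraliser Q \<inter> N) T" "u ^ (p - 1) \<in> sprod (centraliser Q \<inter> N) T"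
proof -
  obtain W where W: "subgrp W" "W \<subseteq> Q" "card W = p ^ (d - 1)" "N \<subseteq> normaliser W"
    using invariant_of_corank_one by blast
  define \<V> where "\<V> = {V. subgrp V \<and> W \<subseteq> V \<and> V \<subseteq> Q \<and> card V = p ^ d}"
  define X where "X = {g \<in> N. \<forall>V\<in>\<V>. g \<in> stabmod V W}"
  define C where "C = centraliser Q \<inter> N"
  have X: "subgrp X" "X \<subseteq> N"
    using N(1) subgrp_stabmod[OF W(1)] by (auto simp: X_def subgrp_def)
  have C: "subgrp C" by (simp add: C_def subgrp_Int subgrp_centraliser N)
  have CX: "C \<subseteq> X"
  proof
    fix g assume g: "g \<in> C"
    have "g \<in> stabmod V W" if "V \<in> \<V>" for V
    proof -
      have "g \<in> centraliser V" using g that by (auto simp: C_def \<V>_def centraliser_def)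
      then show ?thesis using centraliser_stabmod[OF W(1)] that by (auto simp: \<V>_def)
    qed
    then show "g \<in> X" using g by (auto simp: X_def C_def)
  qed
  have NC: "N \<subseteq> normaliser C" unfolding C_def by (rule normaliser_centraliser_Int[OF N(1,4)])
  have "h \<in> C" if "h \<in> X" "h ^ m = 1" "coprime m p" for h m
  proof -
    have "h \<in> centraliser Q"
    proof (rule coprime_centralises[OF W _ that(2,3)])
      show "h \<in> N" using that X by blast
      fix V x assume "subgrp V" "W \<subseteq> V" "V \<subseteq> Q" "card V = p ^ d" and x: "x \<in> V"
      then have "V \<in> \<V>" by (simp add: \<V>_def)
      then show "cm x h \<in> W" using that(1) stabmodD[OF _ x] by (auto simp: X_def)
    qed
    then show ?thesis using that X by (auto simp: C_def)
  qed
  then obtain g where g: "g \<in> N" "\<And>x. x \<in> X \<Longrightarrow> cj g x \<in> sprod C T"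
    using p_prime_elements_central[OF N(1,2) T p(1) ind X C CX NC] by blast
  have CN: "cm a b \<in> X" "a ^ (p - 1) \<in> X" if a: "a \<in> N" and b: "b \<in> N" for a b
  proof -
    have n: "a \<in> normaliser W" "b \<in> normaliser W" using a b W by auto
    have st: "cm a b \<in> stabmod V W \<and> a ^ (p - 1) \<in> stabmod V W" if "V \<in> \<V>" for V
    proof -
      have V: "subgrp V" "W \<subseteq> V" "V \<subseteq> Q" "card V = p ^ d" using that by (auto simp: \<V>_def)
      have VN: "N \<subseteq> normaliser V" using inv[OF V(1,3,4)] .
      have pd: "p ^ d = p * p ^ (d - 1)" using d by (simp flip: power_Suc)
      have finV: "finite V" using V(3) finQ finite_subset by blast
      have VW: "V \<subseteq> normaliser W" using V(3) N(3) W(4) by blast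
      have cV: "card V = p * card W" using V(4) W(3) pd by simp
      have "W \<noteq> V" using cV card_subgrp_pos[OF V(1) finV] p0 by auto
      then obtain x0 where x0: "x0 \<in> V" "x0 \<notin> W" using V by blast
      have Vx0: "V = adj W x0" using index_prime(2)[OF W(1) V(2,1) finV VW cV p(1) x0] by simp
      have xp: "x ^ p \<in> W" if "x \<in> V" for x
        using index_prime(1)[OF W(1) V(2,1) finV VW cV p(1) that] subgrp_power[OF W(1)] by blast
      have vn: "a \<in> normaliser V" "b \<in> normaliser V" using a b VN by auto
      have "cm x (cm a b) \<in> W" if "x \<in> V" for x
        by (rule commutator_trivial_on_prime_index[OF W(1) Vx0 VW x0(1) n(1) vn(1) n(2) vn(2) that])
      moreover have "cm x (a ^ (p - 1)) \<in> W" if "x \<in> V" for x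
        by (rule power_trivial_on_prime_index[OF W(1) Vx0 VW x0 n(1) vn(1) p(1) xp that])
      moreover have "cm a b \<in> normaliser W"
        unfolding cm_def using n by (intro subgrp_mult subgrp_inv subgrp_cj subgrp_normaliser)
      moreover have "a ^ (p - 1) \<in> normaliser W" by (rule subgrp_power[OF subgrp_normaliser n(1)])
      ultimately show ?thesis by (simp add: stabmod_def)
    qed
    have "cm a b \<in> N" "a ^ (p - 1) \<in> N"
      unfolding cm_def using a b N(1) by (simp_all add: subgrp_mult subgrp_inv subgrp_cj subgrp_power)
    then show "cm a b \<in> X" "a ^ (p - 1) \<in> X" using st by (auto simp: X_def)
  qed
  \<comment> \<open>X enters CT only after conjugation by g, so the inclusion is applied to the
    conjugates of u and v by g^-1.\<close>
  have gi: "cj (inverse g) a \<in> N" if "a \<in> N" for a using that g N(1) by (simp add: subgrp_cj subgrp_inv)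
  have "cj g (cm (cj (inverse g) u) (cj (inverse g) v)) \<in> sprod C T"
    "cj g (cj (inverse g) u ^ (p - 1)) \<in> sprod C T"
    by (rule g(2)[OF CN(1)[OF gi[OF u] gi[OF v]]], rule g(2)[OF CN(2)[OF gi[OF u] gi[OF u]]])
  then show "cm u v \<in> sprod (centraliser Q \<inter> N) T" "u ^ (p - 1) \<in> sprod (centraliser Q \<inter> N) T"
    by (simp_all add: C_def cj_power cm_def cj_mult cj_inverse cj_cj[of g "cj (inverse g) v"])
qed

end

section \<open>Transvections\<close>

text \<open>B^u lies in CB. The index of B in CB is |C : C \<inter> S|, the index of S in CS, hence
  prime to \<open>p\<close>; so B^u is moved into B by some cb with c in C and b in B, and already
  uc maps B into B. The correction c lies in C, so it does not disturb an action that C does not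
  see.\<close>

lemma frattini_conjugate:
  assumes N: "subgrp N" "finite N" and S: "subgrp S" "S \<subseteq> N" "card S = p ^ m" and p: "prime (p::nat)"
    and ind: "\<not> p dvd card N div card S" and C: "subgrp C" "C \<subseteq> N" "N \<subseteq> normaliser C"
    and B: "subgrp B" "B \<subseteq> S" "C \<inter> S \<subseteq> B" and u: "u \<in> N" "\<And>b. b \<in> B \<Longrightarrow> cj u b \<in> sprod C B"
  obtains c where "c \<in> C" "\<And>b. b \<in> B \<Longrightarrow> cj (u * c) b \<in> B"
proof -
  have fin: "finite C" "finite S" "finite B"
    using C S B N(2) by (meson finite_subset order_trans)+
  have BN: "B \<subseteq> N" using B S by blast
  define L where "L = sprod C B"
  have BC: "B \<subseteq> normaliser C" and SC: "S \<subseteq> normaliser C" using BN S C by blast+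
  have L: "subgrp L" "L \<subseteq> N" "B \<subseteq> L" and CS: "subgrp (sprod C S)" "sprod C S \<subseteq> N"
    using subgrp_sprod[OF C(1) B(1) BC] sprod_subset[OF N(1) C(2) BN] sprod_right[OF C(1), of B]
      subgrp_sprod[OF C(1) S(1) SC] sprod_subset[OF N(1) C(2) S(2)] by (auto simp: L_def)
  have CB: "C \<inter> B = C \<inter> S" using B by blast
  have CSs: "subgrp (C \<inter> S)" "finite (C \<inter> S)" using C S fin by (auto intro: subgrp_Int)
  have pos: "card B > 0" "card S > 0" "card (C \<inter> S) > 0"
    using card_subgrp_pos B S CSs fin by blast+
  obtain k where k: "card C = card (C \<inter> S) * k"
    using card_subgrp_dvd[OF CSs(1) C(1) _ fin(1)] by blast
  have "card L * card (C \<inter> S) = card C * card B"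
    using card_sprod[OF C(1) B(1) fin(1,3)] CB by (simp add: L_def)
  then have cL: "card L = k * card B" using pos(3) k by simp
  have "card (sprod C S) * card (C \<inter> S) = card C * card S"
    using card_sprod[OF C(1) S(1) fin(1,2)] .
  then have cCS: "card (sprod C S) = k * card S" using pos(3) k by simp
  obtain j where j: "card N = card (sprod C S) * j" using card_subgrp_dvd[OF CS(1) N(1) CS(2) N(2)] by blast
  have "card N div card S = k * j" using j cCS pos(2) by (simp add: mult.assoc mult.left_commute)
  then have "\<not> p dvd k" using ind by (metis dvd_mult2)
  then have indL: "\<not> p dvd card L div card B" using cL pos by simp
  have uB: "subgrp (cj u ` B)" "cj u ` B \<subseteq> L" using u(2) B(1) by (auto simp: L_def subgrp_cj_image)
  obtain r where "card B = p ^ r" using prime_power_card[OF B(1,2) S(1,3) p] by blast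
  then have "card (cj u ` B) = p ^ r" by (simp add: card_cj_image)
  then obtain l where l: "l \<in> L" "\<And>z. z \<in> cj u ` B \<Longrightarrow> cj l z \<in> B"
    using sylow_conjugate[OF L(1) finite_subset[OF L(2) N(2)] B(1) L(3) uB _ p indL] by metis
  obtain c b where cb: "l = c * b" "c \<in> C" "b \<in> B" using l(1) unfolding L_def by (rule sprodE)
  have "cj (u * c) z \<in> B" if "z \<in> B" for z
  proof -
    have "cj b (cj c (cj u z)) \<in> B" using l(2)[OF imageI[OF that]] by (simp add: cb cj_prod)
    moreover have "b \<in> normaliser B" using subgrp_le_normaliser[OF B(1)] cb by blast
    ultimately show ?thesis by (simp add: normaliserD cj_prod)
  qed
  then show thesis using that cb by blast
qed

lemma cj_mem_stabmod:
  assumes "g \<in> stabmod V W" "u \<in> normaliser V" "u \<in> normaliser W"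
  shows "cj u g \<in> stabmod V W"
proof -
  have "cm x (cj u g) \<in> W" if "x \<in> V" for x
  proof -
    have "cj (inverse u) x \<in> V"
      using normaliser_cj[OF subgrp_inv[OF subgrp_normaliser assms(2)] that] .
    then have "cj u (cm (cj (inverse u) x) g) \<in> W"
      using normaliser_cj[OF assms(3) stabmodD[OF assms(1)]] by blast
    then show ?thesis by (simp add: cm_def cj_mult cj_inverse cj_cj[of u g])
  qed
  then show ?thesis
    using assms by (simp add: stabmod_def subgrp_cj[OF subgrp_normaliser])
qed

text \<open>[x, h] lies in W, where h acts trivially, so coprimeness kills it. Applied repeatedly,
  this climbs a chain of subgroups one factor at a time.\<close>

lemma coprime_stabiliser_trivial:
  assumes p: "prime (p::nat)" and Q: "subgrp Q" "card Q = p ^ k" and V: "V \<subseteq> Q" "W \<subseteq> V"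
    and h: "h ^ m = 1" "coprime m p" and st: "h \<in> stabmod V W" and W: "\<And>x. x \<in> W \<Longrightarrow> cj h x = x"
    and x: "x \<in> V"
  shows "cj h x = x"
proof -
  have c: "cm x h \<in> W" using stabmodD[OF st x] .
  have "cm x h ^ (p ^ k) = 1" by (rule p_group_power[OF Q p]) (use c V in blast)
  then have "cm x h = 1" using coprime_action_trivial[OF h cj_cm W[OF c]] by blast
  then show ?thesis by (simp add: cm_eq_1_iff)
qed

text \<open>The situation |Q| = \<open>p^d\<close> with N = N_G(Q). The last assumption is applied
  with K = S, which makes subgroups of order \<open>p^d\<close> invariant under S, and with K =
  Q<x>.\<close>

locale transvections =
  fixes N S Q :: "'a::group_mult set" and p d m :: nat
  assumes p: "prime p" "odd p" and N: "subgrp N" "finite N"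
    and S: "subgrp S" "S \<subseteq> N" "card S = p ^ m" and ind: "\<not> p dvd card N div card S"
    and Q: "subgrp Q" "card Q = p ^ d" "Q \<subset> S" "N \<subseteq> normaliser Q" and d: "0 < d"
    and cent: "centraliser Q \<inter> S \<subseteq> Q"
    and ab: "\<And>H x y. subgrp H \<Longrightarrow> H \<subseteq> S \<Longrightarrow> card H = p ^ d \<Longrightarrow> x \<in> H \<Longrightarrow> y \<in> H \<Longrightarrow> x * y = y * x"
    and inv: "\<And>H K. subgrp H \<Longrightarrow> subgrp K \<Longrightarrow> H \<subseteq> K \<Longrightarrow> K \<subseteq> S \<Longrightarrow> card H = p ^ d \<Longrightarrow>
      N \<inter> normaliser K \<subseteq> normaliser H"
begin

definition "C = centraliser Q \<inter> N"
text \<open>C_Q(t); together with \<open>img t\<close>, which is [Q, t], the kernel and the image of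
  the endomorphism q |-> [q, t] of the abelian group Q.\<close>

definition "fixq t = {q \<in> Q. cj t q = q}"
definition "img t = (\<lambda>q. cm q t) ` Q"
text \<open>A transvection on Q: it fixes a subgroup of index \<open>p\<close> pointwise, and [Q, t]
  is contained in this subgroup. Then [Q, t] has order \<open>p\<close>. Q itself is abelian, but
  not assumed to be elementary.\<close>

definition "tv t \<longleftrightarrow> t \<in> N \<and> card (fixq t) = p ^ (d - 1) \<and> img t \<subseteq> fixq t"

lemma p0: "p > 0" "p > 1"
  by (rule prime_gt_0_nat prime_gt_1_nat, rule p)+

lemma pd: "p ^ d = p * p ^ (d - 1)"
  using d by (simp flip: power_Suc)

section \<open>The action of N on Q: commutator maps and basic facts on transvections\<close>

lemma QS: "Q \<subseteq> S"
  using Q(3) by blast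

lemma finQ: "finite Q" and finS: "finite S"
  using Q(2) S(3) p(1) by (simp_all add: finite_p_group)

lemma Qab: "x \<in> Q \<Longrightarrow> y \<in> Q \<Longrightarrow> x * y = y * x"
  using ab[OF Q(1) QS Q(2)] .

lemma Qcj: "x \<in> Q \<Longrightarrow> y \<in> Q \<Longrightarrow> cj y x = x"
  using Qab by (simp add: cj_eq_self_iff)

lemma cjQ: "g \<in> N \<Longrightarrow> q \<in> Q \<Longrightarrow> cj g q \<in> Q"
  using Q(4) by (auto intro: normaliser_cj)

lemma cmQ: "g \<in> N \<Longrightarrow> q \<in> Q \<Longrightarrow> cm q g \<in> Q"
  using cjQ Q(1) by (simp add: cm_def subgrp_mult subgrp_inv)

lemma C: "subgrp C" "C \<subseteq> N" "N \<subseteq> normaliser C" "Q \<subseteq> C" "C \<inter> S = Q"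
proof -
  show "subgrp C" "C \<subseteq> N" by (auto simp: C_def intro: subgrp_Int subgrp_centraliser N)
  show "N \<subseteq> normaliser C" unfolding C_def by (rule normaliser_centraliser_Int[OF N(1) Q(4)])
  show "Q \<subseteq> C" using Qcj QS S(2) by (auto simp: C_def centraliser_def)
  then show "C \<inter> S = Q" using cent QS by (auto simp: C_def)
qed

lemma cm_hom: "g \<in> N \<Longrightarrow> x \<in> Q \<Longrightarrow> y \<in> Q \<Longrightarrow> cm (x * y) g = cm x g * cm y g"
  and cm_hom_inv: "g \<in> N \<Longrightarrow> x \<in> Q \<Longrightarrow> cm (inverse x) g = inverse (cm x g)"
  using cm_abelian[OF Q(1) finQ Qab, of g] Q(4) by blast+

lemma cm_hom_power: "g \<in> N \<Longrightarrow> x \<in> Q \<Longrightarrow> cm (x ^ i) g = cm x g ^ i"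
  by (induction i) (use cm_hom Q(1) in \<open>simp_all add: subgrp_power cm_def[of 1]\<close>)

lemma subgrp_fixq: "subgrp (fixq t)"
  using Q(1) by (auto simp: fixq_def subgrp_def cj_mult cj_inverse)

lemma subgrp_img: "t \<in> N \<Longrightarrow> subgrp (img t)"
  using subgrp_cm_image[OF Q(1) finQ Qab, of t] Q(4) by (auto simp: img_def)

lemma img_sub: "t \<in> N \<Longrightarrow> img t \<subseteq> Q"
  using cmQ by (auto simp: img_def)

lemma card_img_fixq: "t \<in> N \<Longrightarrow> card Q = card (img t) * card (fixq t)"
  unfolding img_def fixq_def using card_cm_image[OF Q(1) finQ Qab, of t] Q(4) by blast

lemma tv_card_img:
  assumes "tv t"
  shows "card (img t) = p"
proof -
  have "p * p ^ (d - 1) = card (img t) * p ^ (d - 1)"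
    using card_img_fixq[of t] assms Q(2) pd by (simp add: tv_def)
  then show ?thesis using p0 by simp
qed

lemma img_power: "tv t \<Longrightarrow> x \<in> img t \<Longrightarrow> x ^ p = 1"
  using power_card[OF subgrp_img, of t x] tv_card_img[of t] finite_subset[OF img_sub finQ]
  by (auto simp: tv_def)

lemma img_generated:
  assumes t: "tv t" and c: "c \<in> img t" "c \<noteq> 1" and x: "x \<in> img t"
  obtains i where "x = c ^ i"
proof -
  have tN: "t \<in> N" using t by (simp add: tv_def)
  have fin: "finite (img t)" using finite_subset[OF img_sub[OF tN] finQ] .
  have "adj {1} c = img t"
    by (rule index_prime(2)[OF subgrp_trivial _ subgrp_img[OF tN] fin _ _ p(1) c(1)])
      (use subgrp_one[OF subgrp_img[OF tN]] tv_card_img[OF t] c normaliser_trivial in auto)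
  then show thesis using that x by (auto simp: adj_def)
qed

lemma tv_cj:
  assumes t: "tv t" and g: "g \<in> N"
  shows "tv (cj g t)"
proof -
  have gi: "inverse g \<in> N" using g N(1) by (simp add: subgrp_inv)
  have "fixq (cj g t) = cj g ` fixq t"
  proof (intro equalityI subsetI)
    fix q assume q: "q \<in> fixq (cj g t)"
    then have "cj g (cj t (cj (inverse g) q)) = q"
      by (simp add: fixq_def cj_cj[of g t])
    then have "cj t (cj (inverse g) q) = cj (inverse g) q" by (metis cj_inv_cj(1))
    then have "cj (inverse g) q \<in> fixq t" using cjQ[OF gi] q by (simp add: fixq_def)
    then show "q \<in> cj g ` fixq t" by (simp add: mem_cj_image)
  next
    fix q assume "q \<in> cj g ` fixq t"
    then obtain r where r: "q = cj g r" "r \<in> fixq t" by blast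
    have "cj (cj g t) q = cj g (cj t r)" by (simp only: r(1) cj_cj[of g t r])
    then show "q \<in> fixq (cj g t)" using r cjQ[OF g] by (simp add: fixq_def)
  qed
  moreover have "img (cj g t) \<subseteq> cj g ` img t"
  proof
    fix x assume "x \<in> img (cj g t)"
    then obtain q where q: "x = cm q (cj g t)" "q \<in> Q" by (auto simp: img_def)
    have "x = cj g (cm (cj (inverse g) q) t)"
      by (simp add: q cm_def cj_mult cj_inverse cj_cj[of g t])
    then show "x \<in> cj g ` img t" using cjQ[OF gi q(2)] by (auto simp: img_def)
  qed
  moreover have "cj g t \<in> N" using t g N(1) by (simp add: tv_def subgrp_cj)
  moreover have "cj g ` img t \<subseteq> cj g ` fixq t" using t by (intro image_mono) (simp add: tv_def)
  ultimately show ?thesis using t by (simp add: tv_def card_cj_image)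
qed

lemma tv_not_central: "tv t \<Longrightarrow> t \<notin> C"
proof
  assume t: "tv t" "t \<in> C"
  then have "fixq t = Q" by (auto simp: fixq_def C_def centraliser_def)
  then have "p * p ^ (d - 1) = p ^ (d - 1)" using t Q(2) pd by (simp add: tv_def)
  then show False using p0 by simp
qed

lemma cj_power_tv:
  assumes t: "tv t" and q: "q \<in> Q"
  shows "cj (t ^ i) q = q * cm q t ^ i"
proof (induction i)
  case (Suc i)
  have "cm q t \<in> fixq t" using t q by (auto simp: tv_def img_def)
  then have f: "cj t (cm q t) = cm q t" by (simp add: fixq_def)
  have "cj (t ^ Suc i) q = cj t (cj (t ^ i) q)" by (simp add: power_commutes flip: cj_prod)
  also have "\<dots> = q * cm q t * cm q t ^ i" using Suc f by (simp add: cj_mult cj_power cj_cm[of t q])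
  finally show ?case by (simp add: mult.assoc)
qed simp

lemma tv_power_central: "tv t \<Longrightarrow> t ^ p \<in> C"
  using cj_power_tv img_power N(1) by (auto simp: C_def centraliser_def img_def tv_def subgrp_power)

lemma central_commutator:
  assumes "x \<in> N" "y \<in> N"
  shows "cm x y \<in> C \<longleftrightarrow> (\<forall>q\<in>Q. cj y (cj x q) = cj x (cj y q))"
proof -
  have "cm x y \<in> C \<longleftrightarrow> (\<forall>q\<in>Q. cj (cm x y) q = q)"
    using assms N(1) by (simp add: C_def centraliser_def cm_def subgrp_mult subgrp_inv subgrp_cj)
  also have "\<dots> \<longleftrightarrow> (\<forall>q\<in>Q. cj (cm x y) (cj x (cj y q)) = cj x (cj y q))"
  proof (intro iffI ballI)
    assume *: "\<forall>q\<in>Q. cj (cm x y) (cj x (cj y q)) = cj x (cj y q)"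
    fix q assume "q \<in> Q"
    then have "cj (inverse y) (cj (inverse x) q) \<in> Q" using assms N(1) by (simp add: cjQ subgrp_inv)
    from *[rule_format, OF this] show "cj (cm x y) q = q" by simp
  qed (use cjQ assms in auto)
  also have "\<dots> \<longleftrightarrow> (\<forall>q\<in>Q. cj y (cj x q) = cj x (cj y q))"
  proof -
    have "y * x * cm x y = x * y" by (simp add: cm_def cj_def mult.assoc)
    then have "cj (cm x y) (cj x (cj y q)) = cj y (cj x q)" for q by (simp flip: cj_prod)
    then show ?thesis by simp
  qed
  finally show ?thesis .
qed

lemma S_normalises: "subgrp H \<Longrightarrow> H \<subseteq> S \<Longrightarrow> card H = p ^ d \<Longrightarrow> S \<subseteq> normaliser H"
  using inv[of H S] S subgrp_le_normaliser[OF S(1)] by blast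

text \<open>K = Q<t> is not <t>, because t does not centralise Q; so t lies in some M < K of order
  \<open>p^d\<close>. M is abelian, so t centralises M \<inter> Q, which has index \<open>p\<close>
  in Q and thus is C_Q(t). M is S-invariant, so [Q, t] <= M \<inter> Q. Finally K = QM is
  S-invariant, and the \<open>p\<close>-group S acts trivially on K/Q of order
  \<open>p\<close>.\<close>

lemma elementary_transvection:
  assumes t: "t \<in> S" "t \<notin> Q" "t ^ p \<in> Q"
  shows "tv t" "S \<subseteq> normaliser (fixq t)" "subgrp (adj (fixq t) t)" "card (adj (fixq t) t) = p ^ d"
    "t ^ p \<in> fixq t" "\<And>s. s \<in> S \<Longrightarrow> cm t s \<in> Q"
proof -
  have tN: "t \<in> N" using t S by blast
  have tnQ: "t \<in> normaliser Q" using tN Q by blast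
  define K where "K = adj Q t"
  have K: "subgrp K" "K \<subseteq> S" "Q \<subseteq> K" "t \<in> K"
    using subgrp_adj[OF Q(1) tnQ t(3) p0(1)] adj_subset[OF S(1) QS t(1)] adj_sub adj_mem[OF Q(1)]
    by (auto simp: K_def)
  have cK: "card K = p ^ Suc d"
    using card_adj_prime[OF Q(1) finQ p(1) t(3,2)] Q(2) by (simp add: K_def)
  have finK: "finite K" using K(2) finS finite_subset by blast
  have tC: "t \<notin> centraliser Q" using cent t by blast
  then have fix_ne: "fixq t \<noteq> Q" by (auto simp: fixq_def centraliser_def)
  have tpow: "t ^ (p ^ m) \<in> {1}" using p_group_power[OF S(1,3) p(1) t(1)] by simp
  have T1: "subgrp (adj {1} t)"
    by (rule subgrp_adj[OF subgrp_trivial _ tpow]) (auto simp: normaliser_trivial p0)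
  have T1K: "adj {1} t \<subseteq> K" using K by (intro adj_subset) (auto simp: subgrp_one)
  obtain j where j: "card (adj {1} t) = p ^ j" "j \<le> Suc d"
    using prime_power_card[OF T1 T1K K(1) cK p(1)] by blast
  have "j \<noteq> Suc d"
  proof
    assume "j = Suc d"
    then have "adj {1} t = K" using card_subset_eq[OF finK T1K] j cK by simp
    then have "t \<in> centraliser Q"
    proof -
      have "cj t q = q" if "q \<in> Q" for q
      proof -
        have "q \<in> adj {1} t" using that K(3) \<open>adj {1} t = K\<close> by blast
        then obtain i where "q = t ^ i" by (auto simp: adj_def)
        then show ?thesis by (simp add: cj_power)
      qed
      then show ?thesis by (simp add: centraliser_def)
    qed
    then show False using tC by simp
  qed
  then have jd: "j \<le> d" using j by simp
  obtain M where M: "subgrp M" "adj {1} t \<subseteq> M" "M \<subseteq> K" "card M = p ^ d"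
    by (rule intermediate_subgrp[OF T1 T1K K(1) cK p(1) j(1) jd]) (use that in auto)
  have tM: "t \<in> M" using M(2) adj_mem[OF subgrp_trivial, of t] by blast
  have MS: "M \<subseteq> S" using M K by blast
  have SM: "S \<subseteq> normaliser M" by (rule S_normalises[OF M(1) MS M(4)])
  define Z where "Z = M \<inter> Q"
  have Z: "subgrp Z" using M Q by (simp add: Z_def subgrp_Int)
  have finM: "finite M" using MS finS finite_subset by blast
  have QM: "M \<subseteq> normaliser Q" using MS S Q by blast
  have MQ: "subgrp (sprod Q M)" "sprod Q M \<subseteq> K"
    using subgrp_sprod[OF Q(1) M(1) QM] sprod_subset[OF K(1,3) M(3)] by auto
  obtain i where i: "card (sprod Q M) = p ^ i" "i \<le> Suc d"
    using prime_power_card[OF MQ K(1) cK p(1)] by blast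
  have "Q \<subset> sprod Q M"
    using sprod_left[OF M(1), of Q] sprod_right[OF Q(1), of M] tM t(2) by blast
  then have "card Q < card (sprod Q M)"
    using finite_subset[OF MQ(2) finK] by (simp add: psubset_card_mono)
  then have "d < i" using i Q(2) p0 by (simp add: power_strict_increasing_iff)
  then have i': "i = Suc d" using i by simp
  have QMK: "sprod Q M = K" using card_subset_eq[OF finK MQ(2)] i i' cK by simp
  obtain z where z: "card Z = p ^ z" using prime_power_card[OF Z _ Q(1,2) p(1)] by (auto simp: Z_def)
  have "p ^ i * p ^ z = p ^ d * p ^ d"
    using card_sprod[OF Q(1) M(1) finQ finM] i z M(4) Q(2) by (simp add: Z_def Int_commute)
  then have "i + z = d + d" using p0 by (simp flip: power_add)
  then have "z = d - 1" using i' by simp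
  then have cZ: "card Z = p ^ (d - 1)" using z by simp
  have Zfix: "Z \<subseteq> fixq t"
    using ab[OF M(1) MS M(4)] tM by (auto simp: Z_def fixq_def cj_eq_self_iff)
  have "fixq t \<subseteq> Q" by (auto simp: fixq_def)
  obtain f where f: "card (fixq t) = p ^ f" "f \<le> d"
    using prime_power_card[OF subgrp_fixq \<open>fixq t \<subseteq> Q\<close> Q(1,2) p(1)] by blast
  have "f \<noteq> d" using card_subset_eq[OF finQ \<open>fixq t \<subseteq> Q\<close>] f fix_ne Q(2) by auto
  then have "p ^ f \<le> p ^ (d - 1)" using f p0 by (intro power_increasing) auto
  then have Zeq: "Z = fixq t"
    using cZ f(1) Zfix finite_subset[OF \<open>fixq t \<subseteq> Q\<close> finQ] by (intro card_seteq) auto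
  have "cm q t \<in> fixq t" if "q \<in> Q" for q
  proof -
    have "cm q t = inverse (cj q t) * t" by (simp add: cm_def cj_def mult.assoc)
    moreover have "cj q t \<in> M" using that QS SM tM by (auto intro: normaliser_cj)
    ultimately have "cm q t \<in> M" using M(1) tM by (simp add: subgrp_mult subgrp_inv)
    then show ?thesis using cmQ[OF tN that] Zeq by (auto simp: Z_def)
  qed
  then show "tv t" using tN cZ Zeq by (auto simp: tv_def img_def)
  show "S \<subseteq> normaliser (fixq t)"
  proof
    fix s assume "s \<in> S"
    then show "s \<in> normaliser (fixq t)"
      unfolding Zeq[symmetric] Z_def using SM S Q(4) by (intro normaliser_Int) auto
  qed
  then have tn: "t \<in> normaliser (fixq t)" using t(1) by blast
  have "t ^ p \<in> M" using M(1) tM by (simp add: subgrp_power)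
  then show tp: "t ^ p \<in> fixq t" using t(3) Zeq by (auto simp: Z_def)
  show "subgrp (adj (fixq t) t)" by (rule subgrp_adj[OF subgrp_fixq tn tp p0(1)])
  have "t \<notin> fixq t" using t(2) by (simp add: fixq_def)
  then show "card (adj (fixq t) t) = p ^ d"
    using card_adj_prime[OF subgrp_fixq finite_subset[OF \<open>fixq t \<subseteq> Q\<close> finQ] p(1) tp] cZ Zeq pd by simp
  fix s assume s: "s \<in> S"
  have SK: "S \<subseteq> normaliser K"
  proof
    fix s assume "s \<in> S"
    then show "s \<in> normaliser K"
      unfolding QMK[symmetric] using SM S Q(4) by (intro normaliser_sprod) auto
  qed
  have SQ: "S \<subseteq> normaliser Q" using S Q by blast
  show "cm t s \<in> Q"
    by (rule central_index_prime[OF Q(1) K(3,1) cK _ S(1,3) SQ SK p(1) K(4) s]) (simp add: cK Q)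
qed

lemma fixq_power:
  assumes "tv t" "q \<in> fixq t"
  shows "cj (t ^ i) q = q"
proof -
  have "cm q t = 1" using assms by (simp add: fixq_def cm_eq_1_iff)
  then show ?thesis using cj_power_tv[OF assms(1), of q i] assms by (simp add: fixq_def)
qed

text \<open>The elements \<open>x\<close> and a suitable power \<open>y'\<close> of \<open>y\<close> act on \<open>\<langle>b, c\<rangle>\<close> as
  the two elementary matrices generating \<open>SL\<^sub>2(p)\<close>, and \<open>(x y' x)\<^sup>2\<close> acts as \<open>-1\<close>.\<close>

lemma opposite_transvections_absurd:
  assumes x: "x \<in> S" "x \<notin> Q" "x ^ p \<in> Q" and y: "tv y"
    and c0: "c0 \<in> img x" "cj y c0 \<noteq> c0" and b: "b \<in> img y" "cj x b \<noteq> b"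
  shows False
proof -
  note E = elementary_transvection[OF x]
  have xt: "tv x" by (rule E)
  have xN: "x \<in> N" and yN: "y \<in> N" using xt y by (simp_all add: tv_def)
  have bQ: "b \<in> Q" using b img_sub[OF yN] by blast
  define c where "c = cm b x"
  have ci: "c \<in> img x" using bQ by (simp add: c_def img_def)
  have cQ: "c \<in> Q" using ci img_sub[OF xN] by blast
  have c1: "c \<noteq> 1" using b by (simp add: c_def cm_eq_1_iff)
  have cx: "cj x c = c" using ci xt by (auto simp: tv_def fixq_def)
  have yb: "cj y b = b" using b y by (auto simp: tv_def fixq_def)
  have cy: "cm c y \<noteq> 1"
  proof
    assume "cm c y = 1"
    then have "cj y c = c" by (simp add: cm_eq_1_iff)
    moreover obtain i where "c0 = c ^ i" using img_generated[OF xt ci c1 c0(1)] by blast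
    ultimately show False using c0(2) by (simp add: cj_power)
  qed
  have cyi: "cm c y \<in> img y" using cQ by (simp add: img_def)
  have "inverse b \<in> img y" using b subgrp_img[OF yN] by (simp add: subgrp_inv)
  \<comment> \<open>[c, y] generates the group [Q, y] of order \<open>p\<close>, so j can be chosen
    such that y^j sends c to c b^-1.\<close>
  then obtain j where j: "inverse b = cm c y ^ j" using img_generated[OF y cyi cy] by blast
  define y' where "y' = y ^ j"
  have y'N: "y' \<in> N" using yN N(1) by (simp add: y'_def subgrp_power)
  have bx: "cj x b = b * c" by (simp add: c_def cj_cm)
  have cy': "cj y' c = c * inverse b" using cj_power_tv[OF y cQ, of j] j by (simp add: y'_def)
  have yb': "cj y' b = b" using yb by (intro fixq_power[OF y, of b j, folded y'_def]) (simp add: fixq_def bQ)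
  have bc: "b * c = c * b" using Qab bQ cQ by blast
  \<comment> \<open>The Weyl element: it sends b to c and c to b^-1, so its square inverts
    both.\<close>
  define w where "w = x * y' * x"
  define t where "t = w * w"
  have wb: "cj w b = c"
  proof -
    have "cj w b = cj x (cj y' (b * c))" by (simp add: w_def cj_prod bx)
    also have "cj y' (b * c) = b * (c * inverse b)" by (simp add: cj_mult yb' cy')
    also have "\<dots> = c" by (simp add: bc flip: mult.assoc) (simp add: mult.assoc)
    finally show ?thesis by (simp add: cx)
  qed
  have wc: "cj w c = inverse b"
  proof -
    have "cj w c = cj x (c * inverse b)" by (simp add: w_def cj_prod cx cy')
    also have "\<dots> = c * inverse (b * c)" by (simp add: cj_mult cj_inverse cx bx)
    finally show ?thesis by simp
  qed
  have tb: "cj t b = inverse b" by (simp add: t_def cj_prod wb wc)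
  have tc: "cj t c = inverse c" by (simp add: t_def cj_prod wb wc cj_inverse)
  have tN: "t \<in> N" "w \<in> N" using xN y'N N(1) by (simp_all add: t_def w_def subgrp_mult)
  \<comment> \<open>Q is generated by b, c and the common fixed points of x and y, on which t acts
    trivially. Hence t commutes with x on Q.\<close>
  have decomp: "\<exists>i k z. q = b ^ i * c ^ k * z \<and> z \<in> fixq x \<and> cj y z = z" if q: "q \<in> Q" for q
  proof -
    have "cm q x \<in> img x" using q by (simp add: img_def)
    then obtain i where i: "cm q x = c ^ i" using img_generated[OF xt ci c1] by blast
    define q1 where "q1 = inverse (b ^ i) * q"
    have bi: "b ^ i \<in> Q" "inverse (b ^ i) \<in> Q" using bQ Q(1) by (simp_all add: subgrp_power subgrp_inv)
    have q1: "q1 \<in> Q" using bi q Q(1) by (simp add: q1_def subgrp_mult)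
    have "cm q1 x = inverse (cm (b ^ i) x) * cm q x"
      using cm_hom[OF xN bi(2) q] cm_hom_inv[OF xN bi(1)] by (simp add: q1_def)
    also have "cm (b ^ i) x = c ^ i" using cm_hom_power[OF xN bQ] by (simp add: c_def)
    finally have q1x: "cm q1 x = 1" by (simp add: i)
    have "cm q1 y \<in> img y" using q1 by (simp add: img_def)
    then obtain k where k: "cm q1 y = cm c y ^ k" using img_generated[OF y cyi cy] by blast
    define z where "z = inverse (c ^ k) * q1"
    have ck: "c ^ k \<in> Q" "inverse (c ^ k) \<in> Q" using cQ Q(1) by (simp_all add: subgrp_power subgrp_inv)
    have z: "z \<in> Q" using ck q1 Q(1) by (simp add: z_def subgrp_mult)
    have "cm z y = inverse (cm (c ^ k) y) * cm q1 y"
      using cm_hom[OF yN ck(2) q1] cm_hom_inv[OF yN ck(1)] by (simp add: z_def)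
    then have "cm z y = 1" using cm_hom_power[OF yN cQ] k by simp
    moreover have "cj x z = z" using q1x by (simp add: z_def cj_mult cj_inverse cj_power cx cm_eq_1_iff)
    moreover have "q = b ^ i * c ^ k * z" by (simp add: z_def q1_def mult.assoc)
    ultimately show ?thesis using z by (auto simp: fixq_def cm_eq_1_iff)
  qed
  have "cj t (cj x q) = cj x (cj t q)" if q: "q \<in> Q" for q
  proof -
    obtain i k z where z: "q = b ^ i * c ^ k * z" "z \<in> fixq x" "cj y z = z" using decomp[OF q] by blast
    have zQ: "z \<in> Q" and zx: "cj x z = z" using z(2) by (auto simp: fixq_def)
    have zy: "cj y' z = z" unfolding y'_def using fixq_power[OF y, of z] z(3) zQ by (simp add: fixq_def)
    have "cj w z = z" by (simp add: w_def cj_prod zx zy)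
    then have zt: "cj t z = z" by (simp add: t_def cj_prod)
    have inv: "inverse (b * c) = inverse b * inverse c" by (simp add: bc)
    show ?thesis
      by (simp add: z(1) cj_mult cj_power cj_inverse tb tc bx cx zx zt inv del: inv_mult)
  qed
  then have xtC: "cm x t \<in> C" using central_commutator[OF xN tN(1)] by blast
  define K where "K = adj Q x"
  have xnQ: "x \<in> normaliser Q" using xN Q by blast
  have K: "subgrp K" "K \<subseteq> S" "Q \<subseteq> K" "x \<in> K"
    using subgrp_adj[OF Q(1) xnQ x(3) p0(1)] adj_subset[OF S(1) QS x(1)] adj_sub adj_mem[OF Q(1)]
    by (auto simp: K_def)
  \<comment> \<open>Since [x, t] lies in C, t maps K = Q<x> into CK. An element of C then corrects t
    to a \<open>t'\<close> that normalises K and acts on Q as t does.\<close>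
  have tK: "cj t k \<in> sprod C K" if k: "k \<in> K" for k
  proof -
    obtain q i where q: "k = q * x ^ i" "q \<in> Q" using k unfolding K_def by (rule adjE)
    have KN: "K \<subseteq> normaliser C" using K S C by blast
    have sub: "subgrp (sprod C K)" using subgrp_sprod[OF C(1) K(1) KN] .
    have "cj t q \<in> sprod C K" using cjQ[OF tN(1) q(2)] K(3) sprod_right[OF C(1), of K] by blast
    moreover have "x * cm x t \<in> sprod C K"
      using K(4) xtC sprod_right[OF C(1), of K] sprod_left[OF K(1), of C] by (intro subgrp_mult sub) auto
    ultimately show ?thesis using sub by (simp add: q cj_mult cj_power cj_cm[of t x] subgrp_mult subgrp_power)
  qed
  obtain e where e: "e \<in> C" "\<And>k. k \<in> K \<Longrightarrow> cj (t * e) k \<in> K"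
    using frattini_conjugate[OF N S p(1) ind C(1-3) K(1,2) _ tN(1) tK] C(5) K(3) by blast
  define t' where "t' = t * e"
  have t'N: "t' \<in> N" using tN e C N(1) by (auto simp: t'_def subgrp_mult)
  have finK: "finite K" using K finS finite_subset by blast
  have t'K: "t' \<in> N \<inter> normaliser K" using t'N e(2) finK by (auto simp: t'_def intro: normaliserI)
  have t'b: "cj t' b = inverse b"
    using e(1) subgrp_inv[OF Q(1) bQ] by (simp add: t'_def cj_prod tb C_def centraliser_def)
  define Z where "Z = fixq x"
  define M where "M = adj Z x"
  have Z: "subgrp Z" "Z \<subseteq> Q" by (auto simp: Z_def subgrp_fixq) (auto simp: fixq_def)
  have xnZ: "x \<in> normaliser Z" using E(2) x by (auto simp: Z_def)
  have M: "subgrp M" "card M = p ^ d" using E(3,4) by (simp_all add: M_def Z_def)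
  have MK: "M \<subseteq> K" unfolding M_def using K Z by (intro adj_subset) auto
  have xM: "x \<in> M" unfolding M_def by (rule adj_mem[OF Z(1)])
  have finZ: "finite Z" using Z finQ finite_subset by blast
  \<comment> \<open>Z has index \<open>p\<close> in Z<g>, so a q outside Z would generate Z<g>
    together with Z and force g into Q.\<close>
  have capQ: "q \<in> Z" if q: "q \<in> adj Z g" "q \<in> Q" and g: "g \<notin> Q" "g ^ p \<in> Z" "g \<in> normaliser Z" "subgrp (adj Z g)" for q g
  proof (rule ccontr)
    assume qZ: "q \<notin> Z"
    have gZ: "g \<notin> Z" using g Z by blast
    have "adj Z g \<subseteq> normaliser Z"
      by (intro adj_subset subgrp_normaliser subgrp_le_normaliser Z g)
    moreover have fin: "card (adj Z g) = p * card Z" using card_adj_prime[OF Z(1) finZ p(1) g(2) gZ] .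
    moreover have "finite (adj Z g)"
    proof (rule ccontr)
      assume "infinite (adj Z g)"
      then show False using fin card_subgrp_pos[OF Z(1) finZ] p0 by simp
    qed
    ultimately have "adj Z q = adj Z g"
      using index_prime(2)[OF Z(1) adj_sub g(4) _ _ _ p(1) q(1) qZ] by blast
    moreover have "adj Z q \<subseteq> Q" using Z q by (intro adj_subset Q) auto
    ultimately show False using adj_mem[OF Z(1), of g] g(1) by blast
  qed
  have ext: "cm x t' \<in> Z"
  proof -
    have "t' \<in> normaliser M" using inv[OF M(1) K(1) MK K(2) M(2)] t'K by blast
    then have "cj t' x \<in> M" using xM by (simp add: normaliser_cj)
    then have cmM: "cm x t' \<in> M" using M xM by (simp add: cm_def subgrp_mult subgrp_inv)
    have "cm x e \<in> C"
    proof -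
      have "cm x e = cj x (inverse e) * e" by (simp add: cm_def cj_def mult.assoc)
      moreover have "cj x (inverse e) \<in> C" using e(1) C xN by (auto intro!: normaliser_cj subgrp_inv)
      ultimately show ?thesis using e C by (simp add: subgrp_mult)
    qed
    moreover have "cj e (cm x t) \<in> C" using e xtC C(1) by (simp add: subgrp_cj)
    ultimately have "cm x t' \<in> C" using C(1) by (simp add: t'_def cm_prod subgrp_mult)
    then have "cm x t' \<in> Q" using cmM MK K C(5) by blast
    then show ?thesis using capQ[of "cm x t'" x] cmM x(2) E(5) xnZ M by (simp add: M_def Z_def)
  qed
  \<comment> \<open>Z<xb> has order \<open>p^d\<close>, so \<open>t'\<close> normalises it. Modulo Z
    it sends xb to x b^-1, which puts b^2 into Z<xb> \<inter> Q = Z. As \<open>p\<close> is odd, b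
    would lie in Z = C_Q(x).\<close>
  define g where "g = x * b"
  have bnZ: "b \<in> normaliser Z"
    using Qcj bQ Z by (intro normaliserI[OF finZ]) auto
  have gn: "g \<in> normaliser Z" unfolding g_def using xnZ bnZ by (intro subgrp_mult subgrp_normaliser)
  have gQ: "g \<notin> Q" using x(2) bQ subgrp_mult_iff(2)[OF Q(1) bQ] by (simp add: g_def)
  have gp: "g ^ p \<in> Z"
  proof -
    have "c \<in> Z" using ci xt by (auto simp: tv_def Z_def)
    then have "cj (quo Z x) (quo Z b) = quo Z b"
      using cm_mem_iff_quo[OF Z(1) bnZ xnZ] quo_cj[OF xnZ bnZ] by (simp add: c_def)
    then have "(quo Z x * quo Z b) ^ p = quo Z x ^ p * quo Z b ^ p"
      by (intro commuting_power_mult) (simp add: cj_eq_self_iff)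
    then have "quo Z (g ^ p) = quo Z (x ^ p) * quo Z (b ^ p)"
      by (simp add: quo_power gn xnZ bnZ) (simp add: g_def quo_mult xnZ bnZ)
    also have "quo Z (x ^ p) = 1"
      using E(5) quo_eq_1_iff[OF Z(1) subgrp_power[OF subgrp_normaliser xnZ]] by (simp add: Z_def)
    also have "b ^ p = 1" by (rule img_power[OF y b(1)])
    finally show ?thesis using quo_eq_1_iff[OF Z(1) subgrp_power[OF subgrp_normaliser gn]] by simp
  qed
  define H where "H = adj Z g"
  have H: "subgrp H" unfolding H_def by (rule subgrp_adj[OF Z(1) gn gp p0(1)])
  have gZ: "g \<notin> Z" using gQ Z by blast
  have cH: "card H = p ^ d"
    using card_adj_prime[OF Z(1) finZ p(1) gp gZ] xt pd by (simp add: H_def Z_def tv_def)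
  have HK: "H \<subseteq> K" unfolding H_def g_def using K Z bQ by (intro adj_subset subgrp_mult) auto
  have gH: "g \<in> H" unfolding H_def by (rule adj_mem[OF Z(1)])
  have "t' \<in> normaliser H" using inv[OF H K(1) HK K(2) cH] t'K by blast
  then have "cj t' g \<in> H" using gH by (simp add: normaliser_cj)
  then have "inverse g * cj t' g \<in> H" using H gH by (simp add: subgrp_mult subgrp_inv)
  also have "inverse g * cj t' g = inverse b * cm x t' * inverse b"
    by (simp add: g_def cj_mult t'b cj_cm[of t' x] mult.assoc)
  also have "\<dots> = cm x t' * inverse (b ^ 2)"
  proof -
    have "inverse b * cm x t' = cm x t' * inverse b" using Qab ext Z bQ Q(1) by (blast intro: subgrp_inv)
    then show ?thesis by (simp add: mult.assoc power2_eq_square)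
  qed
  finally have "inverse (b ^ 2) \<in> H"
    using subgrp_mult_iff(1)[OF H] ext adj_sub[of Z g] by (auto simp: H_def)
  then have "b ^ 2 \<in> H" using subgrp_inv_iff[OF H] by blast
  moreover have "b ^ 2 \<in> Q" using bQ Q(1) by (simp add: subgrp_power)
  ultimately have "b ^ 2 \<in> Z" using capQ[of "b ^ 2" g] gQ gp gn H by (simp add: H_def)
  moreover have "b ^ p \<in> Z" using img_power[OF y b(1)] Z by (simp add: subgrp_one)
  moreover have "coprime 2 p" using p by simp
  ultimately have "b \<in> Z" using power_mem_coprime[OF Z(1)] by blast
  then show False using b by (simp add: Z_def fixq_def)
qed

text \<open>Here x fixes [Q, y] pointwise, so x and y both act trivially on the factors of the chain
  1 <= F2 <= F1 <= Q. Elements of order prime to \<open>p\<close> doing so lie in C, so modulo C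
  both x and y are conjugate, by the same n, into S. There elements of order \<open>p\<close> modulo
  Q are central, so x and y commute on Q, which contradicts [c, y] being nontrivial.\<close>

lemma one_sided_transvections_absurd:
  assumes x: "tv x" and y: "tv y" and c: "c \<in> img x" "cj y c \<noteq> c" and b: "cj x (cm c y) = cm c y"
  shows False
proof -
  have xN: "x \<in> N" and yN: "y \<in> N" using x y by (simp_all add: tv_def)
  have cQ: "c \<in> Q" using c img_sub[OF xN] by blast
  define b where "b = cm c y"
  have bi: "b \<in> img y" using cQ by (simp add: b_def img_def)
  have b1: "b \<noteq> 1" using c by (simp add: b_def cm_eq_1_iff)
  have bx: "cj x b = b" using b by (simp add: b_def)
  have xy: "cj x z = z" if z: "z \<in> img y" for z
  proof -
    obtain i where "z = b ^ i" using img_generated[OF y bi b1 z] by blast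
    then show ?thesis by (simp add: cj_power bx)
  qed
  have xx: "cj x z = z" if "z \<in> img x" for z using that x by (auto simp: tv_def fixq_def)
  have yy: "cj y z = z" if "z \<in> img y" for z using that y by (auto simp: tv_def fixq_def)
  define F2 F1 where "F2 = img y" and "F1 = sprod (img x) (img y)"
  have I: "subgrp (img x)" "subgrp (img y)" "img x \<subseteq> Q" "img y \<subseteq> Q"
    using subgrp_img img_sub xN yN by auto
  have "img y \<subseteq> normaliser (img x)"
  proof
    fix z assume z: "z \<in> img y"
    have "cj z v = v" if "v \<in> img x" for v using Qcj z that I by blast
    then show "z \<in> normaliser (img x)"
      by (intro normaliserI finite_subset[OF I(3) finQ]) simp
  qed
  then have F1: "subgrp F1" "F1 \<subseteq> Q" "F2 \<subseteq> F1" and F1x: "img x \<subseteq> F1"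
    using subgrp_sprod[OF I(1,2)] sprod_subset[OF Q(1) I(3,4)] sprod_right[OF I(1)] sprod_left[OF I(2)]
    by (auto simp: F1_def F2_def)
  have F2: "subgrp F2" "F2 \<subseteq> Q" using I by (simp_all add: F2_def)
  have fin: "finite F1" "finite F2" using F1 F2 finQ finite_subset by blast+
  have xF1: "cj x z = z" if "z \<in> F1" for z
    using that xx xy unfolding F1_def by (auto elim!: sprodE simp: cj_mult)
  have xF2: "cj x z = z" if "z \<in> F2" for z using that xF1 F1 by blast
  have yF1: "cm z y \<in> F2" if "z \<in> F1" for z
    using that I(3) by (auto simp: F2_def img_def F1(2)[THEN subsetD])
  have yF2: "cj y z = z" if "z \<in> F2" for z using that yy by (simp add: F2_def)
  define X where "X = N \<inter> stabmod Q F1 \<inter> stabmod F1 F2 \<inter> stabmod F2 {1}"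
  have X: "subgrp X" "X \<subseteq> N"
    by (auto simp: X_def intro!: subgrp_Int subgrp_stabmod N F1 F2 subgrp_trivial)
  have "x \<in> stabmod Q F1"
    unfolding stabmod_def using xF1 F1x by (auto intro!: normaliserI fin simp: img_def)
  moreover have "x \<in> stabmod F1 F2"
    unfolding stabmod_def using xF1 xF2 subgrp_one[OF F2(1)]
    by (auto intro!: normaliserI fin simp: cm_eq_1_iff[THEN iffD2])
  moreover have "x \<in> stabmod F2 {1}"
    unfolding stabmod_def using xF2 by (auto simp: normaliser_trivial cm_eq_1_iff)
  ultimately have xX: "x \<in> X" using xN by (simp add: X_def)
  have "y \<in> stabmod Q F1"
    unfolding stabmod_def
  proof (clarsimp, intro conjI ballI normaliserI fin)
    fix z assume "z \<in> F1"
    then show "cj y z \<in> F1" unfolding cj_cm using yF1 F1 by (blast intro: subgrp_mult)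
  qed (use F1(3) in \<open>auto simp: F2_def img_def\<close>)
  moreover have "y \<in> stabmod F1 F2"
    unfolding stabmod_def using yF1 yF2 by (auto intro!: normaliserI fin)
  moreover have "y \<in> stabmod F2 {1}"
    unfolding stabmod_def using yF2 by (auto simp: normaliser_trivial cm_eq_1_iff)
  ultimately have yX: "y \<in> X" using yN by (simp add: X_def)
  have CX: "C \<subseteq> X"
  proof
    fix g assume g: "g \<in> C"
    then have gq: "g \<in> centraliser V" if "V \<subseteq> Q" for V using that by (auto simp: C_def centraliser_def)
    have "g \<in> stabmod Q F1" "g \<in> stabmod F1 F2" "g \<in> stabmod F2 {1}"
      using centraliser_stabmod[OF F1(1,2)] centraliser_stabmod[OF F2(1) F1(3)]
        centraliser_stabmod[OF subgrp_trivial, of F2] subgrp_one[OF F2(1)] gq F1 F2 by blast+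
    then show "g \<in> X" using g C by (auto simp: X_def)
  qed
  have "h \<in> C" if h: "h \<in> X" "h ^ k = 1" "coprime k p" for h k
  proof -
    have st: "h \<in> stabmod Q F1" "h \<in> stabmod F1 F2" "h \<in> stabmod F2 {1}" using h by (auto simp: X_def)
    have 2: "cj h z = z" if "z \<in> F2" for z
      using stabmodD[OF st(3) that] by (simp add: cm_eq_1_iff)
    have 1: "cj h z = z" if "z \<in> F1" for z
      by (rule coprime_stabiliser_trivial[OF p(1) Q(1,2) F1(2,3) h(2,3) st(2) 2 that])
    have "cj h z = z" if "z \<in> Q" for z
      by (rule coprime_stabiliser_trivial[OF p(1) Q(1,2) subset_refl F1(2) h(2,3) st(1) 1 that])
    then show ?thesis using h X by (auto simp: C_def centraliser_def)
  qed
  then obtain n where n: "n \<in> N" "\<And>g. g \<in> X \<Longrightarrow> cj n g \<in> sprod C S"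
    using p_prime_elements_central[OF N S(1,2) p(1) ind X C(1) CX C(3)] by blast
  \<comment> \<open>Modulo C the conjugate of g by n is an element s of S; it has order
    \<open>p\<close> modulo Q because g is a transvection and C \<inter> S = Q.\<close>
  have split: "\<exists>s\<in>S. s \<notin> Q \<and> s ^ p \<in> Q \<and> s \<in> normaliser C \<and> quo C (cj n g) = quo C s"
    if g: "g \<in> X" "tv g" for g
  proof -
    obtain a s where as: "cj n g = a * s" "a \<in> C" "s \<in> S" using n(2)[OF g(1)] by (rule sprodE)
    have an: "a \<in> normaliser C" and sn: "s \<in> normaliser C" using as C S by auto
    have q: "quo C (cj n g) = quo C s"
      using as(2) by (simp add: as(1) quo_mult an sn quo_eq_1_iff[OF C(1) an, THEN iffD2])
    have gN: "cj n g \<in> normaliser C" using as an sn subgrp_mult[OF subgrp_normaliser] by metis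
    have tvg: "tv (cj n g)" by (rule tv_cj[OF g(2) n(1)])
    have "s \<notin> Q"
    proof
      assume "s \<in> Q"
      then have "cj n g \<in> C" using as C by (auto simp: subgrp_mult)
      then show False using tv_not_central[OF tvg] by simp
    qed
    moreover have "s ^ p \<in> Q"
    proof -
      have "quo C (s ^ p) = quo C (cj n g ^ p)" using q by (simp add: quo_power sn gN)
      also have "\<dots> = 1"
        using tv_power_central[OF tvg] quo_eq_1_iff[OF C(1) subgrp_power[OF subgrp_normaliser gN]] by simp
      finally have "s ^ p \<in> C" using quo_eq_1_iff[OF C(1) subgrp_power[OF subgrp_normaliser sn]] by simp
      then show ?thesis using as S C(5) by (auto simp: subgrp_power)
    qed
    ultimately show ?thesis using as sn q by blast
  qed
  obtain x1 where x1: "x1 \<in> S" "x1 \<notin> Q" "x1 ^ p \<in> Q" "x1 \<in> normaliser C" "quo C (cj n x) = quo C x1"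
    using split[OF xX x] by blast
  obtain y1 where y1: "y1 \<in> S" "y1 \<in> normaliser C" "quo C (cj n y) = quo C y1"
    using split[OF yX y] by blast
  have nx: "cj n x \<in> N" "cj n y \<in> N" using xN yN n N by (auto simp: subgrp_cj)
  then have nxC: "cj n x \<in> normaliser C" "cj n y \<in> normaliser C" using C by auto
  have "cm x1 y1 \<in> C" using elementary_transvection(6)[OF x1(1-3) y1(1)] C by blast
  then have "quo C (cm x1 y1) = 1"
    using quo_eq_1_iff[OF C(1)] C(3) x1(1) y1(1) S C(2) by blast
  then have "quo C (cm (cj n x) (cj n y)) = 1"
    using x1 y1 nxC by (simp add: quo_cm)
  moreover have "cm (cj n x) (cj n y) = cj n (cm x y)" by (simp add: cm_def cj_mult cj_inverse cj_cj[of n y])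
  moreover have "cm x y \<in> N" using xN yN N(1) by (simp add: cm_def subgrp_mult subgrp_inv subgrp_cj)
  then have "cj n (cm x y) \<in> normaliser C" using n N C by (auto intro: subgrp_cj)
  ultimately have "cj n (cm x y) \<in> C" using quo_eq_1_iff[OF C(1)] by simp
  then have "cm x y \<in> C" using n C normaliserD by blast
  then have comm: "cj y (cj x q) = cj x (cj y q)" if "q \<in> Q" for q
    using central_commutator[OF xN yN] that by blast
  \<comment> \<open>Applying x and y to \<open>q0\<close> in both orders, with [q0, x] = c, the
    results differ by the factor b = [c, y].\<close>
  obtain q0 where q0: "c = cm q0 x" "q0 \<in> Q" using c by (auto simp: img_def)
  have qy: "cm q0 y \<in> img y" "cm q0 y \<in> Q" using q0 cmQ[OF yN] by (auto simp: img_def)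
  have "cj y (cj x q0) = q0 * cm q0 y * (c * b)"
    by (simp add: cj_cm[of x q0] cj_mult cj_cm[of y] q0(1)[symmetric] b_def)
  moreover have "cj x (cj y q0) = q0 * c * cm q0 y"
    by (simp add: cj_cm[of y q0] cj_mult cj_cm[of x q0] q0(1)[symmetric] xy[OF qy(1)])
  ultimately have "cm q0 y * (c * b) = c * cm q0 y" using comm[OF q0(2)] by (simp add: mult.assoc)
  also have "\<dots> = cm q0 y * c" using Qab cQ qy by blast
  finally have "b = 1" by (metis left_mult_cancel mult_1_right)
  then show False using b1 by simp
qed

text \<open>Suppose y moves c = [q, x]. If x moves [c, y], the pair is opposite and yields SL_2(p);
  if x fixes it, both stabilise a common chain. Each case is absurd.\<close>

lemma transvections_annihilate:
  assumes x: "x \<in> S" "x \<notin> Q" "x ^ p \<in> Q" and y: "tv y" and q: "q \<in> Q"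
  shows "cj y (cm q x) = cm q x"
proof (rule ccontr)
  assume ne: "cj y (cm q x) \<noteq> cm q x"
  have xt: "tv x" by (rule elementary_transvection[OF x])
  have c: "cm q x \<in> img x" using q by (simp add: img_def)
  then have "cm q x \<in> Q" using img_sub xt by (auto simp: tv_def)
  then have "cm (cm q x) y \<in> img y" by (simp add: img_def)
  then show False
    using opposite_transvections_absurd[OF x y c ne] one_sided_transvections_absurd[OF xt y c ne] by blast
qed

text \<open>Let F be the common fixed points in Q of all N-conjugates of elements of E.
  Transvections annihilate each other, so [Q, E] <= F. The elements of N acting trivially on Q/F and
  on F form a subgroup X normal in N that contains E, and X/C is a \<open>p\<close>-group; so B = S
  \<inter> X serves, and B > Q because S/Q has elements of order \<open>p\<close>.\<close>

lemma normal_p_section: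
  obtains B where "subgrp B" "Q \<subset> B" "B \<subseteq> S" "C \<inter> S \<subseteq> B" "\<And>u b. u \<in> N \<Longrightarrow> b \<in> B \<Longrightarrow> cj u b \<in> sprod C B"
proof -
  define E where "E = {t \<in> S. t ^ p \<in> Q}"
  define \<T> where "\<T> = {cj g t | g t. g \<in> N \<and> t \<in> E}"
  have EN: "E \<subseteq> N" using S by (auto simp: E_def)
  have ET: "E \<subseteq> \<T>"
  proof
    fix t assume "t \<in> E"
    then have "cj 1 t \<in> \<T>" unfolding \<T>_def using subgrp_one[OF N(1)] by blast
    then show "t \<in> \<T>" by simp
  qed
  have Tcj: "cj u y \<in> \<T>" if u: "u \<in> N" and y: "y \<in> \<T>" for u y
  proof -
    obtain g t where "y = cj g t" "g \<in> N" "t \<in> E" using y by (auto simp: \<T>_def)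
    then have "cj u y = cj (g * u) t" "g * u \<in> N" "t \<in> E"
      using u N(1) by (auto simp: cj_prod subgrp_mult)
    then show ?thesis by (auto simp: \<T>_def)
  qed
  have Ttv: "tv y \<or> y \<in> Q" if y: "y \<in> \<T>" for y
  proof -
    obtain g t where "y = cj g t" "g \<in> N" "t \<in> E" using y by (auto simp: \<T>_def)
    then show ?thesis
      using elementary_transvection(1)[of t] tv_cj[of t g] cjQ[of g t] by (auto simp: E_def)
  qed
  have ann: "cj y (cm q x) = cm q x" if x: "x \<in> E" and y: "y \<in> \<T>" and q: "q \<in> Q" for x y q
  proof (cases "x \<in> Q \<or> y \<in> Q")
    case True
    have "x \<in> N" using x EN by blast
    then show ?thesis
    proof (cases "y \<in> Q")
      case False
      then have "cm q x = 1" using True Qcj[OF q] by (simp add: cm_eq_1_iff)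
      then show ?thesis by simp
    qed (use Qcj cmQ[OF _ q] in blast)
  next
    case False
    then show ?thesis using transvections_annihilate[of x y q] x Ttv[OF y] q by (auto simp: E_def)
  qed
  define F where "F = {q \<in> Q. \<forall>y\<in>\<T>. cj y q = q}"
  have F: "subgrp F" "F \<subseteq> Q"
    using Q(1) by (auto simp: F_def subgrp_def cj_mult cj_inverse)
  have finF: "finite F" using F finQ finite_subset by blast
  have NF: "N \<subseteq> normaliser F"
  proof
    fix u assume u: "u \<in> N"
    have ui: "inverse u \<in> N" using u N(1) by (simp add: subgrp_inv)
    show "u \<in> normaliser F"
    proof (rule normaliserI[OF finF])
      fix q assume q: "q \<in> F"
      have "cj y (cj u q) = cj u q" if "y \<in> \<T>" for y
      proof -
        have "cj (cj (inverse u) y) q = q" using q Tcj[OF ui that] by (simp add: F_def)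
        then have "cj u (cj (cj (inverse u) y) q) = cj u q" by simp
        then show ?thesis by (simp add: cj_cj[of u "cj (inverse u) y"])
      qed
      then show "cj u q \<in> F" using q cjQ[OF u] by (simp add: F_def)
    qed
  qed
  define X where "X = N \<inter> stabmod Q F \<inter> stabmod F {1}"
  have X: "subgrp X" "X \<subseteq> N"
    by (auto simp: X_def intro!: subgrp_Int subgrp_stabmod N F subgrp_trivial)
  have Xcj: "cj u g \<in> X" if "u \<in> N" "g \<in> X" for u g
    using that Q(4) NF N(1) cj_mem_stabmod[of g Q F u] cj_mem_stabmod[of g F "{1}" u]
    by (auto simp: X_def normaliser_trivial subgrp_cj)
  have CX: "C \<subseteq> X"
  proof
    fix g assume g: "g \<in> C"
    then have gq: "g \<in> centraliser V" if "V \<subseteq> Q" for V using that by (auto simp: C_def centraliser_def)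
    have "g \<in> stabmod Q F" "g \<in> stabmod F {1}"
      using centraliser_stabmod[OF F] centraliser_stabmod[OF subgrp_trivial, of F] subgrp_one[OF F(1)] gq F
      by blast+
    then show "g \<in> X" using g C by (auto simp: X_def)
  qed
  have EX: "E \<subseteq> X"
  proof
    fix t assume t: "t \<in> E"
    then have tN: "t \<in> N" using EN by blast
    have "cm q t \<in> F" if "q \<in> Q" for q
      using ann[OF t _ that] cmQ[OF tN that] by (simp add: F_def)
    moreover have "cm q t = 1" if "q \<in> F" for q
      using that ET t by (auto simp: F_def cm_eq_1_iff)
    ultimately show "t \<in> X" using tN NF by (auto simp: X_def stabmod_def normaliser_trivial)
  qed
  have "h \<in> C" if h: "h \<in> X" "h ^ k = 1" "coprime k p" for h k
  proof -
    have st: "h \<in> stabmod Q F" "h \<in> stabmod F {1}" using h by (auto simp: X_def)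
    have 1: "cj h z = z" if "z \<in> F" for z
      using stabmodD[OF st(2) that] by (simp add: cm_eq_1_iff)
    have "cj h z = z" if "z \<in> Q" for z
      by (rule coprime_stabiliser_trivial[OF p(1) Q(1,2) subset_refl F(2) h(2,3) st(1) 1 that])
    then show ?thesis using h X by (auto simp: C_def centraliser_def)
  qed
  then obtain n where n: "n \<in> N" "\<And>g. g \<in> X \<Longrightarrow> cj n g \<in> sprod C S"
    using p_prime_elements_central[OF N S(1,2) p(1) ind X C(1) CX C(3)] by blast
  define B where "B = S \<inter> X"
  have XB: "g \<in> sprod C B" if g: "g \<in> X" for g
  proof -
    \<comment> \<open>X is normal in N, so the conjugation by n can be undone, and X itself lies in
      CS.\<close>
    have "cj (inverse n) g \<in> X" using Xcj[OF subgrp_inv[OF N(1) n(1)] g] .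
    from n(2)[OF this] have "g \<in> sprod C S" by simp
    then obtain a s where as: "g = a * s" "a \<in> C" "s \<in> S" by (rule sprodE)
    then have "s \<in> X" using g CX subgrp_mult_iff(1)[OF X(1)] by blast
    then show ?thesis using as by (auto simp: B_def intro: sprodI)
  qed
  obtain t where t: "t \<in> S" "t \<notin> Q" "t ^ p \<in> Q"
    using p_group_normaliser_grows[OF Q(1) S(1) Q(3) S(3) p(1)] by blast
  then have "t \<in> B" using EX by (auto simp: B_def E_def)
  moreover have "Q \<subseteq> B" using QS C CX by (auto simp: B_def)
  ultimately have "Q \<subset> B" using t by blast
  moreover have "subgrp B" unfolding B_def using S X by (simp add: subgrp_Int)
  moreover have "cj u b \<in> sprod C B" if "u \<in> N" "b \<in> B" for u b
    using XB Xcj that by (auto simp: B_def)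
  moreover have "C \<inter> S \<subseteq> B" using CX by (auto simp: B_def)
  ultimately show thesis using that[of B] by (auto simp: B_def)
qed

end

section \<open>Control of fusion\<close>

text \<open>The last assumption is semi-invariance of H: the automorphisms of K in the fusion system
  are the conjugations by elements of G \<inter> \<open>normaliser K\<close>.\<close>

locale sylow_semi_invariant =
  fixes G S :: "'a::group_mult set" and p m d :: nat
  assumes p: "prime p" "odd p" and G: "subgrp G" "finite G"
    and S: "subgrp S" "S \<subseteq> G" "card S = p ^ m" and ind: "\<not> p dvd card G div card S"
    and d: "0 < d" "d < m"
    and ab: "\<And>H x y. subgrp H \<Longrightarrow> H \<subseteq> S \<Longrightarrow> card H = p ^ d \<Longrightarrow> x \<in> H \<Longrightarrow> y \<in> H \<Longrightarrow> x * y = y * x"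
    and inv: "\<And>H K. subgrp H \<Longrightarrow> subgrp K \<Longrightarrow> H \<subseteq> K \<Longrightarrow> K \<subseteq> S \<Longrightarrow> card H = p ^ d \<Longrightarrow>
      G \<inter> normaliser K \<subseteq> normaliser H"
begin

lemma finS: "finite S"
  using S G finite_subset by blast

text \<open>The last clause says that CB is normal in N. If C_S(Q) is not contained in Q, take B = Q
  C_S(Q); if |Q| = \<open>p^d\<close>, the transvections provide B; if |Q| > \<open>p^d\<close>,
  take B = T, as CT contains all commutators of N.\<close>

lemma local_extension_subgrp:
  assumes Q: "subgrp Q" "Q \<subset> S"
  defines "N \<equiv> G \<inter> normaliser Q" and "T \<equiv> S \<inter> normaliser Q" and "C \<equiv> centraliser Q \<inter> (G \<inter> normaliser Q)"
  assumes indN: "\<not> p dvd card N div card T"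
  obtains B where "subgrp B" "Q \<subset> B" "B \<subseteq> T" "C \<inter> T \<subseteq> B"
    "\<And>u b. u \<in> N \<Longrightarrow> b \<in> B \<Longrightarrow> cj u b \<in> sprod C B"
proof -
  have QS: "Q \<subseteq> S" using Q by blast
  have QQ: "Q \<subseteq> normaliser Q" using subgrp_le_normaliser[OF Q(1)] .
  have N: "subgrp N" "finite N" "N \<subseteq> normaliser Q" "Q \<subseteq> N" "N \<subseteq> G"
    unfolding N_def using subgrp_Int[OF G(1) subgrp_normaliser] G(2) QQ QS S by auto
  have T: "subgrp T" "T \<subseteq> N" "T \<subseteq> S" "Q \<subseteq> T"
    unfolding T_def N_def using subgrp_Int[OF S(1) subgrp_normaliser] S QQ QS by auto
  have C: "subgrp C" "C \<subseteq> N" unfolding C_def N_def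
    using subgrp_Int[OF subgrp_centraliser N(1)[unfolded N_def]] by auto
  have NC: "N \<subseteq> normaliser C"
    using normaliser_centraliser_Int[OF N(1,3)] by (simp add: C_def N_def)
  have Ceq: "C = centraliser Q \<inter> N" by (simp add: C_def N_def)
  obtain k where k: "card Q = p ^ k" using prime_power_card[OF Q(1) QS S(1,3) p(1)] by blast
  have QT: "Q \<subset> T"
  proof -
    obtain x where "x \<in> S" "x \<notin> Q" "x \<in> normaliser Q"
      using p_group_normaliser_grows[OF Q(1) S(1) Q(2) S(3) p(1)] by blast
    then show ?thesis using T(4) by (auto simp: T_def)
  qed
  show thesis
  proof (cases "centraliser Q \<inter> S \<subseteq> Q")
    case False
    define Z where "Z = C \<inter> S"
    have Z: "subgrp Z" "Z \<subseteq> S" "Z \<subseteq> C" unfolding Z_def using C S by (auto intro: subgrp_Int)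
    have Zs: "centraliser Q \<inter> S \<subseteq> Z"
      using S centraliser_le_normaliser[of Q] by (auto simp: Z_def C_def)
    have ZQ: "Z \<subseteq> normaliser Q" using Z C N by blast
    define B where "B = sprod Q Z"
    have B: "subgrp B" "Q \<subseteq> B" "Z \<subseteq> B"
      unfolding B_def using subgrp_sprod[OF Q(1) Z(1) ZQ] sprod_left[OF Z(1)] sprod_right[OF Q(1)] by auto
    have "Z \<subseteq> T" using Z ZQ by (auto simp: T_def)
    then have BT: "B \<subseteq> T" unfolding B_def using T by (intro sprod_subset) auto
    have "Q \<subset> B" using B False Zs by blast
    moreover have "C \<inter> T \<subseteq> B" using B T by (auto simp: Z_def)
    moreover have "cj u b \<in> sprod C B" if u: "u \<in> N" and b: "b \<in> B" for u b
    proof -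
      obtain q z where qz: "b = q * z" "q \<in> Q" "z \<in> Z" using b unfolding B_def by (rule sprodE)
      have uq: "cj u q \<in> Q" using u qz N by (auto intro: normaliser_cj)
      have uz: "cj u z \<in> C" using u qz Z NC by (auto intro: normaliser_cj)
      have "cj (cj u z) (cj u q) = cj u q" using uz uq by (auto simp: C_def centraliser_def)
      then have "cj u q * cj u z = cj u z * cj u q" by (simp add: cj_eq_self_iff)
      then have "cj u b = cj u z * cj u q" by (simp add: qz(1) cj_mult)
      then show ?thesis using uz uq B by (auto intro!: sprodI)
    qed
    ultimately show thesis using that[OF B(1)] BT by blast
  next
    case cent: True
    have dk: "d \<le> k"
    proof (rule ccontr)
      assume "\<not> d \<le> k"
      then have kd: "k \<le> d" "k \<noteq> d" "d \<le> m" using d by auto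
      obtain H where H: "subgrp H" "Q \<subseteq> H" "H \<subseteq> S" "card H = p ^ d"
        using intermediate_subgrp[OF Q(1) QS S(1,3) p(1) k kd(1,3)] by blast
      have "H \<subseteq> centraliser Q"
        using ab[OF H(1,3,4)] H(2) by (auto simp: centraliser_def cj_eq_self_iff)
      then have "H \<subseteq> Q" using cent H by blast
      then have "H = Q" using H by blast
      then have "p ^ k = p ^ d" using H k by simp
      then show False using kd prime_gt_1_nat[OF p(1)] power_inject_exp by blast
    qed
    show thesis
    proof (cases "k = d")
      case True
      have cQ: "card Q = p ^ d" using k True by simp
      have SQ: "S \<subseteq> normaliser Q"
        using inv[OF Q(1) S(1) QS subset_refl cQ] S subgrp_le_normaliser[OF S(1)] by blast
      then have TS: "T = S" by (auto simp: T_def)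
      interpret tr: transvections N S Q p d m
      proof
        show "H \<subseteq> S \<Longrightarrow> subgrp H \<Longrightarrow> card H = p ^ d \<Longrightarrow> x \<in> H \<Longrightarrow> y \<in> H \<Longrightarrow> x * y = y * x" for H x y
          using ab by blast
        show "N \<inter> normaliser K \<subseteq> normaliser H"
          if "subgrp H" "subgrp K" "H \<subseteq> K" "K \<subseteq> S" "card H = p ^ d" for H K
          using inv[OF that] N(5) by blast
      qed (use p N S Q cQ d cent indN TS T in auto)
      show thesis
        using tr.normal_p_section that TS unfolding tr.C_def Ceq by metis
    next
      case False
      then have dk': "d < k" using dk by simp
      interpret iv: invariant_subgroups Q N p k d
      proof
        show "N \<subseteq> normaliser H" if "subgrp H" "H \<subseteq> Q" "card H = p ^ d" for H
          using inv[OF that(1) Q(1) that(2) QS that(3)] by (simp add: N_def)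
        show "x * y = y * x" if "subgrp H" "H \<subseteq> Q" "card H = p ^ d" "x \<in> H" "y \<in> H" for H x y
          using ab[OF that(1) _ that(3,4,5)] that(2) QS by blast
      qed (use p N Q k d dk' in auto)
      have TC: "T \<subseteq> normaliser C" using T NC by blast
      have sub: "subgrp (sprod C T)" by (rule subgrp_sprod[OF C(1) T(1) TC])
      have "cj u b \<in> sprod C T" if u: "u \<in> N" and b: "b \<in> T" for u b
      proof -
        have "b \<in> N" using b T by blast
        then have "cm b u \<in> sprod C T"
          using iv.commutators_and_powers(1)[OF T(1,2) indN _ u] by (simp add: Ceq)
        moreover have "b \<in> sprod C T" using b sprod_right[OF C(1), of T] by blast
        ultimately show ?thesis unfolding cj_cm by (intro subgrp_mult[OF sub])
      qed
      then show thesis using that[OF T(1) QT] by blast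
    qed
  qed
qed

text \<open>Some uc with c centralising Q maps B into itself and acts on Q as u does. Since B > Q,
  the induction hypothesis applies to uc on B.\<close>

lemma local_control:
  assumes Q: "subgrp Q" "Q \<subset> S" and indN: "\<not> p dvd card (G \<inter> normaliser Q) div card (S \<inter> normaliser Q)"
    and IH: "\<And>P g. subgrp P \<Longrightarrow> P \<subseteq> S \<Longrightarrow> card Q < card P \<Longrightarrow> g \<in> G \<Longrightarrow> (\<And>x. x \<in> P \<Longrightarrow> cj g x \<in> S) \<Longrightarrow>
      \<exists>n\<in>G \<inter> normaliser S. \<forall>x\<in>P. cj g x = cj n x"
    and u: "u \<in> G \<inter> normaliser Q"
  shows "\<exists>n\<in>G \<inter> normaliser S. \<forall>x\<in>Q. cj u x = cj n x"
proof -
  let ?N = "G \<inter> normaliser Q" and ?T = "S \<inter> normaliser Q" and ?C = "centraliser Q \<inter> (G \<inter> normaliser Q)"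
  have N: "subgrp ?N" "finite ?N" using subgrp_Int[OF G(1) subgrp_normaliser] G(2) by auto
  have T: "subgrp ?T" "?T \<subseteq> ?N" using subgrp_Int[OF S(1) subgrp_normaliser] S by auto
  obtain t where t: "card ?T = p ^ t" using prime_power_card[OF T(1) _ S(1,3) p(1)] by blast
  have C: "subgrp ?C" "?C \<subseteq> ?N" using subgrp_Int[OF subgrp_centraliser N(1)] by auto
  have NC: "?N \<subseteq> normaliser ?C" by (rule normaliser_centraliser_Int[OF N(1)]) simp
  obtain B where B: "subgrp B" "Q \<subset> B" "B \<subseteq> ?T" "?C \<inter> ?T \<subseteq> B"
    "\<And>u b. u \<in> ?N \<Longrightarrow> b \<in> B \<Longrightarrow> cj u b \<in> sprod ?C B"
    using local_extension_subgrp[OF Q indN] by blast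
  obtain c where c: "c \<in> ?C" "\<And>b. b \<in> B \<Longrightarrow> cj (u * c) b \<in> B"
    using frattini_conjugate[OF N T t p(1) indN C NC B(1,3,4) u B(5)[OF u]] by blast
  have BS: "B \<subseteq> S" using B by blast
  have "card Q < card B" using B finite_subset[OF BS finS] by (intro psubset_card_mono)
  moreover have "u * c \<in> G" using u c G by (auto intro: subgrp_mult)
  ultimately obtain n where n: "n \<in> G \<inter> normaliser S" "\<forall>x\<in>B. cj (u * c) x = cj n x"
    using IH[OF B(1) BS, of "u * c"] c(2) BS by blast
  have "cj u x = cj n x" if x: "x \<in> Q" for x
  proof -
    have "cj u x \<in> Q" using u x by (auto intro: normaliser_cj)
    then have "cj (u * c) x = cj u x" using c(1) by (simp add: cj_prod centraliser_def)
    moreover have "x \<in> B" using x B by blast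
    ultimately show ?thesis using n by simp
  qed
  then show ?thesis using n by blast
qed

text \<open>Alperin's argument: a conjugation is factored through a fully normalised conjugate of its
  domain, extending both factors to normalisers.\<close>

theorem control_of_fusion:
  assumes "subgrp P" "P \<subseteq> S" "g \<in> G" "\<And>x. x \<in> P \<Longrightarrow> cj g x \<in> S"
  shows "\<exists>n\<in>G \<inter> normaliser S. \<forall>x\<in>P. cj g x = cj n x"
  using assms
proof (induction "card S - card P" arbitrary: P g rule: less_induct)
  case less
  note P = less.prems(1,2) and g = less.prems(3) and PS = less.prems(4)
  show ?case
  proof (cases "P = S")
    case True
    then have "g \<in> normaliser S" using PS finS by (intro normaliserI) auto
    then show ?thesis using g by blast
  next
    case False
    then have PsS: "P \<subset> S" using P by blast
    have IH: "\<exists>n\<in>G \<inter> normaliser S. \<forall>x\<in>P'. cj g' x = cj n x"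
      if P': "subgrp P'" "P' \<subseteq> S" "card P < card P'" "g' \<in> G" "\<And>x. x \<in> P' \<Longrightarrow> cj g' x \<in> S" for P' g'
    proof -
      have "card P' \<le> card S" using P'(2) finS by (simp add: card_mono)
      then have "card S - card P' < card S - card P" using P'(3) by simp
      then show ?thesis using less.hyps P' by blast
    qed
    define Q where "Q = cj g ` P"
    have Q: "subgrp Q" "Q \<subseteq> S" "card Q = card P"
      using P PS by (auto simp: Q_def subgrp_cj_image card_cj_image)
    have QsS: "Q \<subset> S"
      using Q psubset_card_mono[OF finS PsS] by (metis less_irrefl psubsetI)
    define N where "N = G \<inter> normaliser Q"
    have N: "subgrp N" "finite N" "N \<subseteq> G" "N \<subseteq> normaliser Q"
      unfolding N_def using subgrp_Int[OF G(1) subgrp_normaliser] G(2) by auto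
    \<comment> \<open>R will be moved into S by some k. The normaliser in S of Q' = Q^k is then
      Sylow in N_G(Q'), so Q' is fully normalised.\<close>
    obtain R where R: "subgrp R" "R \<subseteq> N" "card R = p ^ multiplicity p (card N)"
      using sylow_exists[OF p(1) N(1,2)] by blast
    have cN: "card N \<noteq> 0" using card_subgrp_pos[OF N(1,2)] by simp
    have indR: "\<not> p dvd card N div card R"
      unfolding R(3) by (rule multiplicity_decompose[OF cN]) (use p(1) not_prime_unit in blast)
    define A1 A2 where "A1 = cj g ` (S \<inter> normaliser P)" and "A2 = S \<inter> normaliser Q"
    have SP: "subgrp (S \<inter> normaliser P)" "subgrp A2" unfolding A2_def
      using subgrp_Int[OF S(1) subgrp_normaliser] by auto
    have A1: "subgrp A1" "A1 \<subseteq> N"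
    proof -
      show "subgrp A1" unfolding A1_def by (rule subgrp_cj_image[OF SP(1)])
      show "A1 \<subseteq> N"
        unfolding A1_def N_def Q_def using g S(2) G(1) by (auto simp: normaliser_cj_image subgrp_cj)
    qed
    have A2: "A2 \<subseteq> N" "A2 \<subseteq> S" using S by (auto simp: A2_def N_def)
    obtain e1 where "card (S \<inter> normaliser P) = p ^ e1"
      using prime_power_card[OF SP(1) _ S(1,3) p(1)] by blast
    then have e1: "card A1 = p ^ e1" by (simp add: A1_def card_cj_image)
    obtain e2 where e2: "card A2 = p ^ e2"
      using prime_power_card[OF SP(2) A2(2) S(1,3) p(1)] by blast
    \<comment> \<open>With m1, m2 and k, conjugation by g m1 k on P and by m2 k on Q extends to maps
      from N_S(P) and N_S(Q) into S; these domains are larger, so induction applies.\<close>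
    obtain m1 where m1: "m1 \<in> N" "\<And>x. x \<in> A1 \<Longrightarrow> cj m1 x \<in> R"
      using sylow_conjugate[OF N(1,2) R(1,2) A1 e1 p(1) indR] by blast
    obtain m2 where m2: "m2 \<in> N" "\<And>x. x \<in> A2 \<Longrightarrow> cj m2 x \<in> R"
      using sylow_conjugate[OF N(1,2) R(1,2) SP(2) A2(1) e2 p(1) indR] by blast
    have RG: "R \<subseteq> G" using R N by blast
    obtain k where k: "k \<in> G" "\<And>x. x \<in> R \<Longrightarrow> cj k x \<in> S"
      using sylow_conjugate[OF G S(1,2) R(1) RG R(3) p(1) ind] by blast
    have QA2: "Q \<subseteq> A2" using subgrp_le_normaliser[OF Q(1)] Q(2) by (auto simp: A2_def)
    have QR: "Q \<subseteq> R"
    proof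
      fix x assume x: "x \<in> Q"
      have "inverse m2 \<in> normaliser Q" using m2(1) N by (auto intro: subgrp_inv subgrp_normaliser)
      then have "cj (inverse m2) x \<in> A2" using x QA2 normaliser_cj by blast
      then show "x \<in> R" using m2(2)[of "cj (inverse m2) x"] by simp
    qed
    define Q' where "Q' = cj k ` Q"
    have Q': "subgrp Q'" "Q' \<subseteq> S" "card Q' = card P"
      using Q QR k by (auto simp: Q'_def subgrp_cj_image card_cj_image)
    have Q's: "Q' \<subset> S"
      using Q' psubset_card_mono[OF finS PsS] by (metis less_irrefl psubsetI)
    let ?N' = "G \<inter> normaliser Q'" and ?T' = "S \<inter> normaliser Q'"
    have N': "?N' = cj k ` N"
    proof (intro equalityI subsetI)
      fix x assume "x \<in> ?N'"
      then have "cj (inverse k) x \<in> N"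
        using k(1) G(1) by (auto simp: N_def Q'_def normaliser_cj_image subgrp_cj subgrp_inv)
      then show "x \<in> cj k ` N" by (simp add: mem_cj_image)
    next
      fix x assume "x \<in> cj k ` N"
      then show "x \<in> ?N'" using k(1) G(1) by (auto simp: N_def Q'_def normaliser_cj_image subgrp_cj)
    qed
    have T': "subgrp ?T'" "?T' \<subseteq> ?N'" using subgrp_Int[OF S(1) subgrp_normaliser] S by auto
    have "cj k ` R \<subseteq> ?T'" using k(2) R(2) N' by blast
    then have le: "card R \<le> card ?T'"
      using card_mono[of ?T' "cj k ` R"] finS by (simp add: card_cj_image)
    obtain t where t: "card ?T' = p ^ t"
      using prime_power_card[OF T'(1) _ S(1,3) p(1)] by blast
    have N's: "subgrp ?N'" "finite ?N'" using subgrp_Int[OF G(1) subgrp_normaliser] G(2) by auto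
    have "p ^ t dvd card N"
      using card_subgrp_dvd[OF T'(1) N's(1) T'(2) N's(2)] t N' by (simp add: card_cj_image)
    then have "t \<le> multiplicity p (card N)"
      using cN prime_gt_1_nat[OF p(1)] by (intro multiplicity_geI) auto
    then have "p ^ t \<le> p ^ multiplicity p (card N)"
      using prime_ge_1_nat[OF p(1)] by (rule power_increasing)
    then have "card ?T' = card R" using le t R(3) by simp
    then have ind': "\<not> p dvd card ?N' div card ?T'" using indR N' by (simp add: card_cj_image)
    \<comment> \<open>The mismatch of the two factors: g = (g m1 k) u (m2 k)^-1, where u normalises
      Q' and is handled by \<open>local_control\<close>.\<close>
    define u where "u = inverse k * inverse m1 * m2 * k"
    have "inverse m1 * m2 \<in> N" using m1 m2 N(1) by (simp add: subgrp_mult subgrp_inv)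
    then have "cj k (inverse m1 * m2) \<in> ?N'" using N' by blast
    then have u: "u \<in> ?N'" by (simp add: u_def cj_def mult.assoc)
    obtain n3 where n3: "n3 \<in> G \<inter> normaliser S" "\<forall>x\<in>Q'. cj u x = cj n3 x"
      using local_control[OF Q'(1) Q's ind' _ u] IH Q'(3) by metis
    have grow: "X \<subseteq> S \<inter> normaliser X" "card X < card (S \<inter> normaliser X)" if X: "subgrp X" "X \<subset> S" for X
    proof -
      obtain x where "x \<in> S" "x \<notin> X" "x \<in> normaliser X"
        using p_group_normaliser_grows[OF X(1) S(1) X(2) S(3) p(1)] by blast
      moreover show XN: "X \<subseteq> S \<inter> normaliser X" using X subgrp_le_normaliser[OF X(1)] by blast
      ultimately have "X \<subset> S \<inter> normaliser X" by blast
      then show "card X < card (S \<inter> normaliser X)" using finS by (intro psubset_card_mono) auto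
    qed
    have mG: "g * m1 * k \<in> G" "m2 * k \<in> G" using g m1 m2 k N G by (auto intro!: subgrp_mult)
    have "cj (g * m1 * k) x \<in> S" if "x \<in> S \<inter> normaliser P" for x
      using k(2)[OF m1(2)[of "cj g x"]] that by (simp add: A1_def cj_prod)
    then obtain n1 where n1: "n1 \<in> G \<inter> normaliser S" "\<forall>x\<in>S \<inter> normaliser P. cj (g * m1 * k) x = cj n1 x"
      using IH[OF SP(1) _ grow(2)[OF P(1) PsS] mG(1)] by blast
    have "cj (m2 * k) x \<in> S" if "x \<in> A2" for x
      using k(2)[OF m2(2)[OF that]] by (simp add: cj_prod)
    moreover have "card P < card A2" using grow(2)[OF Q(1) QsS] Q(3) by (simp add: A2_def)
    ultimately obtain n2 where n2: "n2 \<in> G \<inter> normaliser S" "\<forall>x\<in>A2. cj (m2 * k) x = cj n2 x"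
      using IH[OF SP(2) A2(2) _ mG(2)] by blast
    have "cj g x = cj (n1 * n3 * inverse n2) x" if x: "x \<in> P" for x
    proof -
      define q where "q = cj g x"
      have q: "q \<in> Q" using x by (simp add: q_def Q_def)
      have "x \<in> S \<inter> normaliser P" using grow(1)[OF P(1) PsS] x by blast
      then have "cj n1 x = cj (g * m1 * k) x" using n1 by simp
      then have 1: "cj n1 x = cj k (cj m1 q)" by (simp add: cj_prod q_def)
      have "cj m1 q \<in> Q" using q m1(1) N by (auto intro: normaliser_cj)
      then have "cj n1 x \<in> Q'" using 1 by (simp add: Q'_def)
      then have "cj n3 (cj n1 x) = cj u (cj n1 x)" using n3 by simp
      also have "\<dots> = cj (m2 * k) q" by (simp add: 1 u_def cj_prod)
      also have "\<dots> = cj n2 q" using n2 q QA2 by blast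
      finally show ?thesis by (simp add: cj_prod q_def)
    qed
    moreover have "n1 * n3 * inverse n2 \<in> G \<inter> normaliser S"
      using n1 n2 n3 subgrp_Int[OF G(1) subgrp_normaliser, of S] by (intro subgrp_mult subgrp_inv)
    ultimately show ?thesis by blast
  qed
qed

end

section \<open>Invariant chains\<close>

text \<open>Multiplication by a primitive root b permutes the nonzero residues, so the sum is
  unchanged modulo \<open>p\<close> when multiplied by b^i; and b^i is not 1 modulo
  \<open>p\<close>.\<close>

lemma sum_powers_cong_0:
  fixes p i :: nat
  assumes p: "prime p" and i: "0 < i" "i < p - 1"
  shows "p dvd (\<Sum>a\<in>{1..<p}. a ^ i)"
proof -
  obtain b where b: "residue_primroot p b"
    using prime_primitive_root_exists p by (metis prime_gt_1_nat)
  have cop: "coprime p b" using b by (simp add: residue_primroot_def)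
  have pb: "\<not> p dvd b" using cop p by (metis coprime_absorb_left not_prime_unit)
  have "ord p b = p - 1" using b p by (simp add: residue_primroot_def totient_prime)
  then have "\<not> ord p b dvd i" using i by (simp add: nat_dvd_not_less)
  then have bi: "\<not> [b ^ i = 1] (mod p)" using ord_divides[of b i p] by blast
  let ?s = "\<Sum>a\<in>{1..<p}. a ^ i"
  have inj: "inj_on (\<lambda>a. b * a mod p) {1..<p}"
  proof (rule inj_onI)
    fix x y assume xy: "x \<in> {1..<p}" "y \<in> {1..<p}" "b * x mod p = b * y mod p"
    then have "[b * x = b * y] (mod p)" by (simp add: cong_def)
    then have "[x = y] (mod p)" using cop by (simp add: cong_mult_lcancel_nat coprime_commute)
    then show "x = y" using xy by (simp add: cong_def)
  qed
  have "(\<lambda>a. b * a mod p) ` {1..<p} \<subseteq> {1..<p}"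
  proof
    fix y assume "y \<in> (\<lambda>a. b * a mod p) ` {1..<p}"
    then obtain a where a: "y = b * a mod p" "a \<in> {1..<p}" by blast
    have "\<not> p dvd a" using a(2) by (auto dest: dvd_imp_le)
    then have "\<not> p dvd b * a" using pb p by (simp add: prime_dvd_mult_iff)
    then show "y \<in> {1..<p}" using a p by (simp add: dvd_eq_mod_eq_0 prime_gt_0_nat)
  qed
  then have im: "(\<lambda>a. b * a mod p) ` {1..<p} = {1..<p}"
    using inj by (intro card_subset_eq) (auto simp: card_image)
  have "b ^ i * ?s = (\<Sum>a\<in>{1..<p}. (b * a) ^ i)"
    by (simp add: sum_distrib_left power_mult_distrib)
  also have "[\<dots> = (\<Sum>a\<in>{1..<p}. (b * a mod p) ^ i)] (mod p)"
    by (intro cong_sum cong_pow) (simp add: cong_def)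
  also have "(\<Sum>a\<in>{1..<p}. (b * a mod p) ^ i) = ?s"
    using sum.reindex[OF inj, of "\<lambda>a. a ^ i"] im by simp
  finally have "[b ^ i * ?s = 1 * ?s] (mod p)" by simp
  then have "p dvd ?s \<or> [b ^ i = 1] (mod p)"
    using cong_mult_rcancel_nat[of ?s p "b ^ i" 1] p prime_imp_coprime coprime_commute by metis
  then show ?thesis using bi by simp
qed

text \<open>For \<open>g\<close> acting on an elementary abelian \<open>p\<close>-group with \<open>g\<^sup>p\<^sup>-\<^sup>1 = 1\<close>, the product of the
  \<open>(g\<^sup>i y)\<^bsup>a\<^sup>i\<^esup>\<close> over \<open>i < p - 1\<close> is an eigenvector with eigenvalue \<open>a\<^sup>-\<^sup>1\<close>, and the product of these
  over all \<open>a\<close> is \<open>y\<^sup>p\<^sup>-\<^sup>1\<close>.\<close>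

lemma eigenvector_exists:
  fixes V :: "'a::group_mult set"
  assumes p: "prime (p::nat)" and V: "subgrp V" and ab: "\<And>x y. x \<in> V \<Longrightarrow> y \<in> V \<Longrightarrow> x * y = y * x"
    and ex: "\<And>x. x \<in> V \<Longrightarrow> x ^ p = 1" and g: "\<And>x. x \<in> V \<Longrightarrow> cj g x \<in> V"
    and gp: "\<And>x. x \<in> V \<Longrightarrow> cj (g ^ (p - 1)) x = x" and y: "y \<in> V" "y \<noteq> 1"
  obtains z b where "z \<in> V" "z \<noteq> 1" "cj g z = z ^ b"
proof -
  have gV: "cj (g ^ i) x \<in> V" if x: "x \<in> V" for i x
  proof (induction i)
    case (Suc i)
    have "cj (g ^ Suc i) x = cj g (cj (g ^ i) x)" by (simp add: power_commutes flip: cj_prod)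
    then show ?case using g[OF Suc] by simp
  qed (use x in simp)
  \<comment> \<open>The product over i < n of the elements (y^(g^i))^(f i).\<close>
  define E where "E f n = rec_nat 1 (\<lambda>i z. z * cj (g ^ i) y ^ f i) n" for f :: "nat \<Rightarrow> nat" and n
  have E: "E f 0 = 1" "E f (Suc n) = E f n * cj (g ^ n) y ^ f n" for f n by (simp_all add: E_def)
  have pV: "cj (g ^ i) y ^ n \<in> V" for i n using gV[OF y(1)] V by (simp add: subgrp_power)
  have EV: "E f n \<in> V" for f n by (induction n) (use V pV in \<open>auto simp: E subgrp_one subgrp_mult\<close>)
  have Eadd: "E (\<lambda>i. f i + f' i) n = E f n * E f' n" for f f' n
  proof (induction n)
    case (Suc n)
    let ?v = "cj (g ^ n) y"
    have "E f n * E f' n * (?v ^ f n * ?v ^ f' n) = E f n * (E f' n * ?v ^ f n) * ?v ^ f' n"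
      by (simp add: mult.assoc)
    also have "E f' n * ?v ^ f n = ?v ^ f n * E f' n" using ab EV pV by blast
    finally show ?case using Suc by (simp add: E power_add mult.assoc)
  qed (simp add: E)
  define v where "v a = E (\<lambda>i. a ^ i) (p - 1)" for a
  \<comment> \<open>g moves each factor to the next, and the a-th power adjusts the exponent. The
    shifted product lacks only the factor y and gains one factor at the end.\<close>
  have eig: "cj g (E (\<lambda>i. a ^ i) n) ^ a * y = E (\<lambda>i. a ^ i) n * cj (g ^ n) y ^ (a ^ n)" for a n
  proof (induction n)
    case (Suc n)
    let ?e = "E (\<lambda>i. a ^ i) n" and ?w = "cj (g ^ n) y ^ (a ^ n)"
    have gw: "cj g ?w ^ a = cj (g ^ Suc n) y ^ (a ^ Suc n)"
    proof -
      have "cj g (cj (g ^ n) y) = cj (g ^ Suc n) y" by (simp add: power_commutes flip: cj_prod)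
      then show ?thesis by (simp add: cj_power mult.commute flip: power_mult)
    qed
    have "cj g (?e * ?w) ^ a = cj g ?e ^ a * cj g ?w ^ a"
      unfolding cj_mult using ab g EV pV by (intro commuting_power_mult) blast
    then have "cj g (?e * ?w) ^ a * y = cj g ?e ^ a * (cj g ?w ^ a * y)" by (simp add: mult.assoc)
    also have "cj g ?w ^ a * y = y * cj g ?w ^ a" unfolding gw using ab pV y by blast
    also have "cj g ?e ^ a * (y * cj g ?w ^ a) = ?e * ?w * cj g ?w ^ a" using Suc by (simp flip: mult.assoc)
    finally show ?case by (simp only: E(2) gw)
  qed (simp add: E)
  have "\<exists>a\<in>{1..<p}. v a \<noteq> 1"
  proof (rule ccontr)
    assume "\<not> (\<exists>a\<in>{1..<p}. v a \<noteq> 1)"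
    then have v1: "v a = 1" if "a \<in> {1..<p}" for a using that by blast
    have Esum: "E (\<lambda>i. \<Sum>a\<in>A. a ^ i) (p - 1) = 1" if "finite A" "A \<subseteq> {1..<p}" for A
      using that
    proof (induction A rule: finite_induct)
      case empty
      have "E (\<lambda>i. 0) n = 1" for n by (induction n) (simp_all add: E)
      then show ?case by simp
    next
      case (insert a A)
      then show ?case using v1[of a] by (simp add: Eadd) (simp add: v_def)
    qed
    \<comment> \<open>For i > 0 the exponent is a power sum divisible by \<open>p\<close>; for i = 0
      it is p - 1.\<close>
    have "E (\<lambda>i. \<Sum>a\<in>{1..<p}. a ^ i) (Suc n) = y ^ (p - 1)" if "Suc n \<le> p - 1" for n
      using that
    proof (induction n)
      case 0
      then show ?case by (simp add: E)
    next
      case (Suc n)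
      obtain t where t: "(\<Sum>a\<in>{1..<p}. a ^ Suc n) = p * t"
        using sum_powers_cong_0[OF p, of "Suc n"] Suc.prems by (auto elim: dvdE)
      have "cj (g ^ Suc n) y ^ (\<Sum>a\<in>{1..<p}. a ^ Suc n) = 1"
        unfolding t power_mult ex[OF gV[OF y(1)]] by simp
      then show ?case using Suc by (simp add: E(2)[of _ "Suc n"])
    qed
    moreover obtain n where "p - 1 = Suc n" using prime_gt_1_nat[OF p] by (cases "p - 1") auto
    ultimately have "y ^ (p - 1) = 1" using Esum[of "{1..<p}"] by simp
    moreover have "y ^ p = y * y ^ (p - 1)" using prime_gt_0_nat[OF p] by (simp flip: power_Suc)
    ultimately show False using ex[OF y(1)] y(2) by simp
  qed
  then obtain a where a: "a \<in> {1..<p}" "v a \<noteq> 1" by blast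
  have "\<not> p dvd a" using a(1) by (auto dest: dvd_imp_le)
  have ymod: "x ^ n = x" if n1: "[n = 1] (mod p)" and xV: "x \<in> V" for x n
  proof (cases "n = 0")
    case True
    then have "p dvd 1" using n1 by (simp add: cong_def)
    then show ?thesis using p by simp
  next
    case False
    obtain t where "n - 1 = p * t" using cong_to_1_nat[OF n1] by (elim dvdE)
    then have "n = 1 + p * t" using False by simp
    then show ?thesis using ex[OF xV] by (simp add: power_mult)
  qed
  have "cj g (v a) ^ a * y = v a * y"
    using eig[of a "p - 1"] gp[OF y(1)] ymod[OF fermat_theorem[OF p \<open>\<not> p dvd a\<close>] y(1)] by (simp add: v_def)
  then have va: "cj g (v a) ^ a = v a" by simp
  have "coprime a p" using \<open>\<not> p dvd a\<close> p prime_imp_coprime coprime_commute by metis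
  \<comment> \<open>The a-th power of (v a)^g is v a; the inverse b of a modulo \<open>p\<close>
    turns this into (v a)^g = (v a)^b.\<close>
  then obtain b where b: "[a * b = 1] (mod p)" using cong_solve_coprime_nat[of a p] by auto
  have "cj g (v a) = cj g (v a) ^ (a * b)" using ymod[OF b g] EV by (simp add: v_def)
  also have "\<dots> = v a ^ b" by (simp add: power_mult va)
  finally show thesis using that[of "v a" b] a(2) EV by (simp add: v_def)
qed

context sylow_semi_invariant
begin

text \<open>Take L minimal among the N-invariant subgroups above M on which S acts trivially modulo
  M, where N = N_G(S). Then N acts on L/M through commuting maps of order dividing p - 1, and L/M is
  elementary abelian by minimality. So each u in N has an eigenvector, its eigenspace is N-invariant
  and hence everything, and every subgroup between M and L is N-invariant.\<close>

lemma chain_step: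
  assumes M: "subgrp M" "M \<subset> S" "G \<inter> normaliser S \<subseteq> normaliser M"
  obtains L where "subgrp L" "M \<subseteq> L" "L \<subseteq> S" "card L = p * card M" "G \<inter> normaliser S \<subseteq> normaliser L"
proof -
  define N where "N = G \<inter> normaliser S"
  have SS: "S \<subseteq> normaliser S" by (rule subgrp_le_normaliser[OF S(1)])
  have N: "subgrp N" "finite N" "N \<subseteq> normaliser S" "S \<subseteq> N" "N \<subseteq> G" "N \<subseteq> normaliser M"
    unfolding N_def using subgrp_Int[OF G(1) subgrp_normaliser] G(2) SS S M by auto
  have MS: "M \<subseteq> S" "S \<subseteq> normaliser M" using M N by auto
  have finM: "finite M" using MS finS finite_subset by blast
  interpret iv: invariant_subgroups S N p m d
  proof
    show "N \<subseteq> normaliser H" if "subgrp H" "H \<subseteq> S" "card H = p ^ d" for H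
      using inv[OF that(1) S(1) that(2) subset_refl that(3)] by (simp add: N_def)
    show "x * y = y * x" if "subgrp H" "H \<subseteq> S" "card H = p ^ d" "x \<in> H" "y \<in> H" for H x y
      using ab[OF that] .
  qed (use p N S d in auto)
  have "card S dvd card N" by (rule card_subgrp_dvd[OF S(1) N(1,4,2)])
  then obtain j where j: "card N = card S * j" by (elim dvdE)
  obtain i where i: "card G = card N * i" using card_subgrp_dvd[OF N(1) G(1) N(5) G(2)] by (elim dvdE)
  have posS: "card S > 0" by (rule card_subgrp_pos[OF S(1) finS])
  have "card G div card S = j * i" using i j posS by (simp add: mult.assoc)
  then have indN: "\<not> p dvd card N div card S" using ind j posS by auto
  define C where "C = centraliser S \<inter> N"
  note cap = iv.commutators_and_powers[OF S(1) N(4) indN, folded C_def]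
  define F where "F = {x \<in> S. \<forall>s\<in>S. x \<in> fixmod M s}"
  have F: "subgrp F" "F \<subseteq> S"
    using subgrp_fixmod[OF M(1)] S(1) by (auto simp: F_def subgrp_def)
  have MF: "M \<subseteq> F" using fixmod_sub[OF M(1)] MS by (auto simp: F_def)
  have Fcm: "cm x s \<in> M" if "x \<in> F" "s \<in> S" for x s using that by (auto simp: F_def fixmod_def)
  obtain x0 where x0: "x0 \<in> S" "x0 \<notin> M" "\<And>s. s \<in> S \<Longrightarrow> cm x0 s \<in> M"
    using p_group_central_step[OF M(1) S(1) M(2) S(3) MS(2) S(1,3) MS(2) SS p(1)] by metis
  have "x0 \<in> F" using x0 MS by (auto simp: F_def fixmod_def)
  have FN: "N \<subseteq> normaliser F"
  proof
    fix u assume u: "u \<in> N"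
    have ui: "inverse u \<in> N" using u N(1) by (simp add: subgrp_inv)
    show "u \<in> normaliser F"
    proof (rule normaliserI)
      show "finite F" using F finS finite_subset by blast
      fix x assume x: "x \<in> F"
      have ux: "cj u x \<in> S" using x F u N(3) by (blast intro: normaliser_cj)
      have "cm (cj u x) s \<in> M" if s: "s \<in> S" for s
      proof -
        have "cj (inverse u) s \<in> S" using s ui N(3) by (blast intro: normaliser_cj)
        then have "cj u (cm x (cj (inverse u) s)) \<in> M"
          using Fcm[OF x] u N(6) by (blast intro: normaliser_cj)
        then show ?thesis by (simp add: cm_def cj_mult cj_inverse cj_cj[of u "cj (inverse u) s"])
      qed
      then show "cj u x \<in> F" using ux MS by (auto simp: F_def fixmod_def)
    qed
  qed
  \<comment> \<open>Staying inside F guarantees that S acts trivially on L/M; F itself is a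
    candidate because \<open>x0\<close> lies in it.\<close>
  define \<L> where "\<L> = {L. subgrp L \<and> M \<subset> L \<and> L \<subseteq> F \<and> N \<subseteq> normaliser L}"
  have "F \<in> \<L>" using F MF FN \<open>x0 \<in> F\<close> x0(2) by (auto simp: \<L>_def)
  then obtain L where L: "L \<in> \<L>" "\<And>L'. L' \<in> \<L> \<Longrightarrow> card L \<le> card L'"
    using ex_has_least_nat[of "\<lambda>L. L \<in> \<L>" F card] by blast
  have L': "subgrp L" "M \<subset> L" "L \<subseteq> F" "N \<subseteq> normaliser L" using L(1) by (auto simp: \<L>_def)
  have LS: "L \<subseteq> S" using L' F by blast
  have finL: "finite L" using LS finS finite_subset by blast
  have minimal: "L1 = L" if "subgrp L1" "M \<subseteq> L1" "L1 \<subseteq> L" "L1 \<noteq> M" "N \<subseteq> normaliser L1" for L1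
  proof -
    have "L1 \<in> \<L>" using that L' by (auto simp: \<L>_def)
    then have "card L \<le> card L1" by (rule L(2))
    then show ?thesis using that(3) finL by (meson card_seteq)
  qed
  have LM: "L \<subseteq> normaliser M" using LS MS by blast
  define \<pi> where "\<pi> = quo M"
  have NM: "u \<in> normaliser M" if "u \<in> N" for u using that N by blast
  have Ln: "x \<in> normaliser M" if "x \<in> L" for x using that LM by blast
  have \<pi>1: "\<pi> x = 1 \<longleftrightarrow> x \<in> M" if "x \<in> normaliser M" for x
    unfolding \<pi>_def by (rule quo_eq_1_iff[OF M(1) that])
  have \<pi>m: "\<pi> (x * y) = \<pi> x * \<pi> y" if "x \<in> normaliser M" "y \<in> normaliser M" for x y
    unfolding \<pi>_def by (rule quo_mult[OF that])
  have \<pi>i: "\<pi> (inverse x) = inverse (\<pi> x)" if "x \<in> normaliser M" for x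
    unfolding \<pi>_def by (rule quo_inverse[OF that])
  have \<pi>p: "\<pi> (x ^ n) = \<pi> x ^ n" if "x \<in> normaliser M" for x n
    unfolding \<pi>_def by (rule quo_power[OF that])
  have \<pi>c: "\<pi> (cj u x) = cj (\<pi> u) (\<pi> x)" if "u \<in> normaliser M" "x \<in> normaliser M" for u x
    unfolding \<pi>_def by (rule quo_cj[OF that])
  have uL: "cj u x \<in> L" if "u \<in> N" "x \<in> L" for u x using that L' by (blast intro: normaliser_cj)
  have trivS: "\<pi> (cj s x) = \<pi> x" if "s \<in> S" "x \<in> L" for s x
  proof -
    have "cm x s \<in> M" using Fcm that L' by blast
    then show ?thesis
      unfolding \<pi>_def using cm_mem_iff_quo[OF M(1)] that Ln MS by blast
  qed
  \<comment> \<open>By \<open>cap\<close>, commutators and (p-1)-th powers of N lie in CS and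
    therefore act trivially on L/M.\<close>
  have triv: "\<pi> (cj h x) = \<pi> x" if h: "h \<in> sprod C S" and x: "x \<in> L" for h x
  proof -
    obtain c s where cs: "h = c * s" "c \<in> C" "s \<in> S" using h by (rule sprodE)
    have "cj c x = x" using cs x LS by (auto simp: C_def centraliser_def)
    then show ?thesis using trivS[OF cs(3) x] by (simp add: cs(1) cj_prod)
  qed
  have comm: "\<pi> x * \<pi> y = \<pi> y * \<pi> x" if "x \<in> L" "y \<in> L" for x y
  proof -
    have "cj (\<pi> y) (\<pi> x) = \<pi> x" using trivS[of y x] \<pi>c[of y x] that Ln LS by auto
    then show ?thesis by (simp add: cj_eq_self_iff)
  qed
  have swap: "\<pi> (cj v (cj u x)) = \<pi> (cj u (cj v x))" if u: "u \<in> N" and v: "v \<in> N" and x: "x \<in> L" for u v x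
  proof -
    have e: "cj v (cj u x) = cj (cm u v) (cj u (cj v x))"
    proof -
      have "v * u * cm u v = u * v" by (simp add: cm_def cj_def mult.assoc)
      then show ?thesis by (metis cj_prod)
    qed
    show ?thesis unfolding e by (rule triv[OF cap(1)[OF u v] uL[OF u uL[OF v x]]])
  qed
  obtain f where fL: "card L = p ^ f" using prime_power_card[OF L'(1) LS S(1,3) p(1)] by blast
  \<comment> \<open>The elements of order dividing \<open>p\<close> in the abelian group L/M; by
    minimality this is all of L.\<close>
  define L1 where "L1 = {x \<in> L. x ^ p \<in> M}"
  have L1mem: "x \<in> L1 \<longleftrightarrow> x \<in> L \<and> \<pi> x ^ p = 1" for x
    using \<pi>1[of "x ^ p"] \<pi>p[of x p] Ln[of x] subgrp_power[OF subgrp_normaliser, of x M p]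
    by (auto simp: L1_def)
  have "L1 = L"
  proof (rule minimal)
    show "subgrp L1"
      unfolding subgrp_def
    proof (intro conjI ballI)
      show "1 \<in> L1" using L' M by (simp add: L1_def subgrp_one)
      fix x assume x: "x \<in> L1"
      then show "inverse x \<in> L1"
        using L' Ln \<pi>i by (auto simp: L1mem subgrp_inv simp flip: inv_power)
      fix y assume y: "y \<in> L1"
      have "\<pi> (x * y) ^ p = \<pi> x ^ p * \<pi> y ^ p"
        using x y comm Ln by (simp add: \<pi>m L1mem commuting_power_mult)
      then show "x * y \<in> L1" using x y L' by (simp add: L1mem subgrp_mult)
    qed
    show "M \<subseteq> L1" using L' M by (auto simp: L1_def subgrp_power)
    obtain z where "z \<in> L" "z \<notin> M" "z ^ p \<in> M"
      using p_group_central_step[OF M(1) L'(1,2) fL LM L'(1) fL LM subgrp_le_normaliser[OF L'(1)] p(1)] by metis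
    then show "L1 \<noteq> M" by (auto simp: L1_def)
    show "N \<subseteq> normaliser L1"
    proof
      fix u assume u: "u \<in> N"
      show "u \<in> normaliser L1"
      proof (rule normaliserI)
        show "finite L1" using finL by (simp add: L1_def)
        fix x assume "x \<in> L1"
        then show "cj u x \<in> L1"
          using uL[OF u] NM[OF u] by (auto simp: L1_def normaliser_cj simp flip: cj_power)
      qed
    qed
  qed (auto simp: L1_def)
  then have exp: "\<pi> x ^ p = 1" if "x \<in> L" for x using that L1mem by blast
  have power: "\<exists>b. \<forall>x\<in>L. \<pi> (cj u x) = \<pi> x ^ b" if u: "u \<in> N" for u
  proof -
    define V where "V = \<pi> ` L"
    have V: "subgrp V" unfolding V_def \<pi>_def by (rule subgrp_quo_image[OF L'(1) LM])
    obtain y where y: "y \<in> L" "y \<notin> M" using L' by blast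
    obtain z b where z: "z \<in> V" "z \<noteq> 1" "cj (\<pi> u) z = z ^ b"
    proof (rule eigenvector_exists[OF p(1) V, of "\<pi> u" "\<pi> y"])
      show "x * y = y * x" if "x \<in> V" "y \<in> V" for x y using that comm by (auto simp: V_def)
      show "x ^ p = 1" if "x \<in> V" for x using that exp by (auto simp: V_def)
      show "cj (\<pi> u) x \<in> V" if "x \<in> V" for x
        using that uL[OF u] \<pi>c[OF NM[OF u] Ln] by (auto simp: V_def simp flip: \<pi>c[OF NM[OF u] Ln])
      show "cj (\<pi> u ^ (p - 1)) x = x" if x: "x \<in> V" for x
      proof -
        obtain w where w: "x = \<pi> w" "w \<in> L" using x by (auto simp: V_def)
        have "cj (\<pi> u ^ (p - 1)) x = \<pi> (cj (u ^ (p - 1)) w)"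
          using \<pi>c[OF subgrp_power[OF subgrp_normaliser NM[OF u]] Ln[OF w(2)]] \<pi>p[OF NM[OF u]] w by simp
        then show ?thesis using triv[OF cap(2)[OF u u] w(2)] w by simp
      qed
      show "\<pi> y \<in> V" using y by (simp add: V_def)
      show "\<pi> y \<noteq> 1" using y \<pi>1[OF Ln] by simp
    qed
    \<comment> \<open>An eigenspace of u on L/M. It is nontrivial, and N preserves it because the
      actions of N on L/M commute.\<close>
    define L2 where "L2 = {x \<in> L. \<pi> (cj u x) = \<pi> x ^ b}"
    have un: "cj u x \<in> normaliser M" if "x \<in> L" for x using uL[OF u that] Ln by blast
    have "L2 = L"
    proof (rule minimal)
      show "subgrp L2"
        unfolding subgrp_def
      proof (intro conjI ballI)
        have "\<pi> 1 = 1" by (simp add: \<pi>_def)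
        then show "1 \<in> L2" using L' by (simp add: L2_def subgrp_one)
        fix x assume x: "x \<in> L2"
        then have "\<pi> (cj u (inverse x)) = \<pi> (inverse x) ^ b"
          using \<pi>i Ln un by (simp add: L2_def cj_inverse inv_power)
        then show "inverse x \<in> L2" using x L' by (simp add: L2_def subgrp_inv)
        fix y assume y: "y \<in> L2"
        have "\<pi> (cj u (x * y)) = \<pi> (x * y) ^ b"
          using x y comm Ln un by (simp add: L2_def cj_mult \<pi>m commuting_power_mult)
        then show "x * y \<in> L2" using x y L' by (simp add: L2_def subgrp_mult)
      qed
      show "M \<subseteq> L2"
      proof
        fix x assume x: "x \<in> M"
        then have "cj u x \<in> M" using NM[OF u] by (simp add: normaliser_cj)
        moreover have xL: "x \<in> L" using x L' by blast
        ultimately have "\<pi> (cj u x) = 1" "\<pi> x = 1" using x \<pi>1[OF Ln[OF xL]] \<pi>1[OF un[OF xL]] by auto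
        then show "x \<in> L2" using xL by (simp add: L2_def)
      qed
      obtain w where w: "z = \<pi> w" "w \<in> L" using z by (auto simp: V_def)
      have "w \<in> L2" using w z \<pi>c[OF NM[OF u] Ln[OF w(2)]] by (simp add: L2_def)
      moreover have "w \<notin> M" using z w \<pi>1[OF Ln[OF w(2)]] by simp
      ultimately show "L2 \<noteq> M" by blast
      show "N \<subseteq> normaliser L2"
      proof
        fix v assume v: "v \<in> N"
        show "v \<in> normaliser L2"
        proof (rule normaliserI)
          show "finite L2" using finL by (simp add: L2_def)
          fix x assume x: "x \<in> L2"
          then have xL: "x \<in> L" by (simp add: L2_def)
          have "\<pi> (cj u (cj v x)) = \<pi> (cj v (cj u x))" by (rule swap[OF v u xL])
          also have "\<dots> = cj (\<pi> v) (\<pi> (cj u x))" by (rule \<pi>c[OF NM[OF v] un[OF xL]])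
          also have "\<dots> = \<pi> (cj v x) ^ b" using x \<pi>c[OF NM[OF v] Ln[OF xL]] by (simp add: L2_def cj_power)
          finally show "cj v x \<in> L2" using uL[OF v xL] by (simp add: L2_def)
        qed
      qed
    qed (auto simp: L2_def)
    then show ?thesis by (auto simp: L2_def)
  qed
  \<comment> \<open>Since each element of N acts on L/M as a power map, any y in L outside M gives
    an invariant M<y>.\<close>
  obtain y where y: "y \<in> L" "y \<notin> M" using L' by blast
  have yp: "y ^ p \<in> M" using y \<open>L1 = L\<close> by (auto simp: L1_def)
  have sub: "subgrp (adj M y)" by (rule subgrp_adj[OF M(1) Ln[OF y(1)] yp prime_gt_0_nat[OF p(1)]])
  have le: "adj M y \<subseteq> S" using MS y LS by (intro adj_subset S) auto
  have "N \<subseteq> normaliser (adj M y)"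
  proof
    fix u assume u: "u \<in> N"
    obtain b where b: "\<And>x. x \<in> L \<Longrightarrow> \<pi> (cj u x) = \<pi> x ^ b" using power[OF u] by blast
    show "u \<in> normaliser (adj M y)"
    proof (rule normaliserI)
      show "finite (adj M y)" using le finS finite_subset by blast
      fix x assume "x \<in> adj M y"
      then obtain a i where x: "x = a * y ^ i" "a \<in> M" by (rule adjE)
      have yb: "y ^ b \<in> normaliser M" "cj u y \<in> normaliser M"
        using Ln y uL[OF u] subgrp_power[OF subgrp_normaliser] by blast+
      have "\<pi> (y ^ b) = \<pi> (cj u y)" using b[OF y(1)] \<pi>p[OF Ln[OF y(1)]] by simp
      then have "inverse (y ^ b) * cj u y \<in> M"
        using quo_eq_iff[OF M(1) yb] by (simp add: \<pi>_def)
      then have "y ^ b * (inverse (y ^ b) * cj u y) \<in> adj M y"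
        using adj_sub[of M y] adj_mem[OF M(1), of y]
        by (intro subgrp_mult[OF sub subgrp_power[OF sub]]) auto
      then have "cj u y \<in> adj M y" by simp
      moreover have "cj u a \<in> adj M y" using x NM[OF u] adj_sub[of M y] normaliser_cj by blast
      ultimately show "cj u x \<in> adj M y" using sub by (simp add: x(1) cj_mult cj_power subgrp_mult subgrp_power)
    qed
  qed
  then show thesis
    using that[OF sub adj_sub le card_adj_prime[OF M(1) finM p(1) yp y(2)]] by (simp add: N_def)
qed

lemma invariant_chain:
  "\<exists>T. T 0 = {1} \<and> (\<forall>i\<le>m. subgrp (T i) \<and> T i \<subseteq> S \<and> card (T i) = p ^ i \<and> G \<inter> normaliser S \<subseteq> normaliser (T i)) \<and>
    (\<forall>i<m. T i \<subseteq> T (Suc i))"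
proof -
  \<comment> \<open>Dependent choice produces a sequence over all naturals, so the requirements are
    made void beyond m; the second conjunct fixes the start.\<close>
  define P where "P i L \<longleftrightarrow> (i \<le> m \<longrightarrow> subgrp L \<and> L \<subseteq> S \<and> card L = p ^ i \<and> G \<inter> normaliser S \<subseteq> normaliser L) \<and> (i = 0 \<longrightarrow> L = {1})"
    for i and L :: "'a set"
  define R where "R i L L' \<longleftrightarrow> (i < m \<longrightarrow> L \<subseteq> L')" for i and L L' :: "'a set"
  have "\<exists>T. \<forall>i. P i (T i) \<and> R i (T i) (T (Suc i))"
  proof (rule dependent_nat_choice)
    show "\<exists>L. P 0 L" using S by (auto simp: P_def subgrp_trivial subgrp_one normaliser_trivial)
    fix L i assume L: "P i L"
    show "\<exists>L'. P (Suc i) L' \<and> R i L L'"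
    proof (cases "i < m")
      case True
      then have L': "subgrp L" "L \<subseteq> S" "card L = p ^ i" "G \<inter> normaliser S \<subseteq> normaliser L" using L by (auto simp: P_def)
      have "L \<noteq> S" using True L'(3) S(3) prime_gt_1_nat[OF p(1)] by auto
      then obtain L2 where "subgrp L2" "L \<subseteq> L2" "L2 \<subseteq> S" "card L2 = p * card L" "G \<inter> normaliser S \<subseteq> normaliser L2"
        using chain_step[OF L'(1) _ L'(4)] L'(2) by blast
      then show ?thesis using L'(3) by (intro exI[of _ L2]) (auto simp: P_def R_def)
    qed (auto simp: P_def R_def)
  qed
  then obtain T where "\<forall>i. P i (T i) \<and> R i (T i) (T (Suc i))" by blast
  then show ?thesis by (intro exI[of _ T]) (auto simp: P_def R_def)
qed

end

section \<open>Transfer to HOL-Algebra groups\<close>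

text \<open>Cayley's representation, extended by the identity outside the carrier to give a
  bijection of the whole type.\<close>

definition left_mult :: "('a, 'b) monoid_scheme \<Rightarrow> 'a \<Rightarrow> 'a bijection" where
  "left_mult G g = Abs_bijection (\<lambda>x. if x \<in> carrier G then g \<otimes>\<^bsub>G\<^esub> x else x)"

section \<open>The embedding preserves products, conjugation and subgroups\<close>

context group
begin

lemma bij_left_mult:
  assumes g: "g \<in> carrier G"
  shows "bij (\<lambda>x. if x \<in> carrier G then g \<otimes> x else x)"
proof (rule o_bij)
  show "(\<lambda>x. if x \<in> carrier G then inv g \<otimes> x else x) \<circ> (\<lambda>x. if x \<in> carrier G then g \<otimes> x else x) = id"
    using g by (auto simp: fun_eq_iff m_assoc[symmetric])
  show "(\<lambda>x. if x \<in> carrier G then g \<otimes> x else x) \<circ> (\<lambda>x. if x \<in> carrier G then inv g \<otimes> x else x) = id"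
    using g by (auto simp: fun_eq_iff m_assoc[symmetric])
qed

lemma left_mult_mult:
  assumes "g \<in> carrier G" "h \<in> carrier G"
  shows "left_mult G (g \<otimes> h) = left_mult G g * left_mult G h"
proof -
  have "(\<lambda>x. if x \<in> carrier G then g \<otimes> h \<otimes> x else x) =
    (\<lambda>x. if x \<in> carrier G then g \<otimes> x else x) \<circ> (\<lambda>x. if x \<in> carrier G then h \<otimes> x else x)"
    using assms by (auto simp: fun_eq_iff m_assoc)
  then show ?thesis
    using assms by (simp add: left_mult_def times_bijection.abs_eq eq_onp_def bij_left_mult)
qed

lemma left_mult_inj: "inj_on (left_mult G) (carrier G)"
proof (rule inj_onI)
  fix g h assume gh: "g \<in> carrier G" "h \<in> carrier G" "left_mult G g = left_mult G h"
  then have "(\<lambda>x. if x \<in> carrier G then g \<otimes> x else x) = (\<lambda>x. if x \<in> carrier G then h \<otimes> x else x)"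
    by (simp add: left_mult_def Abs_bijection_inject bij_left_mult)
  from fun_cong[OF this, of \<one>] show "g = h" using gh by simp
qed

lemma left_mult_one: "left_mult G \<one> = 1"
proof -
  have "(\<lambda>x. if x \<in> carrier G then \<one> \<otimes> x else x) = id" by (auto simp: fun_eq_iff)
  then show ?thesis by (simp add: left_mult_def one_bijection_def)
qed

lemma left_mult_inv: "g \<in> carrier G \<Longrightarrow> left_mult G (inv g) = inverse (left_mult G g)"
proof -
  assume g: "g \<in> carrier G"
  have "left_mult G g * left_mult G (inv g) = 1"
    using left_mult_mult[OF g inv_closed[OF g]] g by (simp add: left_mult_one)
  then show ?thesis by (rule mult_eq_1_imp_inverse[symmetric])
qed

lemma left_mult_cj:
  "g \<in> carrier G \<Longrightarrow> x \<in> carrier G \<Longrightarrow> cj (left_mult G g) (left_mult G x) = left_mult G (inv g \<otimes> x \<otimes> g)"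
  by (simp add: cj_def left_mult_mult left_mult_inv)

lemma subgrp_left_mult_image:
  assumes H: "subgroup H G"
  shows "subgrp (left_mult G ` H)"
  unfolding subgrp_def
proof (intro conjI ballI)
  have Hc: "x \<in> carrier G" if "x \<in> H" for x using subgroup.mem_carrier[OF H that] .
  show "1 \<in> left_mult G ` H"
    using subgroup.one_closed[OF H] by (intro image_eqI[of _ _ \<one>]) (simp_all add: left_mult_one)
  fix x assume "x \<in> left_mult G ` H"
  then obtain a where a: "x = left_mult G a" "a \<in> H" by blast
  show "inverse x \<in> left_mult G ` H"
    using a Hc subgroup.m_inv_closed[OF H] by (intro image_eqI[of _ _ "inv a"]) (simp_all add: left_mult_inv)
  fix y assume "y \<in> left_mult G ` H"
  then obtain b where b: "y = left_mult G b" "b \<in> H" by blast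
  show "x * y \<in> left_mult G ` H"
    using a b Hc subgroup.m_closed[OF H] by (intro image_eqI[of _ _ "a \<otimes> b"]) (simp_all add: left_mult_mult)
qed

lemma subgroup_of_left_mult_image:
  assumes H: "H \<subseteq> carrier G" "subgrp (left_mult G ` H)"
  shows "subgroup H G"
proof
  have mem: "x \<in> H" if "left_mult G x \<in> left_mult G ` H" "x \<in> carrier G" for x
    using that H inj_on_image_mem_iff[OF left_mult_inj that(2) H(1)] by blast
  show "H \<subseteq> carrier G" by fact
  show "\<one> \<in> H" by (rule mem) (simp_all add: left_mult_one subgrp_one[OF H(2)])
  show "x \<otimes> y \<in> H" if "x \<in> H" "y \<in> H" for x y
  proof (rule mem)
    have "left_mult G x * left_mult G y \<in> left_mult G ` H"
      using that by (intro subgrp_mult[OF H(2)]) auto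
    then show "left_mult G (x \<otimes> y) \<in> left_mult G ` H" "x \<otimes> y \<in> carrier G"
      using that H(1) by (auto simp: left_mult_mult subset_iff)
  qed
  show "inv x \<in> H" if "x \<in> H" for x
  proof (rule mem)
    have "inverse (left_mult G x) \<in> left_mult G ` H"
      using that by (intro subgrp_inv[OF H(2)]) auto
    then show "left_mult G (inv x) \<in> left_mult G ` H" "inv x \<in> carrier G"
      using that H(1) by (auto simp: left_mult_inv subset_iff)
  qed
qed

lemma subgroup_restrict_iff:
  assumes S: "subgroup S G"
  shows "subgroup H (G\<lparr>carrier := S\<rparr>) \<longleftrightarrow> subgroup H G \<and> H \<subseteq> S"
proof
  assume H: "subgroup H (G\<lparr>carrier := S\<rparr>)"
  then have "H \<subseteq> S" using subgroup.subset by fastforce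
  then show "subgroup H G \<and> H \<subseteq> S" using incl_subgroup[OF S H] by simp
next
  assume "subgroup H G \<and> H \<subseteq> S"
  then show "subgroup H (G\<lparr>carrier := S\<rparr>)" using subgroup_incl[OF _ S] by blast
qed

lemma cyclic_group_of_prime_order:
  assumes "prime (order G)"
  shows "cyclic_group G"
proof -
  have fin: "finite (carrier G)"
    using assms by (metis card.infinite not_prime_0 order_def)
  have "carrier G \<noteq> {\<one>}" using assms by (auto simp: order_def)
  then obtain x where x: "x \<in> carrier G" "x \<noteq> \<one>" using one_closed by blast
  have gen: "subgroup (generate G {x}) G" using x by (intro generate_is_subgroup) auto
  have "card (generate G {x}) dvd order G"
    using lagrange_finite[OF fin gen] by (metis dvd_triv_right)
  then have "card (generate G {x}) = 1 \<or> card (generate G {x}) = order G"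
    using assms by (simp add: prime_nat_iff)
  moreover have "card (generate G {x}) \<noteq> 1"
  proof
    assume "card (generate G {x}) = 1"
    then obtain y where "generate G {x} = {y}" by (rule card_1_singletonE)
    moreover have "x \<in> generate G {x}" "\<one> \<in> generate G {x}" by (auto intro: generate.incl generate.one)
    ultimately show False using x by auto
  qed
  ultimately have "generate G {x} = carrier G"
    using card_subset_eq[OF fin subgroup.subset[OF gen]] by (simp add: order_def)
  then have "subgroup_generated G {x} = G" using x by (simp add: subgroup_generated_def)
  then show ?thesis using x by (auto simp: cyclic_group_def)
qed

end

section \<open>Supersolvability from control of fusion and the invariant chain\<close>

theorem theorem4p3:
  fixes G :: "('a, 'b) monoid_scheme" and p :: nat and S D :: "'a set"
  assumes "group G" and "finite (carrier G)"
    and "prime p" and "odd p"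
    and "sylow_subgroup p G S"
    and "subgroup D (G\<lparr>carrier := S\<rparr>)" and "1 < card D" and "card D < card S"
    and "\<And>H. subgroup H (G\<lparr>carrier := S\<rparr>) \<Longrightarrow> card H = card D \<Longrightarrow>
           comm_group (G\<lparr>carrier := H\<rparr>) \<and>
           semi_invariant (G\<lparr>carrier := S\<rparr>) (fusion_of G S) H"
  shows "supersolvable_fusion (G\<lparr>carrier := S\<rparr>) (fusion_of G S)"
proof -
  interpret group G by fact
  note fin = assms(2) and p = assms(3,4) and hyp = assms(9)
  have S: "subgroup S G" "card S = p ^ multiplicity p (order G)"
    using assms(5) by (simp_all add: sylow_subgroup_def)
  have SG: "S \<subseteq> carrier G" using subgroup.subset[OF S(1)] .
  have sub: "subgroup H (G\<lparr>carrier := S\<rparr>) \<longleftrightarrow> subgroup H G \<and> H \<subseteq> S" for H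
    by (rule subgroup_restrict_iff[OF S(1)])
  have D: "subgroup D G" "D \<subseteq> S" using assms(6) sub by auto
  define m where "m = multiplicity p (order G)"
  define \<iota> where "\<iota> = left_mult G"
  define G' where "G' = \<iota> ` carrier G"
  define S' where "S' = \<iota> ` S"
  have inj: "inj_on \<iota> (carrier G)" by (simp add: \<iota>_def left_mult_inj)
  have card\<iota>: "card (\<iota> ` H) = card H" if "H \<subseteq> carrier G" for H
    using inj_on_subset[OF inj that] by (rule card_image)
  have G': "subgrp G'" "finite G'" "card G' = order G"
    using fin card\<iota>[OF subset_refl] subgrp_left_mult_image[OF subgroup_self]
    by (simp_all add: G'_def \<iota>_def order_def)
  have S': "subgrp S'" "S' \<subseteq> G'" "card S' = p ^ m"
    using subgrp_left_mult_image[OF S(1)] SG card\<iota>[OF SG] S(2)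
    by (auto simp: S'_def G'_def \<iota>_def m_def)
  have finS: "finite S" using SG fin finite_subset by blast
  have oG: "order G \<noteq> 0" using fin by (simp add: order_gt_0_iff_finite)
  have "card D dvd p ^ m"
    using card_subgrp_dvd[OF subgrp_left_mult_image[OF D(1)] S'(1)] D(2) SG finS card\<iota>[of D] S'(3)
    by (simp add: S'_def \<iota>_def image_mono)
  then obtain d where d: "card D = p ^ d" using p(1) by (metis divides_primepow_nat)
  have d0: "0 < d" using assms(7) d by (cases d) auto
  have dm: "d < m"
    using assms(8) d S(2) prime_gt_1_nat[OF p(1)] by (simp add: m_def power_strict_increasing_iff)
  \<comment> \<open>The hypotheses speak of subgroups of S, so subgroups of S' are pulled back along
    \<iota>.\<close>
  define pre where "pre H = {x \<in> S. \<iota> x \<in> H}" for H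
  have pre: "\<iota> ` pre H = H" if "H \<subseteq> S'" for H
    using that by (auto simp: pre_def S'_def)
  have preS: "pre H \<subseteq> S" for H by (auto simp: pre_def)
  have pre_sub: "subgroup (pre H) G" if "subgrp H" "H \<subseteq> S'" for H
    using subgroup_of_left_mult_image[of "pre H"] preS[of H] SG pre[OF that(2)] that(1) by (auto simp: \<iota>_def)
  have pre_card: "card (pre H) = card H" if "H \<subseteq> S'" for H
    using card\<iota>[of "pre H"] preS[of H] SG pre[OF that] by auto
  have pre_hyp: "comm_group (G\<lparr>carrier := pre H\<rparr>)" "semi_invariant (G\<lparr>carrier := S\<rparr>) (fusion_of G S) (pre H)"
    if "subgrp H" "H \<subseteq> S'" "card H = p ^ d" for H
    using hyp[of "pre H"] sub preS pre_sub[OF that(1,2)] pre_card[OF that(2)] that(3) d by auto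
  have cj\<iota>: "cj (\<iota> g) (\<iota> x) = \<iota> (inv\<^bsub>G\<^esub> g \<otimes>\<^bsub>G\<^esub> x \<otimes>\<^bsub>G\<^esub> g)" if "g \<in> carrier G" "x \<in> carrier G" for g x
    using left_mult_cj[OF that] by (simp add: \<iota>_def)
  interpret fus: sylow_semi_invariant G' S' p m d
  proof
    show "\<not> p dvd card G' div card S'"
      unfolding S'(3) G'(3) m_def
      by (rule multiplicity_decompose[OF oG]) (use p(1) not_prime_unit in blast)
    show "x * y = y * x" if H: "subgrp H" "H \<subseteq> S'" "card H = p ^ d" "x \<in> H" "y \<in> H" for H x y
    proof -
      interpret c: comm_group "G\<lparr>carrier := pre H\<rparr>" by (rule pre_hyp[OF H(1-3)])
      obtain a where a: "x = \<iota> a" "a \<in> pre H" using H(4) pre[OF H(2)] by blast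
      obtain b where b: "y = \<iota> b" "b \<in> pre H" using H(5) pre[OF H(2)] by blast
      have "a \<otimes>\<^bsub>G\<^esub> b = b \<otimes>\<^bsub>G\<^esub> a" using c.m_comm[of a b] a b by simp
      then show ?thesis using a b preS[of H] SG left_mult_mult[of a b] left_mult_mult[of b a]
        by (auto simp: \<iota>_def subset_iff)
    qed
    show "G' \<inter> normaliser K \<subseteq> normaliser H"
      if H: "subgrp H" "subgrp K" "H \<subseteq> K" "K \<subseteq> S'" "card H = p ^ d" for H K
    proof
      fix g' assume g': "g' \<in> G' \<inter> normaliser K"
      then obtain g where g: "g' = \<iota> g" "g \<in> carrier G" by (auto simp: G'_def)
      have HS: "H \<subseteq> S'" using H by blast
      have K: "subgroup (pre K) (G\<lparr>carrier := S\<rparr>)" using pre_sub[OF H(2,4)] preS sub by blast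
      have KG: "pre K \<subseteq> carrier G" using preS SG by blast
      have conj: "inv\<^bsub>G\<^esub> k \<otimes>\<^bsub>G\<^esub> x \<otimes>\<^bsub>G\<^esub> k \<in> pre K" if k: "k \<in> carrier G" "\<iota> k \<in> normaliser K" and x: "x \<in> pre K" for k x
      proof -
        have "x \<in> carrier G" "\<iota> x \<in> K" using x KG by (auto simp: pre_def)
        then have "\<iota> (inv\<^bsub>G\<^esub> k \<otimes>\<^bsub>G\<^esub> x \<otimes>\<^bsub>G\<^esub> k) \<in> K" using cj\<iota>[OF k(1)] normaliser_cj[OF k(2)] by metis
        moreover then obtain s where "\<iota> (inv\<^bsub>G\<^esub> k \<otimes>\<^bsub>G\<^esub> x \<otimes>\<^bsub>G\<^esub> k) = \<iota> s" "s \<in> S" using H(4) by (auto simp: S'_def)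
        then have "inv\<^bsub>G\<^esub> k \<otimes>\<^bsub>G\<^esub> x \<otimes>\<^bsub>G\<^esub> k = s"
          using inj_onD[OF inj] k(1) \<open>x \<in> carrier G\<close> SG by (meson inv_closed m_closed subsetD)
        ultimately show ?thesis using \<open>s \<in> S\<close> by (simp add: pre_def)
      qed
      have ig: "inv\<^bsub>G\<^esub> g \<in> carrier G" using g by simp
      have gn: "\<iota> g \<in> normaliser K" "\<iota> (inv\<^bsub>G\<^esub> g) \<in> normaliser K"
        using g' g subgrp_inv[OF subgrp_normaliser] by (auto simp: \<iota>_def left_mult_inv)
      \<comment> \<open>Conjugation by k on the preimage of K; the map for the inverse of k supplies
        the inverse that \<open>fusion_aut\<close> demands.\<close>
      define \<alpha> where "\<alpha> k = (\<lambda>x\<in>pre K. inv\<^bsub>G\<^esub> k \<otimes>\<^bsub>G\<^esub> x \<otimes>\<^bsub>G\<^esub> k)" for k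
      have \<alpha>F: "\<alpha> k \<in> fusion_of G S (pre K) (pre K)" if "k \<in> carrier G" "\<iota> k \<in> normaliser K" for k
        using that K conj[OF that] by (auto simp: fusion_of_def \<alpha>_def)
      have "compose (pre K) (\<alpha> (inv\<^bsub>G\<^esub> k)) (\<alpha> k) = (\<lambda>x\<in>pre K. x)"
        if k: "k \<in> carrier G" "\<iota> k \<in> normaliser K" for k
      proof (rule ext)
        fix x
        have "inv\<^bsub>G\<^esub> (inv\<^bsub>G\<^esub> k) \<otimes>\<^bsub>G\<^esub> (inv\<^bsub>G\<^esub> k \<otimes>\<^bsub>G\<^esub> x \<otimes>\<^bsub>G\<^esub> k) \<otimes>\<^bsub>G\<^esub> inv\<^bsub>G\<^esub> k = x" if "x \<in> carrier G"
          using that k(1) by (simp add: m_assoc) (simp flip: m_assoc)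
        then show "compose (pre K) (\<alpha> (inv\<^bsub>G\<^esub> k)) (\<alpha> k) x = (\<lambda>x\<in>pre K. x) x"
          using conj[OF k] KG k(1) by (auto simp: compose_def \<alpha>_def restrict_def)
      qed
      from this[OF g(2) gn(1)] this[OF ig gn(2)]
      have "\<alpha> g \<in> fusion_aut (fusion_of G S) (pre K)"
        using \<alpha>F[OF g(2) gn(1)] \<alpha>F[OF ig gn(2)] g(2) by (auto simp: fusion_aut_def)
      moreover have "pre H \<subseteq> pre K" using H(3) by (auto simp: pre_def)
      ultimately have aH: "\<alpha> g ` pre H = pre H"
        using pre_hyp(2)[OF H(1) HS H(5)] K by (auto simp: semi_invariant_def)
      have "cj g' y \<in> H" if "y \<in> H" for y
      proof -
        have "y \<in> \<iota> ` pre H" using \<open>y \<in> H\<close> pre[OF HS] by simp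
        then obtain x where x: "y = \<iota> x" "x \<in> pre H" by blast
        then have "\<alpha> g x \<in> pre H" using aH by blast
        moreover have "\<alpha> g x = inv\<^bsub>G\<^esub> g \<otimes>\<^bsub>G\<^esub> x \<otimes>\<^bsub>G\<^esub> g" using x \<open>pre H \<subseteq> pre K\<close> by (auto simp: \<alpha>_def)
        ultimately have "\<iota> (inv\<^bsub>G\<^esub> g \<otimes>\<^bsub>G\<^esub> x \<otimes>\<^bsub>G\<^esub> g) \<in> H" by (simp add: pre_def)
        then show ?thesis using x cj\<iota>[OF g(2)] g(1) preS SG by (metis subsetD)
      qed
      then show "g' \<in> normaliser H"
        using HS S' G'(2) by (intro normaliserI) (auto intro: finite_subset)
    qed
  qed (use p G' S' d0 dm in auto)
  obtain T where T0: "T 0 = {1}" and Tm: "\<And>i. i < m \<Longrightarrow> T i \<subseteq> T (Suc i)"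
    and T: "\<And>i. i \<le> m \<Longrightarrow> subgrp (T i) \<and> T i \<subseteq> S' \<and> card (T i) = p ^ i \<and> G' \<inter> normaliser S' \<subseteq> normaliser (T i)"
    using fus.invariant_chain by blast
  define U where "U i = pre (T i)" for i
  have U: "subgroup (U i) G" "U i \<subseteq> S" "card (U i) = p ^ i" if "i \<le> m" for i
    using T[OF that] pre_sub[of "T i"] preS pre_card[of "T i"] by (auto simp: U_def)
  have U0: "U 0 = {\<one>\<^bsub>G\<^esub>}"
  proof -
    have "\<one>\<^bsub>G\<^esub> \<in> U 0" using U(1)[of 0] subgroup.one_closed by blast
    moreover have "card (U 0) = 1" using U(3)[of 0] by simp
    then obtain z where "U 0 = {z}" by (rule card_1_singletonE)
    ultimately show ?thesis by auto
  qed
  have Um: "U m = S"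
    using card_subset_eq[OF finS U(2)[OF order_refl]] U(3)[OF order_refl] S(2) by (simp add: m_def)
  have closed: "strongly_closed (G\<lparr>carrier := S\<rparr>) (fusion_of G S) (U i)" if i: "i \<le> m" for i
    unfolding strongly_closed_def
  proof (intro conjI allI impI ballI)
    show "subgroup (U i) (G\<lparr>carrier := S\<rparr>)" using U[OF i] sub by blast
    fix P \<phi> assume P: "subgroup P (G\<lparr>carrier := S\<rparr>) \<and> P \<subseteq> U i"
      and "\<phi> \<in> fusion_of G S P (carrier (G\<lparr>carrier := S\<rparr>))"
    then obtain g where g: "g \<in> carrier G" "\<phi> = (\<lambda>x\<in>P. inv\<^bsub>G\<^esub> g \<otimes>\<^bsub>G\<^esub> x \<otimes>\<^bsub>G\<^esub> g)" "\<phi> ` P \<subseteq> S"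
      by (auto simp: fusion_of_def)
    have PS: "subgroup P G" "P \<subseteq> S" using P sub by auto
    have PG: "x \<in> carrier G" if "x \<in> P" for x using that PS SG by blast
    have gS: "inv\<^bsub>G\<^esub> g \<otimes>\<^bsub>G\<^esub> x \<otimes>\<^bsub>G\<^esub> g \<in> S" if "x \<in> P" for x using g that by auto
    have "cj (\<iota> g) y \<in> S'" if "y \<in> \<iota> ` P" for y
      using that cj\<iota>[OF g(1) PG] gS by (auto simp: S'_def)
    \<comment> \<open>By control of fusion the morphism is induced by an element of N_G(S), and such
      elements leave every \<open>T i\<close> invariant.\<close>
    then obtain n where n: "n \<in> G' \<inter> normaliser S'" "\<forall>y\<in>\<iota> ` P. cj (\<iota> g) y = cj n y"
      using fus.control_of_fusion[of "\<iota> ` P" "\<iota> g"] subgrp_left_mult_image[OF PS(1)] PS(2) g(1)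
      by (auto simp: \<iota>_def S'_def G'_def)
    show "\<phi> ` P \<subseteq> U i"
    proof
      fix y assume "y \<in> \<phi> ` P"
      then obtain x where x: "y = inv\<^bsub>G\<^esub> g \<otimes>\<^bsub>G\<^esub> x \<otimes>\<^bsub>G\<^esub> g" "x \<in> P" using g(2) by auto
      have "\<iota> x \<in> T i" using x P by (auto simp: U_def pre_def)
      then have "cj n (\<iota> x) \<in> T i" using n T[OF i] by (auto intro: normaliser_cj)
      then have "\<iota> y \<in> T i" using n x cj\<iota>[OF g(1) PG[OF x(2)]] by auto
      then show "y \<in> U i" using gS[OF x(2)] x by (simp add: U_def pre_def)
    qed
  qed
  have quot: "U i \<subseteq> U (Suc i) \<and> U i \<lhd> G\<lparr>carrier := U (Suc i)\<rparr> \<and>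
      cyclic_group (G\<lparr>carrier := U (Suc i)\<rparr> Mod U i)" if i: "i < m" for i
  proof -
    have UU: "U i \<subseteq> U (Suc i)" using Tm[OF i] by (auto simp: U_def pre_def)
    interpret K: group "G\<lparr>carrier := U (Suc i)\<rparr>"
      using U(1)[of "Suc i"] i by (intro subgroup.subgroup_is_group) auto
    have sK: "subgroup (U i) (G\<lparr>carrier := U (Suc i)\<rparr>)"
      using U[of i] U[of "Suc i"] i UU by (intro subgroup_incl) auto
    \<comment> \<open>The criterion for normality used below conjugates as x h x^-1, so
      \<open>cj\<close> is applied with the inverse of x.\<close>
    have "x \<otimes>\<^bsub>G\<^esub> h \<otimes>\<^bsub>G\<^esub> inv\<^bsub>G\<^esub> x \<in> U i" if x: "x \<in> U (Suc i)" and h: "h \<in> U i" for x h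
    proof -
      have xS: "x \<in> S" and hS: "h \<in> S" using x h by (auto simp: U_def pre_def)
      then have ixS: "inv\<^bsub>G\<^esub> x \<in> S" using subgroup.m_inv_closed[OF S(1)] by blast
      have xhx: "x \<otimes>\<^bsub>G\<^esub> h \<otimes>\<^bsub>G\<^esub> inv\<^bsub>G\<^esub> x \<in> S"
        using xS hS ixS subgroup.m_closed[OF S(1)] by blast
      have "\<iota> (inv\<^bsub>G\<^esub> x) \<in> G' \<inter> normaliser S'"
        using ixS S' subgrp_le_normaliser[OF S'(1)] by (auto simp: S'_def)
      then have "cj (\<iota> (inv\<^bsub>G\<^esub> x)) (\<iota> h) \<in> T i"
        using T[of i] i h by (auto simp: U_def pre_def intro: normaliser_cj)
      then have "\<iota> (x \<otimes>\<^bsub>G\<^esub> h \<otimes>\<^bsub>G\<^esub> inv\<^bsub>G\<^esub> x) \<in> T i"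
        using cj\<iota>[of "inv\<^bsub>G\<^esub> x" h] xS hS SG by (auto simp: subset_iff)
      then show ?thesis using xhx by (simp add: U_def pre_def)
    qed
    moreover have "inv\<^bsub>G\<lparr>carrier := U (Suc i)\<rparr>\<^esub> x = inv\<^bsub>G\<^esub> x" if "x \<in> U (Suc i)" for x
      using m_inv_consistent[OF U(1)[of "Suc i"] that] i by simp
    ultimately have nrm: "U i \<lhd> G\<lparr>carrier := U (Suc i)\<rparr>"
      using K.normal_inv_iff sK by auto
    interpret Q: group "G\<lparr>carrier := U (Suc i)\<rparr> Mod U i"
      by (rule normal.factorgroup_is_group[OF nrm])
    have "finite (U (Suc i))" using finite_subset[OF preS finS] by (simp add: U_def)
    then have "card (rcosets\<^bsub>G\<lparr>carrier := U (Suc i)\<rparr>\<^esub> U i) * card (U i) = card (U (Suc i))"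
      using K.lagrange_finite[OF _ sK] by (simp add: order_def)
    then have "order (G\<lparr>carrier := U (Suc i)\<rparr> Mod U i) = p"
      using U(3)[of i] U(3)[of "Suc i"] i prime_gt_0_nat[OF p(1)] by (simp add: order_def FactGroup_def)
    then have "cyclic_group (G\<lparr>carrier := U (Suc i)\<rparr> Mod U i)"
      using Q.cyclic_group_of_prime_order p(1) by simp
    then show ?thesis using UU nrm by blast
  qed
  show ?thesis
    unfolding supersolvable_fusion_def
    using U0 Um closed quot by (intro exI[of _ m] exI[of _ U]) simp
qed

end
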